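(* Let $G$ be a countable group which is hyperbolic relative to a finite collection of subgroups $\mathbb H=\{H_i\}_{i\in I}$, let $\mathbb K\subset\mathbb H$ be a subcollection, and let $\Gamma\subset G$ be a subgroup. Assume that (C0) $\Gamma$ contains every subgroup belonging to $\mathbb K$; (C1) $\Gamma$ is relatively quasiconvex with respect to $\mathbb H$; (C2) $\Gamma$ is weakly malnormal, i.e. $\Gamma\cap g\Gamma g^{-1}$ is finite for every $g\in G\setminus\Gamma$; (C3) $g\Gamma g^{-1}\cap H_i$ is finite for every $g\in G$ and every $H_i\in\mathbb H\setminus\mathbb K$. Then $G$ is hyperbolic relative to $\{\Gamma\}\cup(\mathbb H\setminus\mathbb K)$.
   Context: Let $G$ be a countable group and $\mathbb H=\{H_i\}_{i\in I}$ a finite collection of subgroups. A finite relative generating set for $(G,\mathbb H)$ is a finite set $X\subset G$ (with $X=X^{-1}$, $1\notin X$) such that $X\cup\bigcup_i H_i$ generates $G$. Put $\mathcal H=\bigsqcup_{i\in I}H_i\setminus\{1\}$. The relative Cayley graph $\mathscr G(G,X\cup\mathcal H)$ has vertex set $G$ and an edge labelled $a$ from $g$ to $ga$ for each $g\in G$ and each letter $a\in X\cup\mathcal H$ (letters from different $H_i$ are different labels); edges have length $1$, giving the distance $d_{X\cup\mathcal H}$. For an edge path $p$, $p_-,p_+$ denote its origin and terminus and $\ell(p)$ its length. $p$ is a $(\lambda,c)$-quasigeodesic if $\ell(q)\le\lambda d_{X\cup\mathcal H}(q_-,q_+)+c$ for every subpath $q$ of $p$. An $H_i$-component of $p$ is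 a maximal subpath labelled by letters from $H_i$. Two $H_i$-components $s,t$ (of paths $p,q$) are connected if there is a path $c$ labelled by letters from $H_i$ with $c_-=s_-$, $c_+=t_-$. An $H_i$-component of $p$ is isolated if no other $H_i$-component of $p$ is connected to it; $p$ is without backtracking if all its $H_i$-components (all $i$) are isolated. A metric $d$ on $G$ is proper if bounded sets are finite, and left invariant if $d(gx,gy)=d(x,y)$. $(G,\mathbb H)$ has the bounded coset penetration (BCP) property if for some (any) proper left invariant metric $d_G$ on $G$ and all $\lambda\ge1,c\ge0$ there is a constant $a$ such that for all $(\lambda,c)$-quasigeodesics $p,q$ without backtracking in $\mathscr G(G,X\cup\mathcal H)$ with $p_-=q_-$, $p_+=q_+$: (1) if $s$ is an $H_i$-component of $p$ with $d_G(s_-,s_+)>a$, then there is an $H_i$-component of $q$ connected to $s$; (2) if $s,t$ are connected $H_i$-components of $p,q$, then $d_G(s_-,t_-)<a$ and $d_G(s_+,t_+)<a$. $G$ is hyperbolic relative to $\mathbb H$ if there is a finite relative generating set $X$, the graph $\mathscr G(G,X\cup\mathcal H)$ is (Gromov) hyperbolic, and the BCP property holds. If $G$ is hyperbolic relative to $\mathbb H$, a subgroup $\Gamma\le G$ is relatively quasiconvex with respect to $\mathbb H$ if for some (any) proper left invariant metric $d$ on $G$ there is $\sigma>0$ such that for every geodesic $p$ in $\mathscr G(G,X\cup\mathcal H)$ with $p_-,p_+\in\Gamma$ and every vertex $v$ of $p$ there is $w\in\Gamma$ with $d(v,w)<\sigma$. *)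

theory Defs
  imports
    "HOL-Algebra.Generated_Groups"
    "HOL-Algebra.Coset"
    "HOL-Analysis.Abstract_Metric_Spaces"
    "Graph_Theory.Arc_Walk"
begin

section \<open>Edge paths in graphs\<close>

text \<open>
  An edge path from \<open>u\<close> to \<open>v\<close> is a list of arcs \<open>p\<close> with
  \<open>pre_digraph.awalk D u p v\<close>.  An undirected edge is represented by a pair of opposite arcs, so
  that walks may cross it in both directions.
\<close>

definition path_vert :: "('v, 'e) pre_digraph \<Rightarrow> 'v \<Rightarrow> 'e list \<Rightarrow> nat \<Rightarrow> 'v" where
  "path_vert D u p k = pre_digraph.awalk_verts D u p ! k"

definition subpath :: "'e list \<Rightarrow> nat \<Rightarrow> nat \<Rightarrow> 'e list" where
  "subpath p m n = take (n - m) (drop m p)"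

text \<open>Only meaningful when \<open>v\<close> can be reached from \<open>u\<close>; see \<open>walk_exists\<close> below.\<close>

definition graph_dist :: "('v, 'e) pre_digraph \<Rightarrow> 'v \<Rightarrow> 'v \<Rightarrow> nat" where
  "graph_dist D u v = (LEAST n. \<exists>p. pre_digraph.awalk D u p v \<and> length p = n)"

definition geodesic :: "('v, 'e) pre_digraph \<Rightarrow> 'v \<Rightarrow> 'e list \<Rightarrow> 'v \<Rightarrow> bool" where
  "geodesic D u p v \<longleftrightarrow> pre_digraph.awalk D u p v \<and> length p = graph_dist D u v"

definition quasigeodesic ::
  "('v, 'e) pre_digraph \<Rightarrow> real \<Rightarrow> real \<Rightarrow> 'v \<Rightarrow> 'e list \<Rightarrow> 'v \<Rightarrow> bool" where
  "quasigeodesic D l c u p v \<longleftrightarrow>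
     pre_digraph.awalk D u p v \<and>
     (\<forall>m n. m \<le> n \<and> n \<le> length p \<longrightarrow>
        real (length (subpath p m n))
          \<le> l * real (graph_dist D (path_vert D u p m) (path_vert D u p n)) + c)"

text \<open>
  Gromov hyperbolicity, as uniform slimness of geodesic triangles.  Triangles have their corners at
  vertices, and slimness is tested at vertices; for a connected graph whose edges have length one
  this is the same as slimness in the geometric realization, up to changing \<open>\<delta>\<close>.  Only the
  first side is mentioned in the conclusion since the three corners can be permuted cyclically.
\<close>

definition hyperbolic_graph :: "('v, 'e) pre_digraph \<Rightarrow> bool" where
  "hyperbolic_graph D \<longleftrightarrow>
     (\<exists>\<delta>::real. \<delta> \<ge> 0 \<and>
        (\<forall>x y z p q r. geodesic D x p y \<and> geodesic D y q z \<and> geodesic D z r x \<longrightarrow>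
           (\<forall>v \<in> set (pre_digraph.awalk_verts D x p).
              \<exists>w \<in> set (pre_digraph.awalk_verts D y q) \<union> set (pre_digraph.awalk_verts D z r).
                real (graph_dist D v w) \<le> \<delta>)))"


section \<open>Relative Cayley graphs\<close>

text \<open>
  \<open>Gen x\<close> is the letter of a relative generator, \<open>Per i h\<close> that of an element of the
  \<open>i\<close>-th peripheral subgroup.  Letters of different kinds are different labels, even if they
  represent the same group element.
\<close>

datatype ('i, 'a) letter = Gen 'a | Per 'i 'a

fun letter_val :: "('i, 'a) letter \<Rightarrow> 'a" where
  "letter_val (Gen x) = x"
| "letter_val (Per i h) = h"

definition letters ::
  "('a, 'b) monoid_scheme \<Rightarrow> 'i set \<Rightarrow> ('i \<Rightarrow> 'a set) \<Rightarrow> 'a set \<Rightarrow> ('i, 'a) letter set" where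
  "letters G I H X = Gen ` X \<union> (\<Union>i\<in>I. Per i ` (H i - {\<one>\<^bsub>G\<^esub>}))"

definition rel_cayley_graph ::
  "('a, 'b) monoid_scheme \<Rightarrow> 'i set \<Rightarrow> ('i \<Rightarrow> 'a set) \<Rightarrow> 'a set
     \<Rightarrow> ('a, 'a \<times> ('i, 'a) letter) pre_digraph" where
  "rel_cayley_graph G I H X =
     \<lparr> verts = carrier G,
       arcs = carrier G \<times> letters G I H X,
       tail = fst,
       head = (\<lambda>(g, a). g \<otimes>\<^bsub>G\<^esub> letter_val a) \<rparr>"

definition finite_rel_generating_set ::
  "('a, 'b) monoid_scheme \<Rightarrow> 'i set \<Rightarrow> ('i \<Rightarrow> 'a set) \<Rightarrow> 'a set \<Rightarrow> bool" where
  "finite_rel_generating_set G I H X \<longleftrightarrow>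
     finite X \<and> X \<subseteq> carrier G \<and> (\<lambda>x. inv\<^bsub>G\<^esub> x) ` X = X \<and> \<one>\<^bsub>G\<^esub> \<notin> X \<and>
     generate G (X \<union> (\<Union>i\<in>I. H i)) = carrier G"

text \<open>In \<open>component i p m n\<close>, the component is \<open>subpath p m n\<close>, that is, the part of \<open>p\<close>
  between its vertices number \<open>m\<close> and \<open>n\<close>.\<close>

definition labelled_by :: "'i \<Rightarrow> ('a \<times> ('i, 'a) letter) list \<Rightarrow> bool" where
  "labelled_by i p \<longleftrightarrow> (\<forall>e \<in> set p. \<exists>h. snd e = Per i h)"

definition component :: "'i \<Rightarrow> ('a \<times> ('i, 'a) letter) list \<Rightarrow> nat \<Rightarrow> nat \<Rightarrow> bool" where
  "component i p m n \<longleftrightarrow>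
     m < n \<and> n \<le> length p \<and> labelled_by i (subpath p m n) \<and>
     (\<forall>m' n'. m' \<le> m \<and> n \<le> n' \<and> n' \<le> length p \<and> labelled_by i (subpath p m' n')
        \<longrightarrow> m' = m \<and> n' = n)"

text \<open>To be applied to the origins of two components.\<close>

definition coset_connected ::
  "('a, 'a \<times> ('i, 'a) letter) pre_digraph \<Rightarrow> 'i \<Rightarrow> 'a \<Rightarrow> 'a \<Rightarrow> bool" where
  "coset_connected D i v w \<longleftrightarrow> (\<exists>c. pre_digraph.awalk D v c w \<and> labelled_by i c)"

definition isolated ::
  "('a, 'a \<times> ('i, 'a) letter) pre_digraph \<Rightarrow> 'i \<Rightarrow> 'a \<Rightarrow> ('a \<times> ('i, 'a) letter) list
     \<Rightarrow> nat \<Rightarrow> nat \<Rightarrow> bool" where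
  "isolated D i u p m n \<longleftrightarrow>
     (\<forall>m' n'. component i p m' n' \<and> (m', n') \<noteq> (m, n) \<longrightarrow>
        \<not> coset_connected D i (path_vert D u p m) (path_vert D u p m'))"

definition without_backtracking ::
  "('a, 'a \<times> ('i, 'a) letter) pre_digraph \<Rightarrow> 'a \<Rightarrow> ('a \<times> ('i, 'a) letter) list \<Rightarrow> bool" where
  "without_backtracking D u p \<longleftrightarrow> (\<forall>i m n. component i p m n \<longrightarrow> isolated D i u p m n)"


section \<open>Relative hyperbolicity\<close>

definition proper_left_inv_metric ::
  "('a, 'b) monoid_scheme \<Rightarrow> ('a \<Rightarrow> 'a \<Rightarrow> real) \<Rightarrow> bool" where
  "proper_left_inv_metric G d \<longleftrightarrow>
     Metric_space (carrier G) d \<and>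
     (\<forall>S. Metric_space.mbounded (carrier G) d S \<longrightarrow> finite S) \<and>
     (\<forall>g \<in> carrier G. \<forall>x \<in> carrier G. \<forall>y \<in> carrier G. d (g \<otimes>\<^bsub>G\<^esub> x) (g \<otimes>\<^bsub>G\<^esub> y) = d x y)"

definition BCP ::
  "('a, 'b) monoid_scheme \<Rightarrow> 'i set \<Rightarrow> ('i \<Rightarrow> 'a set) \<Rightarrow> 'a set \<Rightarrow> bool" where
  "BCP G I H X \<longleftrightarrow>
     (let D = rel_cayley_graph G I H X in
      \<exists>d. proper_left_inv_metric G d \<and>
       (\<forall>l c :: real. l \<ge> 1 \<and> c \<ge> 0 \<longrightarrow>
         (\<exists>a::real. \<forall>u v p q.
            quasigeodesic D l c u p v \<and> without_backtracking D u p \<and>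
            quasigeodesic D l c u q v \<and> without_backtracking D u q \<longrightarrow>
            (\<forall>i \<in> I. \<forall>m n.
               component i p m n \<and> d (path_vert D u p m) (path_vert D u p n) > a \<longrightarrow>
               (\<exists>m' n'. component i q m' n' \<and>
                  coset_connected D i (path_vert D u p m) (path_vert D u q m'))) \<and>
            (\<forall>i \<in> I. \<forall>m n m' n'.
               component i p m n \<and> component i q m' n' \<and>
               coset_connected D i (path_vert D u p m) (path_vert D u q m') \<longrightarrow>
               d (path_vert D u p m) (path_vert D u q m') < a \<and>
               d (path_vert D u p n) (path_vert D u q n') < a))))"

definition hyperbolic_relative_wrt ::
  "('a, 'b) monoid_scheme \<Rightarrow> 'i set \<Rightarrow> ('i \<Rightarrow> 'a set) \<Rightarrow> 'a set \<Rightarrow> bool" where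
  "hyperbolic_relative_wrt G I H X \<longleftrightarrow>
     finite_rel_generating_set G I H X \<and>
     hyperbolic_graph (rel_cayley_graph G I H X) \<and>
     BCP G I H X"

definition hyperbolic_relative_to ::
  "('a, 'b) monoid_scheme \<Rightarrow> 'i set \<Rightarrow> ('i \<Rightarrow> 'a set) \<Rightarrow> bool" where
  "hyperbolic_relative_to G I H \<longleftrightarrow> (\<exists>X. hyperbolic_relative_wrt G I H X)"

text \<open>The generating set \<open>X\<close> is one that witnesses relative hyperbolicity.\<close>

definition relatively_quasiconvex ::
  "('a, 'b) monoid_scheme \<Rightarrow> 'i set \<Rightarrow> ('i \<Rightarrow> 'a set) \<Rightarrow> 'a set \<Rightarrow> bool" where
  "relatively_quasiconvex G I H \<Gamma> \<longleftrightarrow>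
     subgroup \<Gamma> G \<and>
     (\<exists>X. hyperbolic_relative_wrt G I H X \<and>
       (let D = rel_cayley_graph G I H X in
        \<exists>d. proper_left_inv_metric G d \<and>
         (\<exists>\<sigma>::real. \<sigma> > 0 \<and>
           (\<forall>u \<in> \<Gamma>. \<forall>v \<in> \<Gamma>. \<forall>p. geodesic D u p v \<longrightarrow>
             (\<forall>x \<in> set (pre_digraph.awalk_verts D u p). \<exists>w \<in> \<Gamma>. d x w < \<sigma>)))))"

definition conjugate_set :: "('a, 'b) monoid_scheme \<Rightarrow> 'a \<Rightarrow> 'a set \<Rightarrow> 'a set" where
  "conjugate_set G g S = (g <#\<^bsub>G\<^esub> S) #>\<^bsub>G\<^esub> (inv\<^bsub>G\<^esub> g)"

definition weakly_malnormal :: "('a, 'b) monoid_scheme \<Rightarrow> 'a set \<Rightarrow> bool" where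
  "weakly_malnormal G \<Gamma> \<longleftrightarrow>
     (\<forall>g \<in> carrier G - \<Gamma>. finite (\<Gamma> \<inter> conjugate_set G g \<Gamma>))"


section \<open>Basic properties of relative Cayley graphs\<close>

lemma letter_val_in_carrier:
  assumes "\<And>i. i \<in> I \<Longrightarrow> subgroup (H i) G" "X \<subseteq> carrier G" "a \<in> letters G I H X"
  shows "letter_val a \<in> carrier G"
  using assms by (force simp: letters_def dest: subgroup.mem_carrier)

lemma walk_append:
  assumes "pre_digraph.awalk D u p v" "pre_digraph.awalk D v q w"
  shows "pre_digraph.awalk D u (p @ q) w"
proof -
  have "pre_digraph.cas D u p v \<Longrightarrow> pre_digraph.cas D v q w \<Longrightarrow> pre_digraph.cas D u (p @ q) w"
    by (induction p arbitrary: u) (auto simp: pre_digraph.cas.simps)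
  with assms show ?thesis by (auto simp: pre_digraph.awalk_def)
qed

lemma walk_letter:
  assumes "g \<in> carrier G" "a \<in> letters G I H X"
  shows "pre_digraph.awalk (rel_cayley_graph G I H X) g [(g, a)] (g \<otimes>\<^bsub>G\<^esub> letter_val a)"
  using assms by (auto simp: pre_digraph.awalk_def pre_digraph.cas.simps rel_cayley_graph_def)

text \<open>Every arc has an opposite one, and the graph is connected.\<close>

lemma inverse_letter:
  assumes G: "group G" and H: "\<And>i. i \<in> I \<Longrightarrow> subgroup (H i) G"
    and X: "finite_rel_generating_set G I H X" and a: "a \<in> letters G I H X"
  obtains b where "b \<in> letters G I H X" "letter_val b = inv\<^bsub>G\<^esub> (letter_val a)"
proof -
  interpret group G by fact
  from a consider (gen) x where "a = Gen x" "x \<in> X"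
    | (per) i h where "a = Per i h" "i \<in> I" "h \<in> H i" "h \<noteq> \<one>\<^bsub>G\<^esub>"
    by (auto simp: letters_def)
  then show thesis
  proof cases
    case gen
    then have "inv\<^bsub>G\<^esub> x \<in> X" using X by (auto simp: finite_rel_generating_set_def)
    then have "Gen (inv\<^bsub>G\<^esub> x) \<in> letters G I H X" by (auto simp: letters_def)
    then show ?thesis using that gen by force
  next
    case per
    interpret subgroup "H i" G by (rule H) fact
    have "inv\<^bsub>G\<^esub> h \<in> H i" "inv\<^bsub>G\<^esub> h \<noteq> \<one>\<^bsub>G\<^esub>" using per by auto
    then have "Per i (inv\<^bsub>G\<^esub> h) \<in> letters G I H X"
      unfolding letters_def using per(2) by blast
    then show ?thesis using that per by force
  qed
qed

lemma walk_exists: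
  assumes G: "group G" and H: "\<And>i. i \<in> I \<Longrightarrow> subgroup (H i) G"
    and X: "finite_rel_generating_set G I H X"
    and u: "u \<in> carrier G" and v: "v \<in> carrier G"
  shows "\<exists>p. pre_digraph.awalk (rel_cayley_graph G I H X) u p v"
proof -
  interpret group G by fact
  let ?D = "rel_cayley_graph G I H X" and ?S = "X \<union> (\<Union>i\<in>I. H i)"
  have XC: "X \<subseteq> carrier G" and gen: "generate G ?S = carrier G"
    using X by (auto simp: finite_rel_generating_set_def)
  have S: "?S \<subseteq> carrier G" using XC H by (auto dest: subgroup.mem_carrier)
  have nil: "\<exists>p. pre_digraph.awalk ?D g p g" if "g \<in> carrier G" for g
    using that by (intro exI[of _ "[]"])
      (auto simp: pre_digraph.awalk_def pre_digraph.cas.simps rel_cayley_graph_def)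
  have letter: "s = \<one>\<^bsub>G\<^esub> \<or> (\<exists>a \<in> letters G I H X. letter_val a = s)" if "s \<in> ?S" for s
  proof (cases "s \<in> X")
    case True
    then have "Gen s \<in> letters G I H X" by (auto simp: letters_def)
    then show ?thesis by force
  next
    case False
    then obtain i where "i \<in> I" "s \<in> H i" using \<open>s \<in> ?S\<close> by auto
    then have "s = \<one>\<^bsub>G\<^esub> \<or> Per i s \<in> letters G I H X" by (auto simp: letters_def)
    then show ?thesis by force
  qed
  have "\<exists>p. pre_digraph.awalk ?D g p (g \<otimes>\<^bsub>G\<^esub> x)" if "x \<in> generate G ?S" "g \<in> carrier G" for x g
    using that
  proof (induction x arbitrary: g rule: generate.induct)
    case one
    then show ?case using nil by simp
  next
    case (incl s)
    from letter[OF incl(1)] show ?case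
      using nil incl(2) walk_letter[OF incl(2)] by fastforce
  next
    case (inv s)
    from letter[OF inv(1)] show ?case
    proof
      assume "s = \<one>\<^bsub>G\<^esub>"
      then show ?thesis using nil inv(2) by simp
    next
      assume "\<exists>a \<in> letters G I H X. letter_val a = s"
      then obtain b where "b \<in> letters G I H X" "letter_val b = inv\<^bsub>G\<^esub> s"
        using inverse_letter[OF G H X] by metis
      then show ?thesis using walk_letter[OF inv(2)] by metis
    qed
  next
    case (eng x y)
    have xy: "x \<in> carrier G" "y \<in> carrier G" using eng(1,2) gen by auto
    obtain p where p: "pre_digraph.awalk ?D g p (g \<otimes>\<^bsub>G\<^esub> x)" using eng by blast
    obtain q where "pre_digraph.awalk ?D (g \<otimes>\<^bsub>G\<^esub> x) q (g \<otimes>\<^bsub>G\<^esub> x \<otimes>\<^bsub>G\<^esub> y)"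
      using eng.IH(2)[of "g \<otimes>\<^bsub>G\<^esub> x"] eng.prems xy by auto
    from walk_append[OF p this] show ?case using eng.prems xy by (auto simp: m_assoc)
  qed
  from this[of "inv\<^bsub>G\<^esub> u \<otimes>\<^bsub>G\<^esub> v" u] show ?thesis
    using u v gen by (simp add: m_assoc[symmetric])
qed

end

theory Submission
  imports Defs "HOL-Real_Asymp.Real_Asymp"
begin

text \<open>
  Let \<open>D\<close> be the graph distance of the relative Cayley graph for \<open>H\<close>, and \<open>D'\<close> that of the graph for
  the new family, which consists of \<open>\<Gamma>\<close> and the \<open>H i\<close> with \<open>i \<in> I - J\<close>, built with the same finite
  set \<open>X\<close>.  The second graph arises from the first by turning every coset of \<open>\<Gamma>\<close> into a complete graph, so \<open>D' \<le> D\<close>.  Let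
  \<open>d\<close> be a proper left invariant metric on the group.

  Bounded coset penetration is used only through a statement about short loops, the predicate
  \<open>fine_wrt\<close>: a path of length at most \<open>N\<close> that joins two points of a peripheral coset \<open>C\<close> without
  using an edge of \<open>C\<close> has endpoints at \<open>d\<close>-distance bounded in terms of \<open>N\<close>.  One direction
  (\<open>BCP_imp_fine\<close>) is cheap, since a walk of length at most \<open>N\<close> is a \<open>(1, N)\<close>-quasigeodesic, and a
  shortest one has no backtracking.  For the other direction one needs that quasigeodesics with
  common endpoints fellow-travel: near a coset \<open>C\<close>, two of them and two short connecting paths form
  a loop of bounded length (\<open>stable_relative_graph.BCP\<close>).

  Fellow-travelling in \<open>D'\<close>, and with it the hyperbolicity of \<open>D'\<close>, comes from \<open>D\<close>: the geodesics of
  \<open>D\<close> form thin triangles for \<open>D'\<close>, and since \<open>\<Gamma>\<close> is quasiconvex, a geodesic of \<open>D\<close> with \<open>D'\<close>-adjacent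
  endpoints has bounded \<open>D'\<close>-diameter.  The usual argument (bisection gives a logarithmic bound on
  the distance from a geodesic of \<open>D\<close> to any path, and a linear bound from the quasigeodesic
  inequality beats it) shows that every quasigeodesic of \<open>D'\<close> stays \<open>D'\<close>-close to the geodesics of
  \<open>D\<close> with the same endpoints (\<open>interval_near_quasi_seq\<close>, \<open>quasi_seq_near_interval\<close>).

  What remains is the statement about short loops in \<open>D'\<close>.  It is proved by following a nearest-point
  projection along the loop: if each edge that is not in the coset under consideration moves the
  projection by a \<open>d\<close>-bounded amount, then so does the whole loop, while the endpoints are their own
  projections.  For a coset of a remaining \<open>H i\<close> this follows from the fact that a geodesic of \<open>D\<close>
  that has no edge in the coset has \<open>d\<close>-bounded projection (\<open>proj_bounded_if_meets_once\<close>), and from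
  the finiteness of \<open>g \<Gamma> g\<inverse> \<inter> H i\<close>.  For a coset of \<open>\<Gamma>\<close> (\<open>nearest_bounded\<close>) one first bounds the
  \<open>D\<close>-distance of the projections, because distinct cosets of \<open>\<Gamma>\<close> cannot fellow-travel in \<open>D\<close>: if they
  did, they would come \<open>d\<close>-close to each other at two distant places (\<open>metric_close_points\<close>), against
  weak malnormality.  Then every edge between the two projections is \<open>d\<close>-bounded, since it is either
  in the coarse intersection of two distinct cosets or can be projected along the other three
  sides of a quadrilateral.
\<close>

section \<open>Discrete geodesic spaces\<close>

text \<open>The path metric on the vertices of a connected graph, axiomatized without mentioning paths.\<close>

locale discrete_geodesic_space =
  fixes V :: "'a set" and D :: "'a \<Rightarrow> 'a \<Rightarrow> nat"
  assumes dist_eq_0: "\<lbrakk>x \<in> V; y \<in> V\<rbrakk> \<Longrightarrow> D x y = 0 \<longleftrightarrow> x = y"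
    and sym: "\<lbrakk>x \<in> V; y \<in> V\<rbrakk> \<Longrightarrow> D x y = D y x"
    and tri: "\<lbrakk>x \<in> V; y \<in> V; z \<in> V\<rbrakk> \<Longrightarrow> D x z \<le> D x y + D y z"
    and between: "\<lbrakk>x \<in> V; y \<in> V; k \<le> D x y\<rbrakk> \<Longrightarrow> \<exists>w\<in>V. D x w = k \<and> D w y = D x y - k"
begin

text \<open>The union of all geodesics from \<open>x\<close> to \<open>y\<close>.  Arguments about geodesics that do not depend on the
  order of the points are made with this set, which needs no choice of a geodesic.\<close>

definition interval :: "'a \<Rightarrow> 'a \<Rightarrow> 'a set" where
  "interval x y = {v \<in> V. D x v + D v y = D x y}"

definition geodesic_seq :: "(nat \<Rightarrow> 'a) \<Rightarrow> nat \<Rightarrow> bool" where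
  "geodesic_seq g n \<longleftrightarrow> (\<forall>k\<le>n. g k \<in> V) \<and> (\<forall>j k. j \<le> k \<longrightarrow> k \<le> n \<longrightarrow> D (g j) (g k) = k - j)"

lemma dist_self [simp]: "x \<in> V \<Longrightarrow> D x x = 0"
  using dist_eq_0 by blast

lemma interval_V: "v \<in> interval x y \<Longrightarrow> v \<in> V"
  by (auto simp: interval_def)

lemma interval_ends: "\<lbrakk>x \<in> V; y \<in> V\<rbrakk> \<Longrightarrow> x \<in> interval x y" "\<lbrakk>x \<in> V; y \<in> V\<rbrakk> \<Longrightarrow> y \<in> interval x y"
  by (auto simp: interval_def)

lemma interval_commute: "\<lbrakk>x \<in> V; y \<in> V\<rbrakk> \<Longrightarrow> interval x y = interval y x"
  using sym by (auto simp: interval_def)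

lemma interval_self: "x \<in> V \<Longrightarrow> interval x x = {x}"
  using dist_eq_0 by (auto simp: interval_def)

lemma interval_dist_le:
  assumes "v \<in> interval x y"
  shows "D x v \<le> D x y" "D v y \<le> D x y"
  using assms by (auto simp: interval_def)

lemma subinterval:
  assumes "x \<in> V" "y \<in> V" "v \<in> interval x y"
  shows "interval x v \<subseteq> interval x y" "interval v y \<subseteq> interval x y"
proof -
  have v: "v \<in> V" "D x v + D v y = D x y" using assms by (auto simp: interval_def)
  show "interval x v \<subseteq> interval x y"
  proof
    fix u assume "u \<in> interval x v"
    then have u: "u \<in> V" "D x u + D u v = D x v" by (auto simp: interval_def)
    have "D u y \<le> D u v + D v y" "D x y \<le> D x u + D u y" using tri u v assms by auto
    then show "u \<in> interval x y" using u v by (auto simp: interval_def)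
  qed
  show "interval v y \<subseteq> interval x y"
  proof
    fix u assume "u \<in> interval v y"
    then have u: "u \<in> V" "D v u + D u y = D v y" by (auto simp: interval_def)
    have "D x u \<le> D x v + D v u" "D x y \<le> D x u + D u y" using tri u v assms by auto
    then show "u \<in> interval x y" using u v by (auto simp: interval_def)
  qed
qed

text \<open>Segments of geodesics are geodesics.\<close>

lemma interval_split:
  assumes "x \<in> V" "y \<in> V" "w \<in> interval x y" "u \<in> interval x w" "v \<in> interval w y"
  shows "w \<in> interval u v"
proof -
  have w: "w \<in> V" "D x w + D w y = D x y" and u: "u \<in> V" "D x u + D u w = D x w"
    and v: "v \<in> V" "D w v + D v y = D w y" using assms by (auto simp: interval_def)
  have "D u v \<le> D u w + D w v" "D x y \<le> D x u + D u y" "D u y \<le> D u v + D v y"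
    using tri u v w assms by auto
  then show ?thesis using u v w by (auto simp: interval_def)
qed

lemma between_interval:
  assumes "x \<in> V" "y \<in> V" "k \<le> D x y"
  obtains w where "w \<in> interval x y" "D x w = k" "D w y = D x y - k"
  using between[OF assms] assms(3) by (auto simp: interval_def)

lemma geodesic_seqD:
  assumes "geodesic_seq g n"
  shows "k \<le> n \<Longrightarrow> g k \<in> V" "j \<le> k \<Longrightarrow> k \<le> n \<Longrightarrow> D (g j) (g k) = k - j"
  using assms by (auto simp: geodesic_seq_def)

lemma geodesic_seq_interval:
  assumes "geodesic_seq g n" "k \<le> n"
  shows "g k \<in> interval (g 0) (g n)"
  using assms by (auto simp: geodesic_seq_def interval_def)

lemma geodesic_exists:
  assumes "x \<in> V" "y \<in> V"
  obtains g where "geodesic_seq g (D x y)" "g 0 = x" "g (D x y) = y"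
proof -
  have "\<exists>g. geodesic_seq g n \<and> g 0 = x \<and> g n = y" if "D x y = n" "y \<in> V" for n y
    using that
  proof (induction n arbitrary: y)
    case 0
    then have "x = y" using assms dist_eq_0 by blast
    then show ?case using assms by (intro exI[of _ "\<lambda>_. x"]) (auto simp: geodesic_seq_def)
  next
    case (Suc n)
    then obtain w where w: "w \<in> V" "D x w = n" "D w y = 1"
      using between[of x y n] assms by auto
    then obtain g where g: "geodesic_seq g n" "g 0 = x" "g n = w" using Suc.IH by blast
    let ?g = "g(Suc n := y)"
    have *: "D (g j) y = Suc n - j" if "j \<le> n" for j
    proof -
      have gj: "g j \<in> V" "D (g j) w = n - j" "D x (g j) = j"
        using g that geodesic_seqD[OF g(1), of j] geodesic_seqD(2)[OF g(1), of j n]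
          geodesic_seqD(2)[OF g(1), of 0 j] by auto
      have "D (g j) y \<le> D (g j) w + D w y" "D x y \<le> D x (g j) + D (g j) y"
        using gj w(1) Suc.prems assms by (blast intro: tri)+
      then show ?thesis using gj w Suc.prems that by linarith
    qed
    have "geodesic_seq ?g (Suc n)"
      using g(1) * Suc.prems by (auto simp: geodesic_seq_def le_Suc_eq)
    moreover have "?g 0 = x" "?g (Suc n) = y" using g by auto
    ultimately show ?case by blast
  qed
  then show ?thesis using assms that by blast
qed

lemma geodesic_seq_rev:
  assumes "geodesic_seq g n"
  shows "geodesic_seq (\<lambda>k. g (n - k)) n"
  unfolding geodesic_seq_def
proof (intro conjI allI impI)
  fix j k assume jk: "j \<le> k" "k \<le> n"
  have "D (g (n - k)) (g (n - j)) = (n - j) - (n - k)"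
    using jk by (intro geodesic_seqD(2)[OF assms]) auto
  moreover have "D (g (n - k)) (g (n - j)) = D (g (n - j)) (g (n - k))"
    using geodesic_seqD(1)[OF assms] by (intro sym) auto
  ultimately show "D (g (n - j)) (g (n - k)) = k - j" using jk by auto
qed (use geodesic_seqD(1)[OF assms] in auto)

end

text \<open>One of the sides of a triangle is a given geodesic rather than an interval, because later a segment
  of that geodesic is used as part of a path.\<close>

locale slim_space = discrete_geodesic_space +
  fixes \<delta> :: nat
  assumes slim_seq: "\<lbrakk>x \<in> V; y \<in> V; z \<in> V; v \<in> interval x y; geodesic_seq g n; g 0 = y; g n = z\<rbrakk>
    \<Longrightarrow> (\<exists>k\<le>n. D v (g k) \<le> \<delta>) \<or> (\<exists>w\<in>interval z x. D v w \<le> \<delta>)"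
begin

lemma slim:
  assumes "x \<in> V" "y \<in> V" "z \<in> V" "v \<in> interval x y"
  shows "\<exists>w \<in> interval x z \<union> interval z y. D v w \<le> \<delta>"
proof -
  obtain g where g: "geodesic_seq g (D y z)" "g 0 = y" "g (D y z) = z"
    using geodesic_exists assms by metis
  from slim_seq[OF assms g] show ?thesis
    using geodesic_seq_interval[OF g(1)] g interval_commute assms by fastforce
qed

lemma slim_quad:
  assumes "a \<in> V" "b \<in> V" "x \<in> V" "y \<in> V" "v \<in> interval a b"
  shows "\<exists>w \<in> interval a x \<union> interval x y \<union> interval y b. D v w \<le> 2 * \<delta>"
proof -
  have v: "v \<in> V" using assms interval_V by blast
  obtain w where w: "w \<in> interval a x \<union> interval x b" "D v w \<le> \<delta>"
    using slim[of a b x] assms by blast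
  then consider "w \<in> interval a x" | "w \<in> interval x b" by blast
  then show ?thesis
  proof cases
    case 1 then show ?thesis using w by (intro bexI[of _ w]) auto
  next
    case 2
    then obtain u where u: "u \<in> interval x y \<union> interval y b" "D w u \<le> \<delta>"
      using slim[of x b y] assms by blast
    have "D v u \<le> D v w + D w u" using tri v w u interval_V by blast
    then show ?thesis using w u by (intro bexI[of _ u]) auto
  qed
qed

end

section \<open>Stability of quasigeodesics after coning\<close>

text \<open>\<open>D'\<close> stands for the distance after adding edges to the graph of \<open>D\<close>.  The last assumption says that
  the sets that have become cliques were quasiconvex.\<close>

locale coned_space = slim_space V D \<delta> + coned: discrete_geodesic_space V D'
  for V :: "'a set" and D D' :: "'a \<Rightarrow> 'a \<Rightarrow> nat" and \<delta> :: nat +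
  fixes h :: nat
  assumes coned_le: "\<lbrakk>x \<in> V; y \<in> V\<rbrakk> \<Longrightarrow> D' x y \<le> D x y"
    and interval_bounded: "\<lbrakk>x \<in> V; y \<in> V; D' x y \<le> 1; v \<in> interval x y\<rbrakk> \<Longrightarrow> D' x v \<le> h"
begin

text \<open>Bisect the path: each of the \<open>e\<close> bisections costs one application of slimness for \<open>D\<close>, hence \<open>\<delta>\<close>
  also for the smaller distance \<open>D'\<close>, and the last pieces are single steps.\<close>

lemma dyadic_tracking:
  assumes "\<And>k. m \<le> k \<Longrightarrow> k \<le> n \<Longrightarrow> f k \<in> V" "\<And>k. m \<le> k \<Longrightarrow> k < n \<Longrightarrow> D' (f k) (f (Suc k)) \<le> 1"
    and "m \<le> n" "n - m \<le> 2 ^ e" "v \<in> interval (f m) (f n)"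
  shows "\<exists>j\<in>{m..n}. D' v (f j) \<le> h + \<delta> * e"
  using assms
proof (induction e arbitrary: m n v)
  case 0
  have V: "f m \<in> V" "f n \<in> V" "v \<in> V" using 0 interval_V by auto
  have "n = m \<or> n = Suc m" using 0 by auto
  then have "D' (f m) (f n) \<le> 1" using 0 V by auto
  then have "D' (f m) v \<le> h" using interval_bounded V 0 by blast
  then show ?case using coned.sym V 0 by (intro bexI[of _ m]) auto
next
  case (Suc e)
  define k where "k = (m + n) div 2"
  have k: "m \<le> k" "k \<le> n" "k - m \<le> 2 ^ e" "n - k \<le> 2 ^ e" using Suc.prems(3,4) by (auto simp: k_def)
  have V: "f m \<in> V" "f n \<in> V" "f k \<in> V" "v \<in> V" using Suc.prems k interval_V by auto
  obtain w where w: "w \<in> interval (f m) (f k) \<union> interval (f k) (f n)" "D v w \<le> \<delta>"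
    using slim[OF V(1,2,3) Suc.prems(5)] by blast
  have wV: "w \<in> V" using w interval_V by auto
  have "\<exists>j\<in>{m..n}. D' w (f j) \<le> h + \<delta> * e"
  proof (cases "w \<in> interval (f m) (f k)")
    case True
    have "\<exists>j\<in>{m..k}. D' w (f j) \<le> h + \<delta> * e"
      by (rule Suc.IH) (use Suc.prems k True in auto)
    then show ?thesis using k by fastforce
  next
    case False
    have "\<exists>j\<in>{k..n}. D' w (f j) \<le> h + \<delta> * e"
      by (rule Suc.IH) (use Suc.prems k False w in auto)
    then show ?thesis using k by fastforce
  qed
  then obtain j where j: "j \<in> {m..n}" "D' w (f j) \<le> h + \<delta> * e" by blast
  have "f j \<in> V" using Suc.prems j by auto
  then have "D' v (f j) \<le> D' v w + D' w (f j)" "D' v w \<le> D v w"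
    using coned.tri coned_le V wV by auto
  then show ?case using j w by (intro bexI[of _ j]) auto
qed

definition quasi_seq :: "nat \<Rightarrow> nat \<Rightarrow> (nat \<Rightarrow> 'a) \<Rightarrow> nat \<Rightarrow> bool" where
  "quasi_seq l c f n \<longleftrightarrow> (\<forall>k\<le>n. f k \<in> V) \<and> (\<forall>k<n. D' (f k) (f (Suc k)) \<le> 1) \<and>
     (\<forall>i j. i \<le> j \<longrightarrow> j \<le> n \<longrightarrow> j - i \<le> l * D' (f i) (f j) + c)"

lemma quasi_seqD:
  assumes "quasi_seq l c f n"
  shows "k \<le> n \<Longrightarrow> f k \<in> V" "k < n \<Longrightarrow> D' (f k) (f (Suc k)) \<le> 1"
    "i \<le> j \<Longrightarrow> j \<le> n \<Longrightarrow> j - i \<le> l * D' (f i) (f j) + c"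
  using assms by (auto simp: quasi_seq_def)

text \<open>Along a geodesic of \<open>D\<close> the distance \<open>D'\<close> changes by at most one per step, so no value is skipped.\<close>

lemma exit_point:
  assumes "x \<in> V" "w \<in> V" "r < D' x w"
  obtains u where "u \<in> interval x w" "D' u w = r"
proof -
  obtain g where g: "geodesic_seq g (D x w)" "g 0 = x" "g (D x w) = w"
    using geodesic_exists assms by metis
  define k where "k = (GREATEST k. k \<le> D x w \<and> r \<le> D' (g k) w)"
  have ex: "0 \<le> D x w \<and> r \<le> D' (g 0) w" using assms g by auto
  have bd: "\<And>k. k \<le> D x w \<and> r \<le> D' (g k) w \<Longrightarrow> k \<le> D x w" by auto
  have k: "k \<le> D x w" "r \<le> D' (g k) w"
    using GreatestI_nat[where P = "\<lambda>k. k \<le> D x w \<and> r \<le> D' (g k) w", OF ex bd] unfolding k_def by auto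
  have gV: "g j \<in> V" if "j \<le> D x w" for j using geodesic_seqD(1)[OF g(1)] that by auto
  have "D' (g k) w \<le> r"
  proof (cases "k = D x w")
    case True then show ?thesis using g assms by auto
  next
    case False
    then have "Suc k \<le> D x w" using k by auto
    have "\<not> r \<le> D' (g (Suc k)) w"
    proof
      assume "r \<le> D' (g (Suc k)) w"
      then have "Suc k \<le> k" unfolding k_def
        using \<open>Suc k \<le> D x w\<close> k_def by (intro Greatest_le_nat[where b = "D x w"]) auto
      then show False by simp
    qed
    moreover have "D' (g k) w \<le> D' (g k) (g (Suc k)) + D' (g (Suc k)) w"
      using coned.tri gV \<open>Suc k \<le> D x w\<close> assms by auto
    moreover have "D' (g k) (g (Suc k)) \<le> 1"
      using coned_le[of "g k" "g (Suc k)"] gV \<open>Suc k \<le> D x w\<close> geodesic_seqD(2)[OF g(1), of k "Suc k"]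
      by auto
    ultimately show ?thesis by linarith
  qed
  then show ?thesis using that[of "g k"] k geodesic_seq_interval[OF g(1), of k] g by auto
qed

lemma interval_near_coned_geodesic:
  assumes "x \<in> V" "y \<in> V" "D' x y \<le> 2 ^ e" "v \<in> interval x y"
  shows "D' x v \<le> D' x y + h + \<delta> * e"
proof -
  obtain g where g: "coned.geodesic_seq g (D' x y)" "g 0 = x" "g (D' x y) = y"
    using coned.geodesic_exists assms by metis
  note gd = coned.geodesic_seqD[OF g(1)]
  have "\<exists>j\<in>{0..D' x y}. D' v (g j) \<le> h + \<delta> * e"
  proof (rule dyadic_tracking)
    show "D' (g k) (g (Suc k)) \<le> 1" if "0 \<le> k" "k < D' x y" for k
      using gd(2)[of k "Suc k"] that by simp
  qed (use gd g assms in auto)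
  then obtain j where j: "j \<le> D' x y" "D' v (g j) \<le> h + \<delta> * e" by auto
  have V: "v \<in> V" "g j \<in> V" using assms interval_V gd j by auto
  have "D' x (g j) = j" using gd(2)[of 0 j] j g by auto
  moreover have "D' x v \<le> D' x (g j) + D' (g j) v" using coned.tri V assms by auto
  moreover have "D' (g j) v = D' v (g j)" using coned.sym V by auto
  ultimately show ?thesis using j by linarith
qed

text \<open>Let \<open>w\<close> be the point of the interval that is farthest from the path, at distance \<open>t\<close>.  Points \<open>u\<close>
  at distance \<open>2 t\<close> on both sides of \<open>w\<close> are joined to the path by segments that stay at distance
  \<open>t\<close> from \<open>w\<close>, and the part of the path between their ends has length linear in \<open>t\<close>.  By slimness
  \<open>w\<close> is close to one of these three pieces up to an error logarithmic in \<open>t\<close>.\<close>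

lemma max_deviation:
  assumes f: "quasi_seq l c f n" and w: "w \<in> interval (f 0) (f n)"
    and far: "\<And>j. j \<le> n \<Longrightarrow> t \<le> D' w (f j)"
    and near: "\<And>v. v \<in> interval (f 0) (f n) \<Longrightarrow> \<exists>j\<le>n. D' v (f j) \<le> t"
    and e: "6 * l * t + c \<le> 2 ^ e" "t \<le> 2 ^ e"
  shows "t \<le> 2 * \<delta> + h + \<delta> * e"
proof -
  note fV = quasi_seqD(1)[OF f]
  have V: "f 0 \<in> V" "f n \<in> V" "w \<in> V" using fV w interval_V by auto
  \<comment> \<open>An endpoint \<open>x\<close> of the interval, the chosen \<open>u\<close> between \<open>x\<close> and \<open>w\<close>, and a point \<open>a\<close> of the path near
    \<open>u\<close>, such that slimness towards the segment from \<open>u\<close> to \<open>a\<close> already gives the claim.  If \<open>x\<close> is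
    too close to \<open>w\<close>, take \<open>u = a = x\<close>.\<close>
  define good where "good x u a j \<longleftrightarrow> u \<in> interval x w \<and> j \<le> n \<and> f j = a \<and> D' u a \<le> t \<and> D' u w \<le> 2 * t
      \<and> (\<forall>p\<in>interval u a. D' w p \<le> 2 * \<delta> \<longrightarrow> t \<le> 2 * \<delta> + h + \<delta> * e)" for x u a j
  have ends: "\<exists>u j. good x u (f j) j" if x: "x = f i" "i \<le> n" "interval x w \<subseteq> interval (f 0) (f n)" for x i
  proof (cases "D' x w \<le> 2 * t")
    case True
    have "t \<le> 2 * \<delta> + h + \<delta> * e" if "p \<in> interval x x" "D' w p \<le> 2 * \<delta>" for p
      using that x far[of i] fV interval_self[of x] by auto
    then have "good x x (f i) i" using True x V fV by (auto simp: good_def interval_ends)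
    then show ?thesis by blast
  next
    case False
    obtain u where u: "u \<in> interval x w" "D' u w = 2 * t"
      using exit_point[of x w "2 * t"] False x V fV by (metis not_le)
    obtain j where j: "j \<le> n" "D' u (f j) \<le> t" using near u x by blast
    have uV: "u \<in> V" using u interval_V by auto
    have "t \<le> 2 * \<delta> + h + \<delta> * e" if p: "p \<in> interval u (f j)" "D' w p \<le> 2 * \<delta>" for p
    proof -
      have pV: "p \<in> V" using p interval_V by auto
      have "D' u p \<le> D' u (f j) + h + \<delta> * e"
        using interval_near_coned_geodesic[of u "f j" e p] p j e uV fV by auto
      moreover have "D' u w \<le> D' u p + D' p w" using coned.tri uV pV V by auto
      moreover have "D' p w = D' w p" using coned.sym pV V by auto
      ultimately show ?thesis using j p u by linarith
    qed
    then have "good x u (f j) j" using u j by (auto simp: good_def)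
    then show ?thesis by blast
  qed
  have sub: "interval (f 0) w \<subseteq> interval (f 0) (f n)" "interval (f n) w \<subseteq> interval (f 0) (f n)"
    using subinterval[OF V(1,2) w] interval_commute V by auto
  obtain u1 i1 where 1: "good (f 0) u1 (f i1) i1" using ends[of "f 0" 0] sub by blast
  obtain u2 i2 where 2: "good (f n) u2 (f i2) i2" using ends[of "f n" n] sub by blast
  have uV: "u1 \<in> V" "u2 \<in> V" "f i1 \<in> V" "f i2 \<in> V" using 1 2 interval_V fV by (auto simp: good_def)
  have "w \<in> interval u1 u2"
    using interval_split[OF V(1,2) w, of u1 u2] 1 2 interval_commute V by (auto simp: good_def)
  then obtain p where p: "p \<in> interval u1 (f i1) \<union> interval (f i1) (f i2) \<union> interval (f i2) u2" "D w p \<le> 2 * \<delta>"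
    using slim_quad[of u1 u2 "f i1" "f i2" w] uV by blast
  have pV: "p \<in> V" using p interval_V by auto
  have wp: "D' w p \<le> 2 * \<delta>" using coned_le[of w p] p V pV by auto
  consider "p \<in> interval u1 (f i1)" | "p \<in> interval u2 (f i2)" | "p \<in> interval (f i1) (f i2)"
    using p interval_commute uV by auto
  then show ?thesis
  proof cases
    case 1 then show ?thesis using \<open>good (f 0) u1 (f i1) i1\<close> wp by (auto simp: good_def)
  next
    case 2 then show ?thesis using \<open>good (f n) u2 (f i2) i2\<close> wp by (auto simp: good_def)
  next
    case 3
    define m M where "m = min i1 i2" and "M = max i1 i2"
    have mM: "m \<le> M" "M \<le> n" "p \<in> interval (f m) (f M)" "D' (f m) (f M) = D' (f i1) (f i2)"
      using 1 2 3 interval_commute[of "f i1" "f i2"] coned.sym[of "f i1" "f i2"] uV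
      by (auto simp: m_def M_def good_def min_def max_def)
    have "D' (f i1) (f i2) \<le> D' (f i1) u1 + D' u1 (f i2)" "D' u1 (f i2) \<le> D' u1 w + D' w (f i2)"
      "D' w (f i2) \<le> D' w u2 + D' u2 (f i2)" "D' (f i1) u1 = D' u1 (f i1)" "D' w u2 = D' u2 w"
      using uV V by (blast intro: coned.tri coned.sym)+
    then have "D' (f m) (f M) \<le> 6 * t" using 1 2 mM by (auto simp: good_def)
    then have "M - m \<le> l * (6 * t) + c" using quasi_seqD(3)[OF f mM(1,2)]
      by (meson add_le_mono1 le_trans mult_le_mono2)
    then have "M - m \<le> 2 ^ e" using e by (simp add: algebra_simps)
    then have "\<exists>j\<in>{m..M}. D' p (f j) \<le> h + \<delta> * e"
      by (intro dyadic_tracking) (use mM fV quasi_seqD(2)[OF f] in auto)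
    then obtain j where j: "j \<le> n" "D' p (f j) \<le> h + \<delta> * e"
      using mM(2) by (meson atLeastAtMost_iff le_trans)
    have "D' w (f j) \<le> D' w p + D' p (f j)" using coned.tri V pV fV j by auto
    then show ?thesis using far[of j] j wp by linarith
  qed
qed

text \<open>A quantity that is bounded by its own logarithm is bounded.\<close>

lemma deviation_bound: "\<exists>T. \<forall>t. (\<forall>e. 6 * l * t + c \<le> 2 ^ e \<longrightarrow> t \<le> 2 ^ e \<longrightarrow> t \<le> B + \<delta> * e) \<longrightarrow> t \<le> (T::nat)"
proof -
  \<comment> \<open>If \<open>2 ^ m\<close> is about \<open>t\<close>, then \<open>e = A + m + 1\<close> is admissible, since \<open>6 l t + c \<le> A t\<close> and \<open>A \<le> 2 ^ A\<close>.\<close>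
  define A where "A = 6 * l + c + 1"
  have "eventually (\<lambda>m::nat. real B + real \<delta> * (real A + real m + 1) < 2 ^ m) at_top"
    by real_asymp
  then obtain m0 where m0: "\<And>m. m \<ge> m0 \<Longrightarrow> real B + real \<delta> * (real A + real m + 1) < 2 ^ m"
    by (auto simp: eventually_at_top_linorder)
  have "t \<le> 2 ^ m0" if t: "\<And>e. 6 * l * t + c \<le> 2 ^ e \<Longrightarrow> t \<le> 2 ^ e \<Longrightarrow> t \<le> B + \<delta> * e" for t
  proof (rule ccontr)
    assume "\<not> t \<le> 2 ^ m0"
    then have big: "2 ^ m0 < t" by simp
    then have "t > 0" by (metis not_gr0 not_less0)
    then obtain m where m: "2 ^ m \<le> t" "t < 2 ^ (m + 1)" using ex_power_ivl1[of 2 t] by auto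
    have "(2::nat) ^ m0 < 2 ^ (m + 1)" using big m by linarith
    then have "m0 < m + 1" using nat_power_less_imp_less[of 2 m0 "m + 1"] by simp
    then have "m0 \<le> m" by simp
    have "A \<le> 2 ^ A" using less_exp[of A] by linarith
    have "6 * l * t + c \<le> A * t" using \<open>t > 0\<close> unfolding A_def
      by (cases t) (auto simp: algebra_simps)
    also have "\<dots> \<le> 2 ^ A * 2 ^ (m + 1)" using \<open>A \<le> 2 ^ A\<close> m by (intro mult_le_mono) auto
    finally have 1: "6 * l * t + c \<le> 2 ^ (A + m + 1)" by (simp add: power_add)
    have "t \<le> 2 ^ (m + 1)" "(2::nat) ^ (m + 1) \<le> 2 ^ (A + m + 1)" using m by (auto intro: power_increasing)
    then have "t \<le> 2 ^ (A + m + 1)" by linarith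
    then have "t \<le> B + \<delta> * (A + m + 1)" using t 1 by blast
    then have "2 ^ m \<le> B + \<delta> * (A + m + 1)" using m by linarith
    then have "real (2 ^ m) \<le> real (B + \<delta> * (A + m + 1))" using of_nat_le_iff by blast
    then show False using m0[OF \<open>m0 \<le> m\<close>] by (simp add: algebra_simps)
  qed
  then show ?thesis by blast
qed

text \<open>Distances are natural numbers bounded by \<open>D (f 0) (f n)\<close> on the interval, so there is a point of
  maximal deviation.\<close>

lemma interval_near_quasi_seq:
  "\<exists>T. \<forall>f n v. quasi_seq l c f n \<longrightarrow> v \<in> interval (f 0) (f n) \<longrightarrow> (\<exists>j\<le>n. D' v (f j) \<le> T)"
proof -
  obtain T where T: "\<And>t. (\<And>e. 6 * l * t + c \<le> 2 ^ e \<Longrightarrow> t \<le> 2 ^ e \<Longrightarrow> t \<le> (2 * \<delta> + h) + \<delta> * e) \<Longrightarrow> t \<le> T"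
    using deviation_bound[of l c "2 * \<delta> + h"] by blast
  have "\<exists>j\<le>n. D' v (f j) \<le> T" if f: "quasi_seq l c f n" and v: "v \<in> interval (f 0) (f n)" for f n v
  proof -
    define \<rho> where "\<rho> w = Min ((\<lambda>j. D' w (f j)) ` {..n})" for w
    have fV: "f 0 \<in> V" "f n \<in> V" using quasi_seqD(1)[OF f] by auto
    have \<rho>_le: "\<rho> w \<le> D' w (f j)" if "j \<le> n" for w j using that by (auto simp: \<rho>_def)
    have \<rho>_attained: "\<exists>j\<le>n. D' w (f j) = \<rho> w" for w
    proof -
      have "\<rho> w \<in> (\<lambda>j. D' w (f j)) ` {..n}" unfolding \<rho>_def by (intro Min_in) auto
      then show ?thesis by auto
    qed
    have "\<rho> w \<le> D (f 0) (f n)" if "w \<in> interval (f 0) (f n)" for w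
    proof -
      have "w \<in> V" using that interval_V by auto
      then have "D' w (f 0) \<le> D w (f 0)" "D w (f 0) = D (f 0) w" using coned_le sym fV by auto
      then show ?thesis using \<rho>_le[of 0 w] interval_dist_le(1)[OF that] by linarith
    qed
    then have "\<forall>w. w \<in> interval (f 0) (f n) \<longrightarrow> \<rho> w < Suc (D (f 0) (f n))" by (simp add: less_Suc_eq_le)
    then obtain w where w: "w \<in> interval (f 0) (f n)" "\<And>u. u \<in> interval (f 0) (f n) \<Longrightarrow> \<rho> u \<le> \<rho> w"
      using ex_has_greatest_nat[of "\<lambda>w. w \<in> interval (f 0) (f n)" v \<rho> "Suc (D (f 0) (f n))"] v by blast
    have "\<rho> w \<le> T"
    proof (rule T)
      fix e assume "6 * l * \<rho> w + c \<le> 2 ^ e" "\<rho> w \<le> 2 ^ e"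
      then show "\<rho> w \<le> 2 * \<delta> + h + \<delta> * e"
        using w \<rho>_attained by (intro max_deviation[OF f w(1) \<rho>_le]) (auto, metis)
    qed
    then show ?thesis using w(2)[OF v] \<rho>_attained[of v] le_trans by metis
  qed
  then show ?thesis by blast
qed

text \<open>A connectedness argument: walk along a geodesic of \<open>D\<close> and look at the last point that is close to
  the initial part \<open>f 0, ..., f j\<close>.  Its successor is close to a point beyond \<open>f j\<close>, so the
  quasigeodesic inequality bounds how far \<open>f j\<close> can be from both.\<close>

lemma quasi_seq_near_interval:
  "\<exists>T. \<forall>f n j. quasi_seq l c f n \<longrightarrow> j \<le> n \<longrightarrow> (\<exists>v\<in>interval (f 0) (f n). D' (f j) v \<le> T)"
proof -
  obtain T where T: "\<And>f n v. quasi_seq l c f n \<Longrightarrow> v \<in> interval (f 0) (f n) \<Longrightarrow> \<exists>j\<le>n. D' v (f j) \<le> T"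
    using interval_near_quasi_seq by metis
  define R where "R = T + (l * (2 * T + 1) + c)"
  have "\<exists>v\<in>interval (f 0) (f n). D' (f j) v \<le> R" if f: "quasi_seq l c f n" and j: "j \<le> n" for f n j
  proof -
    note fV = quasi_seqD(1)[OF f]
    have step: "D' (f i) (f k) \<le> k - i" if "i \<le> k" "k \<le> n" for i k
      using that
    proof (induction k)
      case (Suc k)
      show ?case
      proof (cases "i = Suc k")
        case False
        then have "D' (f i) (f k) \<le> k - i" using Suc by auto
        moreover have "D' (f i) (f (Suc k)) \<le> D' (f i) (f k) + D' (f k) (f (Suc k))"
          using Suc.prems fV by (intro coned.tri) auto
        moreover have "D' (f k) (f (Suc k)) \<le> 1" using quasi_seqD(2)[OF f] Suc.prems by auto
        ultimately show ?thesis using False Suc.prems by linarith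
      qed (use Suc fV in auto)
    qed (use fV in auto)
    define N where "N = D (f 0) (f n)"
    obtain g where g: "geodesic_seq g N" "g 0 = f 0" "g N = f n"
      using geodesic_exists[of "f 0" "f n"] fV unfolding N_def by auto
    have gI: "g i \<in> interval (f 0) (f n)" if "i \<le> N" for i
      using geodesic_seq_interval[OF g(1) that] g by simp
    then have gV: "g i \<in> V" if "i \<le> N" for i using that interval_V by blast
    define P where "P i \<longleftrightarrow> i \<le> N \<and> (\<exists>j'\<le>j. D' (g i) (f j') \<le> T)" for i
    have P0: "P 0" using g fV by (auto simp: P_def intro!: exI[of _ 0])
    have bd: "\<And>i. P i \<Longrightarrow> i \<le> N" by (auto simp: P_def)
    define i where "i = (GREATEST i. P i)"
    have "P i" unfolding i_def using P0 bd by (rule GreatestI_nat)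
    then obtain j' where j': "i \<le> N" "j' \<le> j" "D' (g i) (f j') \<le> T" by (auto simp: P_def)
    show ?thesis
    proof (cases "i = N")
      case True
      then have "D' (f j') (f n) \<le> T" using j' g coned.sym fV j by auto
      have "n - j' \<le> l * D' (f j') (f n) + c" using quasi_seqD(3)[OF f] j' j by auto
      also have "\<dots> \<le> l * T + c" using \<open>D' (f j') (f n) \<le> T\<close> by auto
      finally have "D' (f j) (f n) \<le> l * T + c" using step[of j n] j j' by auto
      also have "\<dots> \<le> R" by (auto simp: R_def)
      finally show ?thesis using interval_ends fV by (intro bexI[of _ "f n"]) auto
    next
      case False
      then have "Suc i \<le> N" using j' by auto
      then obtain j'' where j'': "j'' \<le> n" "D' (g (Suc i)) (f j'') \<le> T" using T[OF f gI] by blast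
      have "\<not> P (Suc i)"
      proof
        assume "P (Suc i)"
        then have "Suc i \<le> i" unfolding i_def using bd by (rule Greatest_le_nat)
        then show False by simp
      qed
      then have "j < j''" using j'' \<open>Suc i \<le> N\<close> unfolding P_def by (meson not_le)
      have V: "f j' \<in> V" "f j'' \<in> V" "g i \<in> V" "g (Suc i) \<in> V" "f j \<in> V"
        using fV gV j' j'' j \<open>Suc i \<le> N\<close> by auto
      have "D' (f j') (f j'') \<le> D' (f j') (g i) + D' (g i) (f j'')"
        "D' (g i) (f j'') \<le> D' (g i) (g (Suc i)) + D' (g (Suc i)) (f j'')"
        "D' (f j') (g i) = D' (g i) (f j')" "D' (f j) (g i) \<le> D' (f j) (f j') + D' (f j') (g i)"
        "D' (f j) (f j') = D' (f j') (f j)" "D' (g i) (g (Suc i)) \<le> D (g i) (g (Suc i))"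
        using V by (auto intro: coned.tri coned.sym coned_le)
      moreover have "D (g i) (g (Suc i)) = 1" using geodesic_seqD(2)[OF g(1), of i "Suc i"] \<open>Suc i \<le> N\<close> by auto
      ultimately have *: "D' (f j') (f j'') \<le> 2 * T + 1" "D' (f j) (g i) \<le> D' (f j') (f j) + T"
        using j' j'' by linarith+
      have "j'' - j' \<le> l * D' (f j') (f j'') + c" using quasi_seqD(3)[OF f] j' j'' \<open>j < j''\<close> by auto
      also have "\<dots> \<le> l * (2 * T + 1) + c" using * by (intro add_le_mono1 mult_le_mono2)
      finally have "D' (f j') (f j) \<le> l * (2 * T + 1) + c"
        using step[of j' j] j' j \<open>j < j''\<close> by auto
      then have "D' (f j) (g i) \<le> R" using * by (auto simp: R_def)
      then show ?thesis using gI j' by blast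
    qed
  qed
  then show ?thesis by blast
qed

text \<open>Triangles for \<open>D'\<close> inherit slimness from the triangles of \<open>D\<close> with the same corners.\<close>

lemma coned_slim:
  "\<exists>R. \<forall>f g k m n q. quasi_seq 1 0 f m \<longrightarrow> quasi_seq 1 0 g n \<longrightarrow> quasi_seq 1 0 k q \<longrightarrow>
     f m = g 0 \<longrightarrow> g n = k 0 \<longrightarrow> k q = f 0 \<longrightarrow>
     (\<forall>i\<le>m. (\<exists>j\<le>n. D' (f i) (g j) \<le> R) \<or> (\<exists>j\<le>q. D' (f i) (k j) \<le> R))"
proof -
  obtain T where T: "\<And>f n v. quasi_seq 1 0 f n \<Longrightarrow> v \<in> interval (f 0) (f n) \<Longrightarrow> \<exists>j\<le>n. D' v (f j) \<le> T"
    using interval_near_quasi_seq by metis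
  obtain S where S: "\<And>f n j. quasi_seq 1 0 f n \<Longrightarrow> j \<le> n \<Longrightarrow> \<exists>v\<in>interval (f 0) (f n). D' (f j) v \<le> S"
    using quasi_seq_near_interval by metis
  have "(\<exists>j\<le>n. D' (f i) (g j) \<le> S + \<delta> + T) \<or> (\<exists>j\<le>q. D' (f i) (k j) \<le> S + \<delta> + T)"
    if f: "quasi_seq 1 0 f m" and g: "quasi_seq 1 0 g n" and k: "quasi_seq 1 0 k q"
      and e: "f m = g 0" "g n = k 0" "k q = f 0" and i: "i \<le> m" for f g k m n q i
  proof -
    note V = quasi_seqD(1)[OF f] quasi_seqD(1)[OF g] quasi_seqD(1)[OF k]
    have fe: "f 0 \<in> V" "g 0 \<in> V" "k 0 \<in> V" using V by auto
    obtain v where v: "v \<in> interval (f 0) (f m)" "D' (f i) v \<le> S" using S[OF f i] by blast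
    obtain w where w: "w \<in> interval (f 0) (k 0) \<union> interval (k 0) (g 0)" "D v w \<le> \<delta>"
      using slim[of "f 0" "g 0" "k 0" v] v e fe by auto
    have vw: "v \<in> V" "w \<in> V" using v w interval_V by auto
    have near: ?thesis if p: "quasi_seq 1 0 p N" "w \<in> interval (p 0) (p N)" "(p = g \<and> N = n) \<or> (p = k \<and> N = q)" for p N
    proof -
      obtain j where j: "j \<le> N" "D' w (p j) \<le> T" using T[OF p(1,2)] by blast
      have pV: "p j \<in> V" using quasi_seqD(1)[OF p(1)] j by auto
      have "D' (f i) (p j) \<le> D' (f i) v + D' v (p j)" "D' v (p j) \<le> D' v w + D' w (p j)" "D' v w \<le> D v w"
        using coned.tri coned_le V(1)[OF i] vw pV by auto
      then have "D' (f i) (p j) \<le> S + \<delta> + T" using v w j by linarith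
      then show ?thesis using p(3) j by auto
    qed
    show ?thesis
      using w near[OF g] near[OF k] e interval_commute fe by auto
  qed
  then show ?thesis by blast
qed

end

section \<open>Projections to peripheral sets\<close>

text \<open>The geometry of a relatively hyperbolic group: \<open>D\<close> is the distance in the relative Cayley graph, \<open>d\<close> a
  proper metric on the group, and \<open>\<P>\<close> the set of peripheral cosets.\<close>

locale peripheral_space = slim_space V D \<delta>
  for V :: "'a set" and D :: "'a \<Rightarrow> 'a \<Rightarrow> nat" and \<delta> :: nat +
  fixes d :: "'a \<Rightarrow> 'a \<Rightarrow> real" and \<P> :: "'a set set"
  assumes metric_self: "x \<in> V \<Longrightarrow> d x x = 0"
    and metric_sym: "\<lbrakk>x \<in> V; y \<in> V\<rbrakk> \<Longrightarrow> d x y = d y x"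
    and metric_tri: "\<lbrakk>x \<in> V; y \<in> V; z \<in> V\<rbrakk> \<Longrightarrow> d x z \<le> d x y + d y z"
    and metric_dist: "\<exists>N. \<forall>x\<in>V. \<forall>y\<in>V. d x y \<le> R \<longrightarrow> D x y \<le> N"
    and per_V: "P \<in> \<P> \<Longrightarrow> P \<subseteq> V"
    and per_nonempty: "P \<in> \<P> \<Longrightarrow> P \<noteq> {}"
    and per_diam: "\<lbrakk>P \<in> \<P>; x \<in> P; y \<in> P\<rbrakk> \<Longrightarrow> D x y \<le> 1"
    and per_fine: "\<exists>r. \<forall>P\<in>\<P>. \<forall>x\<in>P. \<forall>y\<in>P. \<forall>n\<le>N.
      (x, y) \<in> {(u, v). u \<in> V \<and> v \<in> V \<and> D u v \<le> 1 \<and> \<not> (u \<in> P \<and> v \<in> P)} ^^ n \<longrightarrow> d x y \<le> r"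
    and edges: "\<exists>r. \<forall>x\<in>V. \<forall>y\<in>V. D x y \<le> 1 \<longrightarrow> d x y \<le> r \<or> (\<exists>P\<in>\<P>. x \<in> P \<and> y \<in> P)"
begin

definition steps_off :: "'a set \<Rightarrow> ('a \<times> 'a) set" where
  "steps_off P = {(u, v). u \<in> V \<and> v \<in> V \<and> D u v \<le> 1 \<and> \<not> (u \<in> P \<and> v \<in> P)}"

text \<open>Such a path may pass through single points of \<open>P\<close>; only steps inside \<open>P\<close> are forbidden.\<close>

definition avoids :: "'a set \<Rightarrow> nat \<Rightarrow> 'a \<Rightarrow> 'a \<Rightarrow> bool" where
  "avoids P n x y \<longleftrightarrow> (\<exists>m\<le>n. (x, y) \<in> steps_off P ^^ m)"

definition proj :: "'a set \<Rightarrow> 'a \<Rightarrow> 'a" where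
  "proj P z = (ARG_MIN (D z) b. b \<in> P)"

text \<open>Implies that no geodesic from \<open>x\<close> to \<open>y\<close> has an edge in \<open>P\<close>.\<close>

definition meets_once :: "'a set \<Rightarrow> 'a \<Rightarrow> 'a \<Rightarrow> bool" where
  "meets_once P x y \<longleftrightarrow> (\<forall>a \<in> interval x y \<inter> P. \<forall>b \<in> interval x y \<inter> P. a = b)"

lemma fine: "\<exists>r. \<forall>P\<in>\<P>. \<forall>x\<in>P. \<forall>y\<in>P. avoids P N x y \<longrightarrow> d x y \<le> r"
proof -
  obtain r where r: "\<forall>P\<in>\<P>. \<forall>x\<in>P. \<forall>y\<in>P. \<forall>n\<le>N. (x, y) \<in> steps_off P ^^ n \<longrightarrow> d x y \<le> r"
    using per_fine[of N] unfolding steps_off_def ..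
  show ?thesis unfolding avoids_def by (rule exI[of _ r]) (use r in blast)
qed

lemma avoids_trans: "\<lbrakk>avoids P m x y; avoids P n y z\<rbrakk> \<Longrightarrow> avoids P (m + n) x z"
  unfolding avoids_def by (elim exE conjE) (rule exI, rule conjI[OF add_mono relpow_trans])

lemma avoids_mono: "\<lbrakk>avoids P m x y; m \<le> n\<rbrakk> \<Longrightarrow> avoids P n x y"
  unfolding avoids_def by (elim exE conjE) (rule exI, rule conjI[OF le_trans])

lemma avoids_sym:
  assumes "avoids P n x y"
  shows "avoids P n y x"
proof -
  have "sym (steps_off P)" using sym by (auto simp: steps_off_def intro: symI)
  then have "(steps_off P)\<inverse> = steps_off P" by (simp add: sym_conv_converse_eq)
  have "(y, x) \<in> steps_off P ^^ m" if "(x, y) \<in> steps_off P ^^ m" for m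
    using that
  proof (induction m arbitrary: y)
    case (Suc m)
    obtain z where "(x, z) \<in> steps_off P ^^ m" "(z, y) \<in> steps_off P" by (rule relpow_Suc_E[OF Suc.prems])
    then have "(z, x) \<in> steps_off P ^^ m" "(y, z) \<in> steps_off P" using Suc.IH \<open>sym (steps_off P)\<close> by (auto dest: symD)
    then show ?case by (rule relpow_Suc_I2[rotated])
  qed auto
  then show ?thesis using assms unfolding avoids_def by blast
qed

lemma avoids_dist:
  assumes "avoids P n x y" "x \<in> V"
  shows "D x y \<le> n"
proof -
  have *: "y \<in> V \<and> D x y \<le> m" if "(x, y) \<in> steps_off P ^^ m" for m y
    using that
  proof (induction m arbitrary: y)
    case 0
    then show ?case using assms(2) by simp
  next
    case (Suc m)
    obtain z where z: "(x, z) \<in> steps_off P ^^ m" "(z, y) \<in> steps_off P" by (rule relpow_Suc_E[OF Suc.prems])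
    have "y \<in> V" "D z y \<le> 1" using z(2) by (auto simp: steps_off_def)
    moreover have "z \<in> V" "D x z \<le> m" using Suc.IH[OF z(1)] by auto
    ultimately show ?case using tri[of x z y] assms(2) by simp
  qed
  moreover obtain m where "m \<le> n" "(x, y) \<in> steps_off P ^^ m" using assms(1) unfolding avoids_def by blast
  ultimately show ?thesis by (meson le_trans)
qed

lemma proj:
  assumes "P \<in> \<P>" "z \<in> V"
  shows "proj P z \<in> P" "\<And>c. c \<in> P \<Longrightarrow> D z (proj P z) \<le> D z c"
proof -
  obtain c where "c \<in> P" using per_nonempty assms by blast
  then show "proj P z \<in> P" "\<And>c. c \<in> P \<Longrightarrow> D z (proj P z) \<le> D z c"
    unfolding proj_def using arg_min_nat_lemma[of "\<lambda>b. b \<in> P" c "D z"] by auto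
qed

lemma proj_V: "\<lbrakk>P \<in> \<P>; z \<in> V\<rbrakk> \<Longrightarrow> proj P z \<in> V"
  using proj(1) per_V by blast

lemma proj_id:
  assumes "P \<in> \<P>" "z \<in> P"
  shows "proj P z = z"
proof -
  have z: "z \<in> V" using assms per_V by blast
  then have "D z (proj P z) = 0" using proj(2)[OF assms(1) z assms(2)] by simp
  then show ?thesis using dist_eq_0 z proj_V[OF assms(1) z] by metis
qed

lemma meets_once_sub:
  "\<lbrakk>meets_once P x y; interval u v \<subseteq> interval x y\<rbrakk> \<Longrightarrow> meets_once P u v"
  unfolding meets_once_def by blast

lemma avoids_geodesic:
  assumes "geodesic_seq g n" "meets_once P (g 0) (g n)" "j \<le> k" "k \<le> n"
  shows "avoids P (k - j) (g j) (g k)"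
proof -
  have "(g j, g (j + i)) \<in> steps_off P ^^ i" if "j + i \<le> n" for i
    using that
  proof (induction i)
    case (Suc i)
    have *: "g (j + i) \<in> V" "g (Suc (j + i)) \<in> V" "D (g (j + i)) (g (Suc (j + i))) = 1"
      using geodesic_seqD[OF assms(1)] Suc.prems by auto
    then have "g (j + i) \<noteq> g (Suc (j + i))" by auto
    moreover have "g (j + i) \<in> interval (g 0) (g n)" "g (Suc (j + i)) \<in> interval (g 0) (g n)"
      using geodesic_seq_interval[OF assms(1)] Suc.prems by auto
    ultimately have "\<not> (g (j + i) \<in> P \<and> g (Suc (j + i)) \<in> P)"
      using assms(2) unfolding meets_once_def by blast
    then have "(g (j + i), g (j + Suc i)) \<in> steps_off P" using * by (auto simp: steps_off_def)
    moreover have "(g j, g (j + i)) \<in> steps_off P ^^ i" using Suc by simp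
    ultimately show ?case by (rule relpow_Suc_I[rotated])
  qed simp
  from this[of "k - j"] assms show ?thesis unfolding avoids_def by auto
qed

lemma avoids_interval:
  assumes "x \<in> V" "y \<in> V" "meets_once P x y"
  shows "avoids P (D x y) x y"
proof -
  obtain g where "geodesic_seq g (D x y)" "g 0 = x" "g (D x y) = y"
    using geodesic_exists assms by metis
  then show ?thesis using avoids_geodesic[of g "D x y" P 0 "D x y"] assms by auto
qed

lemma avoids_far:
  assumes "x \<in> V" "y \<in> V" "\<And>c. c \<in> P \<Longrightarrow> D x y < D x c"
  shows "avoids P (D x y) x y"
proof (rule avoids_interval)
  have "interval x y \<inter> P = {}" using assms(3) interval_dist_le(1)[of _ x y] by fastforce
  then show "meets_once P x y" by (auto simp: meets_once_def)
qed (use assms in auto)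

text \<open>A second point of \<open>P\<close> on the way to a nearest point of \<open>Q \<supseteq> P\<close> would be nearer.\<close>

lemma meets_once_proj:
  assumes "P \<in> \<P>" "z \<in> V" "P \<subseteq> Q" "\<And>c. c \<in> Q \<Longrightarrow> D z b \<le> D z c" "b \<in> V"
  shows "meets_once P b z"
proof -
  have "a = b" if "a \<in> interval b z" "a \<in> P" for a
  proof -
    have "a \<in> V" "D b a + D a z = D b z" using that by (auto simp: interval_def)
    moreover have "D z b \<le> D z a" using assms(3,4) that by auto
    ultimately have "D b a = 0" using sym[of z b] sym[of z a] assms(2,5) by auto
    then show ?thesis using dist_eq_0 \<open>a \<in> V\<close> assms(5) by metis
  qed
  then show ?thesis by (auto simp: meets_once_def)
qed

lemma proj_interval_dist:
  assumes "P \<in> \<P>" "z \<in> V" "w \<in> interval (proj P z) z" "c \<in> P"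
  shows "D w (proj P z) \<le> D w c"
proof -
  have V: "proj P z \<in> V" "w \<in> V" "c \<in> V"
    using proj_V[OF assms(1,2)] interval_V[OF assms(3)] per_V[OF assms(1)] assms(4) by blast+
  have "D (proj P z) w + D w z = D (proj P z) z" using assms(3) by (simp add: interval_def)
  moreover have "D z (proj P z) \<le> D z c" by (rule proj(2)[OF assms(1,2,4)])
  moreover have "D z c \<le> D z w + D w c" using V assms(2) by (intro tri)
  ultimately show ?thesis
    using V sym[of z "proj P z"] sym[of z w] sym[of w "proj P z"] assms(2) by linarith
qed

text \<open>The geodesic from \<open>proj P z\<close> to \<open>z\<close> leaves \<open>P\<close> at full speed.  At distance \<open>K\<close> from \<open>P\<close>, slimness
  lets it cross over either to the opposite geodesic \<open>g\<close> or to the geodesic from \<open>proj P z'\<close>, and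
  the crossing is too short to touch \<open>P\<close>.\<close>

lemma exit_from_peripheral:
  assumes "P \<in> \<P>" "z \<in> V" "z' \<in> V" "geodesic_seq g n" "g 0 = z" "g n = z'"
  defines "K \<equiv> 2 * \<delta> + 1"
  shows "(\<exists>k\<le>n. avoids P (K + \<delta>) (proj P z) (g k)) \<or>
    avoids P (2 * K + 4 * \<delta>) (proj P z) (proj P z')"
proof -
  let ?b = "proj P z" and ?c = "proj P z'"
  have V: "?b \<in> V" "?c \<in> V" using proj_V assms by auto
  have bz: "meets_once P ?b z" and cz: "meets_once P ?c z'"
    using meets_once_proj[of P _ P] proj(2) V assms by auto
  show ?thesis
  proof (cases "D ?b z \<le> K")
    case True
    then have "avoids P (K + \<delta>) ?b z" using avoids_mono[OF avoids_interval[OF V(1) assms(2) bz]] by simp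
    then show ?thesis using assms by blast
  next
    case False
    then obtain w where w: "w \<in> interval ?b z" "D ?b w = K"
      using between_interval[of ?b z K] V assms by (metis nat_le_linear)
    have wV: "w \<in> V" using w interval_V by auto
    have wfar: "K \<le> D w c" if "c \<in> P" for c
      using proj_interval_dist[OF assms(1,2) w(1) that] w(2) sym[OF wV V(1)] by simp
    have bw: "avoids P K ?b w"
      using avoids_interval[OF V(1) wV meets_once_sub[OF bz]] subinterval(1)[OF V(1) assms(2) w(1)] w(2)
      by simp
    have from_w: "avoids P (D w u) w u" if "u \<in> V" "D w u < K" for u
      using avoids_far[OF wV that(1)] wfar that(2) less_le_trans by blast
    consider k where "k \<le> n" "D w (g k) \<le> \<delta>" | u where "u \<in> interval z' ?b" "D w u \<le> \<delta>"
      using slim_seq[OF V(1) assms(2,3) w(1) assms(4-6)] by blast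
    then show ?thesis
    proof cases
      case 1
      then have "avoids P \<delta> w (g k)"
        using from_w[of "g k"] geodesic_seqD(1)[OF assms(4)] avoids_mono by (auto simp: K_def)
      then show ?thesis using avoids_trans[OF bw] 1 by blast
    next
      case 2
      then have uV: "u \<in> V" and "u \<in> interval ?b z'" using interval_V interval_commute V assms by auto
      then obtain v where v: "v \<in> interval ?b ?c \<union> interval ?c z'" "D u v \<le> \<delta>"
        using slim[of ?b z' ?c u] V assms by blast
      have vV: "v \<in> V" using v interval_V by auto
      have wv: "D w v \<le> 2 * \<delta>" using tri[OF wV uV vV] v 2 by simp
      have "v \<notin> P" using wfar[of v] wv by (auto simp: K_def)
      have "v \<notin> interval ?b ?c"
      proof
        assume "v \<in> interval ?b ?c"
        then have "D ?b v + D v ?c \<le> 1" using per_diam[of P ?b ?c] proj assms by (auto simp: interval_def)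
        then have "D ?b v = 0 \<or> D v ?c = 0" by linarith
        then have "v = ?b \<or> v = ?c" using dist_eq_0 V vV by metis
        then show False using \<open>v \<notin> P\<close> proj assms by auto
      qed
      then have vI: "v \<in> interval ?c z'" using v by blast
      have "D v ?c \<le> D v ?b" using proj_interval_dist[OF assms(1,3) vI] proj assms by auto
      also have "\<dots> \<le> D v w + D w ?b" using tri vV wV V by auto
      finally have "D v ?c \<le> 2 * \<delta> + K" using wv w sym vV wV V by auto
      moreover have "avoids P (D ?c v) ?c v"
        using avoids_interval[OF V(2) vV meets_once_sub[OF cz]] subinterval(1)[OF V(2) assms(3) vI] .
      ultimately have vc: "avoids P (2 * \<delta> + K) v ?c"
        using avoids_sym avoids_mono sym vV V by metis
      have "avoids P (2 * \<delta>) w v" using from_w[OF vV] wv avoids_mono by (auto simp: K_def)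
      from avoids_trans[OF avoids_trans[OF bw this] vc] show ?thesis
        by (auto elim: avoids_mono)
    qed
  qed
qed

text \<open>Close up the geodesic between \<open>z\<close> and \<open>z'\<close> near its ends by short paths to the projections; this
  gives a path of bounded length off \<open>P\<close> between the two projections, to which the hypothesis on
  short loops applies.\<close>

lemma proj_bounded_if_meets_once:
  "\<exists>R. \<forall>P\<in>\<P>. \<forall>z\<in>V. \<forall>z'\<in>V. meets_once P z z' \<longrightarrow> d (proj P z) (proj P z') \<le> R"
proof -
  define K where "K = 2 * \<delta> + 1"
  obtain r where r: "\<And>P x y. P \<in> \<P> \<Longrightarrow> x \<in> P \<Longrightarrow> y \<in> P \<Longrightarrow> avoids P (4 * K + 4 * \<delta> + 1) x y \<Longrightarrow> d x y \<le> r"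
    using fine[of "4 * K + 4 * \<delta> + 1"] by blast
  have "d (proj P z) (proj P z') \<le> r" if P: "P \<in> \<P>" and z: "z \<in> V" "z' \<in> V" and once: "meets_once P z z'" for P z z'
  proof -
    let ?b = "proj P z" and ?c = "proj P z'"
    have V: "?b \<in> V" "?c \<in> V" using proj_V P z by auto
    obtain g where g: "geodesic_seq g (D z z')" "g 0 = z" "g (D z z') = z'"
      using geodesic_exists z by metis
    define n where "n = D z z'"
    note g = g[folded n_def]
    have "avoids P (4 * K + 4 * \<delta> + 1) ?b ?c"
    proof (cases "avoids P (2 * K + 4 * \<delta>) ?b ?c \<or> avoids P (2 * K + 4 * \<delta>) ?c ?b")
      case True
      then have "avoids P (2 * K + 4 * \<delta>) ?b ?c" using avoids_sym by blast
      then show ?thesis by (rule avoids_mono) simp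
    next
      case False
      then obtain k where k: "k \<le> n" "avoids P (K + \<delta>) ?b (g k)"
        using exit_from_peripheral[OF P z g, folded K_def] by blast
      have "(\<exists>i\<le>n. avoids P (K + \<delta>) ?c (g (n - i))) \<or> avoids P (2 * K + 4 * \<delta>) ?c ?b"
        using g exit_from_peripheral[OF P z(2,1) geodesic_seq_rev[OF g(1)], folded K_def] by simp
      then obtain i where i: "i \<le> n" "avoids P (K + \<delta>) ?c (g (n - i))" using False by blast
      define j where "j = n - i"
      have j: "j \<le> n" "avoids P (K + \<delta>) ?c (g j)" using i by (simp_all add: j_def)
      have gV: "g k \<in> V" "g j \<in> V" using geodesic_seqD(1)[OF g(1)] k(1) j(1) by blast+
      have "D (g k) (g j) \<le> D (g k) ?b + D ?b (g j)" "D ?b (g j) \<le> D ?b ?c + D ?c (g j)"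
        using gV V by (blast intro: tri)+
      moreover have "D (g k) ?b \<le> K + \<delta>" using avoids_dist[OF avoids_sym[OF k(2)]] gV by blast
      moreover have "D ?c (g j) \<le> K + \<delta>" using avoids_dist[OF j(2)] V by blast
      moreover have "D ?b ?c \<le> 1" using per_diam[OF P] proj(1)[OF P] z by blast
      ultimately have kj: "D (g k) (g j) \<le> 2 * K + 2 * \<delta> + 1" by linarith
      have "avoids P (D (g k) (g j)) (g k) (g j)"
      proof (cases "k \<le> j")
        case True
        then show ?thesis
          using avoids_geodesic[OF g(1), of P k j] once g(2,3) j(1) geodesic_seqD(2)[OF g(1), of k j] by simp
      next
        case False
        then have "avoids P (D (g j) (g k)) (g j) (g k)"
          using avoids_geodesic[OF g(1), of P j k] once g(2,3) k(1) geodesic_seqD(2)[OF g(1), of j k] by simp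
        then show ?thesis using avoids_sym sym[OF gV] by simp
      qed
      then have "avoids P (2 * K + 2 * \<delta> + 1) (g k) (g j)" using kj avoids_mono by blast
      from avoids_trans[OF avoids_trans[OF k(2) this] avoids_sym[OF j(2)]] show ?thesis
        by (rule avoids_mono) simp
    qed
    then show ?thesis using r P proj(1) z by blast
  qed
  then show ?thesis by blast
qed

text \<open>A geodesic that does meet \<open>P\<close> is cut at its first and last point in \<open>P\<close>; the outer pieces meet \<open>P\<close>
  once.\<close>

lemma proj_bounded:
  "\<exists>R. \<forall>P\<in>\<P>. \<forall>z\<in>V. \<forall>z'\<in>V. (\<forall>a\<in>interval z z' \<inter> P. \<forall>b\<in>interval z z' \<inter> P. d a b \<le> k) \<longrightarrow>
     d (proj P z) (proj P z') \<le> R"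
proof -
  from proj_bounded_if_meets_once obtain R where
    R: "\<forall>P\<in>\<P>. \<forall>z\<in>V. \<forall>z'\<in>V. meets_once P z z' \<longrightarrow> d (proj P z) (proj P z') \<le> R" ..
  note R = R[rule_format]
  have "d (proj P z) (proj P z') \<le> 2 * \<bar>R\<bar> + \<bar>k\<bar>"
    if P: "P \<in> \<P>" and z: "z \<in> V" "z' \<in> V" and k: "\<forall>a\<in>interval z z' \<inter> P. \<forall>b\<in>interval z z' \<inter> P. d a b \<le> k" for P z z'
  proof (cases "interval z z' \<inter> P = {}")
    case True
    then have "meets_once P z z'" by (auto simp: meets_once_def)
    then show ?thesis using R[OF P z] by auto
  next
    case False
    let ?S = "interval z z' \<inter> P"
    have entry: "\<exists>e\<in>?S. d (proj P x) e \<le> R" if x: "x \<in> V" and sub: "\<And>e. e \<in> ?S \<Longrightarrow> interval x e \<subseteq> interval z z'" for x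
    proof -
      obtain e\<^sub>0 where "e\<^sub>0 \<in> ?S" using False by blast
      from ex_has_least_nat[where P = "\<lambda>e. e \<in> ?S" and m = "D x", OF this]
      obtain e where e: "e \<in> ?S" "\<And>a. a \<in> ?S \<Longrightarrow> D x e \<le> D x a" by (elim exE conjE) simp
      have eV: "e \<in> V" using e interval_V by auto
      have "a = e" if "a \<in> interval x e" "a \<in> P" for a
      proof -
        have "a \<in> ?S" using that sub e by blast
        then have "D x e \<le> D x a" using e by blast
        moreover have "a \<in> V" "D x a + D a e = D x e" using that by (auto simp: interval_def)
        ultimately show ?thesis using dist_eq_0[of a e] eV by auto
      qed
      then have "meets_once P x e" by (auto simp: meets_once_def)
      then have "d (proj P x) (proj P e) \<le> R" using R P x eV by auto
      then show ?thesis using proj_id[OF P] e by auto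
    qed
    obtain e where e: "e \<in> ?S" "d (proj P z) e \<le> R"
      using entry[OF z(1)] subinterval(1)[OF z] by blast
    obtain e' where e': "e' \<in> ?S" "d (proj P z') e' \<le> R"
    proof -
      have "interval z' e \<subseteq> interval z z'" if "e \<in> ?S" for e
      proof -
        have e: "e \<in> interval z z'" using that by simp
        then show ?thesis using subinterval(2)[OF z e] interval_commute[OF interval_V[OF e] z(2)] by simp
      qed
      then show ?thesis using entry[OF z(2)] that by blast
    qed
    have V: "proj P z \<in> V" "proj P z' \<in> V" "e \<in> V" "e' \<in> V" using proj_V P z e e' interval_V by auto
    have "d (proj P z) (proj P z') \<le> d (proj P z) e + d e (proj P z')" "d e (proj P z') \<le> d e e' + d e' (proj P z')"
      "d e' (proj P z') = d (proj P z') e'"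
      using V by (blast intro: metric_tri metric_sym)+
    moreover have "d e e' \<le> k" using k e e' by blast
    ultimately show ?thesis using e e' by linarith
  qed
  then show ?thesis by blast
qed

lemma metric_along_seq:
  fixes n k :: nat
  assumes "\<And>i. i \<le> n \<Longrightarrow> f i \<in> V" "\<And>i. j \<le> i \<Longrightarrow> i < k \<Longrightarrow> d (f i) (f (Suc i)) \<le> e" "j \<le> k" "k \<le> n"
  shows "d (f j) (f k) \<le> real (k - j) * e"
proof -
  have "d (f j) (f (j + i)) \<le> real i * e" if "j + i \<le> k" for i
    using that
  proof (induction i)
    case 0
    have "f j \<in> V" using assms(1)[of j] assms(3,4) by simp
    then show ?case using metric_self by simp
  next
    case (Suc i)
    have "f j \<in> V" "f (j + i) \<in> V" "f (Suc (j + i)) \<in> V"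
      using assms(1) Suc.prems assms(4) by simp_all
    then have "d (f j) (f (Suc (j + i))) \<le> d (f j) (f (j + i)) + d (f (j + i)) (f (Suc (j + i)))"
      by (rule metric_tri)
    moreover have "d (f j) (f (j + i)) \<le> real i * e" using Suc by simp
    moreover have "d (f (j + i)) (f (Suc (j + i))) \<le> e" using Suc.prems by (intro assms(2)) simp_all
    ultimately show ?case by (simp add: algebra_simps)
  qed
  from this[of "k - j"] show ?thesis using assms(3) by simp
qed

text \<open>As \<open>P\<close> has diameter one, a geodesic contains at most one edge of \<open>P\<close>; before that edge it stays
  off \<open>P\<close>.\<close>

lemma meets_once_before_edge:
  assumes "P \<in> \<P>" "v \<in> V" "a \<in> P" "b \<in> P" "D v b = D v a + 1"
  shows "meets_once P v a"
proof -
  have "u = a" if "u \<in> interval v a" "u \<in> P" for u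
  proof -
    have V: "u \<in> V" "a \<in> V" "b \<in> V" using that(2) assms(3,4) per_V[OF assms(1)] by blast+
    have "D v b \<le> D v u + D u b" using assms(2) V by (intro tri)
    moreover have "D u b \<le> 1" by (rule per_diam[OF assms(1) that(2) assms(4)])
    moreover have "D v u + D u a = D v a" using that by (auto simp: interval_def)
    ultimately have "D u a = 0" using assms(5) by linarith
    then show ?thesis using dist_eq_0 V by blast
  qed
  then show ?thesis by (auto simp: meets_once_def)
qed

lemma meets_once_edge:
  assumes x: "x \<in> V" "y \<in> V" and d: "D x y \<le> 1" and no: "\<not> (x \<in> P \<and> y \<in> P)"
  shows "meets_once P x y"
proof -
  have "a = x \<or> a = y" if "a \<in> interval x y" for a
  proof -
    have a: "a \<in> V" "D x a + D a y = D x y" using that by (simp_all add: interval_def)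
    then have "D x a = 0 \<or> D a y = 0" using d by linarith
    then show ?thesis using dist_eq_0[OF x(1) a(1)] dist_eq_0[OF a(1) x(2)] by blast
  qed
  then show ?thesis using no unfolding meets_once_def by blast
qed

end

section \<open>Projections to a separated family of quasiconvex sets\<close>

text \<open>\<open>\<F>\<close> stands for the cosets of \<open>\<Gamma>\<close>.  Coarse intersections of two members, and of a member with a
  peripheral set that it does not contain, are bounded.\<close>

locale separated_family = peripheral_space V D \<delta> d \<P>
  for V :: "'a set" and D :: "'a \<Rightarrow> 'a \<Rightarrow> nat" and \<delta> :: nat and d :: "'a \<Rightarrow> 'a \<Rightarrow> real" and \<P> +
  fixes \<F> :: "'a set set" and \<sigma> :: real
  assumes fam_V: "B \<in> \<F> \<Longrightarrow> B \<subseteq> V"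
    and fam_nonempty: "B \<in> \<F> \<Longrightarrow> B \<noteq> {}"
    and fam_disjoint: "\<lbrakk>B \<in> \<F>; B' \<in> \<F>; B \<noteq> B'\<rbrakk> \<Longrightarrow> B \<inter> B' = {}"
    and fam_qc: "\<lbrakk>B \<in> \<F>; x \<in> B; y \<in> B; v \<in> interval x y\<rbrakk> \<Longrightarrow> \<exists>w\<in>B. d v w \<le> \<sigma>"
    and fam_sep: "\<exists>r. \<forall>B\<in>\<F>. \<forall>B'\<in>\<F>. \<forall>x\<in>V. \<forall>y\<in>V. B \<noteq> B' \<longrightarrow>
      (\<exists>b\<in>B. d x b \<le> R) \<longrightarrow> (\<exists>b\<in>B'. d x b \<le> R) \<longrightarrow> (\<exists>b\<in>B. d y b \<le> R) \<longrightarrow> (\<exists>b\<in>B'. d y b \<le> R) \<longrightarrow>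
      d x y \<le> r"
    and fam_per: "\<exists>r. \<forall>B\<in>\<F>. \<forall>P\<in>\<P>. \<forall>x\<in>P. \<forall>y\<in>P. \<not> P \<subseteq> B \<longrightarrow>
      (\<exists>b\<in>B. d x b \<le> \<sigma>) \<longrightarrow> (\<exists>b\<in>B. d y b \<le> \<sigma>) \<longrightarrow> d x y \<le> r"
begin

text \<open>By quasiconvexity the points of \<open>P\<close> on a geodesic between points of \<open>B\<close> lie in the coarse
  intersection of \<open>P\<close> and \<open>B\<close>.\<close>

lemma proj_bounded_along_family:
  "\<exists>R. \<forall>B\<in>\<F>. \<forall>P\<in>\<P>. \<forall>p\<in>B. \<forall>q\<in>B. \<not> P \<subseteq> B \<longrightarrow> d (proj P p) (proj P q) \<le> R"
proof -
  from fam_per obtain k where k: "\<forall>B\<in>\<F>. \<forall>P\<in>\<P>. \<forall>x\<in>P. \<forall>y\<in>P. \<not> P \<subseteq> B \<longrightarrow>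
      (\<exists>b\<in>B. d x b \<le> \<sigma>) \<longrightarrow> (\<exists>b\<in>B. d y b \<le> \<sigma>) \<longrightarrow> d x y \<le> k" ..
  note k = k[rule_format]
  from proj_bounded[of k] obtain R where R: "\<forall>P\<in>\<P>. \<forall>z\<in>V. \<forall>z'\<in>V.
    (\<forall>a\<in>interval z z' \<inter> P. \<forall>b\<in>interval z z' \<inter> P. d a b \<le> k) \<longrightarrow> d (proj P z) (proj P z') \<le> R" ..
  note R = R[rule_format]
  have "d (proj P p) (proj P q) \<le> R" if h: "B \<in> \<F>" "P \<in> \<P>" "p \<in> B" "q \<in> B" "\<not> P \<subseteq> B" for B P p q
  proof (rule R[OF h(2)])
    show "p \<in> V" "q \<in> V" using fam_V[OF h(1)] h(3,4) by blast+
    fix a b assume "a \<in> interval p q \<inter> P" "b \<in> interval p q \<inter> P"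
    then show "d a b \<le> k"
      using fam_qc[OF h(1,3,4)] by (intro k[OF h(1,2) _ _ h(5)]) blast+
  qed
  then show ?thesis by blast
qed

text \<open>Take a short path between the two members in the middle of the strip in which they fellow-travel,
  and on it a last point \<open>v\<close> in \<open>B\<close> and then a first point \<open>v'\<close> in \<open>B'\<close>.  An edge between \<open>v\<close> and \<open>v'\<close> is
  \<open>d\<close>-short or lies in some \<open>P\<close> contained in neither \<open>B\<close> nor \<open>B'\<close>.  In the latter case its two ends
  are, up to a bounded error, the projections of \<open>v\<close> and \<open>v'\<close> to \<open>P\<close>, and the projection moves little
  on the way round from \<open>v\<close> along \<open>B\<close> to \<open>x\<close>, to \<open>x'\<close>, and back along \<open>B'\<close> to \<open>v'\<close>.\<close>

lemma metric_close_points: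
  "\<exists>L M R. \<forall>B\<in>\<F>. \<forall>B'\<in>\<F>. \<forall>x\<in>B. \<forall>y\<in>B. \<forall>x'\<in>B'. \<forall>y'\<in>B'. \<forall>u.
     B \<noteq> B' \<longrightarrow> D x x' \<le> r \<longrightarrow> D y y' \<le> r \<longrightarrow> u \<in> interval x y \<longrightarrow> L \<le> D u x \<longrightarrow> L \<le> D u y \<longrightarrow>
     (\<exists>v\<in>B. \<exists>v'\<in>B'. d v v' \<le> R \<and> D u v \<le> M)"
proof -
  from metric_dist[of \<sigma>] obtain s where s: "\<forall>x\<in>V. \<forall>y\<in>V. d x y \<le> \<sigma> \<longrightarrow> D x y \<le> s" ..
  note s = s[rule_format]
  from edges obtain r1 where r1: "\<forall>x\<in>V. \<forall>y\<in>V. D x y \<le> 1 \<longrightarrow> d x y \<le> r1 \<or> (\<exists>P\<in>\<P>. x \<in> P \<and> y \<in> P)" ..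
  note r1 = r1[rule_format]
  from proj_bounded_if_meets_once obtain R0 where R0:
    "\<forall>P\<in>\<P>. \<forall>z\<in>V. \<forall>z'\<in>V. meets_once P z z' \<longrightarrow> d (proj P z) (proj P z') \<le> R0" ..
  note R0 = R0[rule_format]
  from proj_bounded_along_family obtain R1 where R1:
    "\<forall>B\<in>\<F>. \<forall>P\<in>\<P>. \<forall>p\<in>B. \<forall>q\<in>B. \<not> P \<subseteq> B \<longrightarrow> d (proj P p) (proj P q) \<le> R1" ..
  note R1 = R1[rule_format]
  define m where "m = 2 * s + 2 * \<delta>"
  \<comment> \<open>\<open>L\<close> keeps \<open>u\<close>, and all peripheral sets that meet the short path near \<open>u\<close>, away from the two ends of
    the strip.\<close>
  define L where "L = 2 * \<delta> + s + m + 2 + r"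
  define e where "e = \<bar>r1\<bar> + (3 * \<bar>R0\<bar> + 2 * \<bar>R1\<bar>)"
  have "\<exists>v\<in>B. \<exists>v'\<in>B'. d v v' \<le> real m * e \<and> D u v \<le> s + m"
    if BB: "B \<in> \<F>" "B' \<in> \<F>" "B \<noteq> B'" and xy: "x \<in> B" "y \<in> B" "x' \<in> B'" "y' \<in> B'"
      and r: "D x x' \<le> r" "D y y' \<le> r" and u: "u \<in> interval x y" "L \<le> D u x" "L \<le> D u y"
    for B B' x y x' y' u
  proof -
    have V: "x \<in> V" "y \<in> V" "x' \<in> V" "y' \<in> V" "u \<in> V"
      using fam_V[OF BB(1)] fam_V[OF BB(2)] xy interval_V[OF u(1)] by blast+
    obtain b where b: "b \<in> B" "d u b \<le> \<sigma>" using fam_qc[OF BB(1) xy(1,2) u(1)] by blast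
    have bV: "b \<in> V" using fam_V[OF BB(1)] b(1) by blast
    have ub: "D u b \<le> s" using s[OF V(5) bV b(2)] .
    obtain w where w: "w \<in> interval x x' \<union> interval x' y' \<union> interval y' y" "D u w \<le> 2 * \<delta>"
      using slim_quad[OF V(1,2,3,4) u(1)] by blast
    have wV: "w \<in> V" using w(1) interval_V by blast
    have "w \<notin> interval x x'"
    proof
      assume "w \<in> interval x x'"
      then have "D x w \<le> r" using interval_dist_le(1) r(1) le_trans by blast
      moreover have "D u x \<le> D u w + D w x" using V wV by (intro tri)
      ultimately show False using w(2) u(2) sym[OF wV V(1)] by (simp add: L_def)
    qed
    moreover have "w \<notin> interval y' y"
    proof
      assume a: "w \<in> interval y' y"
      have "D w y \<le> r" using interval_dist_le(2)[OF a] r(2) sym[OF V(2,4)] by simp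
      moreover have "D u y \<le> D u w + D w y" using V wV by (intro tri)
      ultimately show False using w(2) u(3) by (simp add: L_def)
    qed
    ultimately have wI: "w \<in> interval x' y'" using w(1) by blast
    obtain b' where b': "b' \<in> B'" "d w b' \<le> \<sigma>" using fam_qc[OF BB(2) xy(3,4) wI] by blast
    have b'V: "b' \<in> V" using fam_V[OF BB(2)] b'(1) by blast
    have "D w b' \<le> s" using s[OF wV b'V b'(2)] .
    moreover have "D b b' \<le> D b u + D u b'" "D u b' \<le> D u w + D w b'"
      using V bV wV b'V by (simp_all add: tri)
    ultimately have bb': "D b b' \<le> m" using ub w(2) sym[OF bV V(5)] by (simp add: m_def)
    obtain g where g: "geodesic_seq g (D b b')" "g 0 = b" "g (D b b') = b'"
      using geodesic_exists[OF bV b'V] .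
    define n where "n = D b b'"
    note g = g[folded n_def]
    have nm: "n \<le> m" using bb' by (simp add: n_def)
    define j where "j = (GREATEST j. j \<le> n \<and> g j \<in> B)"
    have jP: "j \<le> n \<and> g j \<in> B"
      unfolding j_def by (rule GreatestI_nat[where k = 0 and b = n]) (use g b in auto)
    have j_max: "g i \<notin> B" if "j < i" "i \<le> n" for i
      using that Greatest_le_nat[where P = "\<lambda>j. j \<le> n \<and> g j \<in> B" and k = i and b = n]
      unfolding j_def by fastforce
    define k where "k = (LEAST k. j \<le> k \<and> g k \<in> B')"
    have kP: "j \<le> k \<and> g k \<in> B'" unfolding k_def
      by (rule LeastI[where k = n]) (use g b' jP in auto)
    have kn: "k \<le> n" unfolding k_def by (rule Least_le) (use g b' jP in auto)
    have k_min: "g i \<notin> B'" if "j \<le> i" "i < k" for i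
      using that not_less_Least[of i "\<lambda>k. j \<le> k \<and> g k \<in> B'"] unfolding k_def by blast
    have gV: "g i \<in> V" if "i \<le> n" for i using geodesic_seqD(1)[OF g(1) that] .
    have edge: "d (g i) (g (Suc i)) \<le> e" if i: "j \<le> i" "i < k" for i
    proof -
      have iV: "g i \<in> V" "g (Suc i) \<in> V" "g j \<in> V" "g k \<in> V" using gV i kn jP by simp_all
      have "D (g i) (g (Suc i)) \<le> 1" using geodesic_seqD(2)[OF g(1), of i "Suc i"] i kn by simp
      then consider "d (g i) (g (Suc i)) \<le> r1" | P where "P \<in> \<P>" "g i \<in> P" "g (Suc i) \<in> P"
        using r1[OF iV(1,2)] by blast
      then show ?thesis
      proof cases
        case 1 then show ?thesis by (simp add: e_def)
      next
        case 2
        have nB: "\<not> P \<subseteq> B" using j_max[of "Suc i"] 2(3) i kn by auto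
        have nB': "\<not> P \<subseteq> B'" using k_min[of i] 2(2) i by auto
        let ?p = "proj P"
        have pV: "?p z \<in> V" if "z \<in> V" for z using proj_V[OF 2(1) that] .
        have Dj: "D (g j) (g i) = i - j" "D (g j) (g (Suc i)) = Suc i - j"
          "D (g i) (g k) = k - i" "D (g (Suc i)) (g k) = k - Suc i"
          using i kn geodesic_seqD(2)[OF g(1)] by simp_all
        have "meets_once P (g j) (g i)"
          by (rule meets_once_before_edge[OF 2(1) iV(3) 2(2,3)]) (use Dj i in simp)
        from R0[OF 2(1) iV(3,1) this] have 1: "d (?p (g j)) (g i) \<le> R0"
          using proj_id[OF 2(1,2)] by simp
        have "meets_once P (g k) (g (Suc i))"
          by (rule meets_once_before_edge[OF 2(1) iV(4) 2(3,2)])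
            (use Dj i sym[OF iV(4,2)] sym[OF iV(4,1)] in simp)
        from R0[OF 2(1) iV(4,2) this] have 5: "d (?p (g k)) (g (Suc i)) \<le> R0"
          using proj_id[OF 2(1,3)] by simp
        have 2: "d (?p (g j)) (?p x) \<le> R1" using R1[OF BB(1) 2(1) _ xy(1) nB] jP by blast
        have 4: "d (?p x') (?p (g k)) \<le> R1" using R1[OF BB(2) \<open>P \<in> \<P>\<close> xy(3) _ nB'] kP by blast
        have "interval x x' \<inter> P = {}"
        proof (rule ccontr)
          assume "interval x x' \<inter> P \<noteq> {}"
          then obtain a where a: "a \<in> interval x x'" "a \<in> P" by blast
          have aV: "a \<in> V" using interval_V[OF a(1)] .
          have "D x a \<le> r" using interval_dist_le(1)[OF a(1)] r(1) by simp
          moreover have "D (g i) a \<le> 1" by (rule per_diam[OF \<open>P \<in> \<P>\<close> \<open>g i \<in> P\<close> a(2)])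
          moreover have "D b (g i) = i" using geodesic_seqD(2)[OF g(1), of 0 i] g i kn by simp
          moreover have "D u x \<le> D u b + D b x" "D b x \<le> D b (g i) + D (g i) x" "D (g i) x \<le> D (g i) a + D a x"
            using V bV aV iV by (simp_all add: tri)
          ultimately show False using u(2) ub i kn nm sym[OF aV V(1)] by (simp add: L_def)
        qed
        then have "meets_once P x x'" by (simp add: meets_once_def)
        from R0[OF \<open>P \<in> \<P>\<close> V(1,3) this] have 3: "d (?p x) (?p x') \<le> R0" .
        have "d (g i) (g (Suc i)) \<le> d (g i) (?p (g j)) + d (?p (g j)) (g (Suc i))"
          "d (?p (g j)) (g (Suc i)) \<le> d (?p (g j)) (?p x) + d (?p x) (g (Suc i))"
          "d (?p x) (g (Suc i)) \<le> d (?p x) (?p x') + d (?p x') (g (Suc i))"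
          "d (?p x') (g (Suc i)) \<le> d (?p x') (?p (g k)) + d (?p (g k)) (g (Suc i))"
          using iV V pV by (simp_all add: metric_tri)
        moreover have "d (g i) (?p (g j)) = d (?p (g j)) (g i)" using iV pV by (intro metric_sym) simp_all
        ultimately show ?thesis using 1 2 3 4 5 unfolding e_def by linarith
      qed
    qed
    have "d (g j) (g k) \<le> real (k - j) * e"
      using metric_along_seq[of n g j k e] gV edge kP kn by blast
    also have "\<dots> \<le> real m * e"
      using kn nm by (intro mult_right_mono) (simp_all add: e_def)
    finally have "d (g j) (g k) \<le> real m * e" .
    moreover have "D u (g j) \<le> s + m"
    proof -
      have "D u (g j) \<le> D u b + D b (g j)" using V bV gV jP by (simp add: tri)
      moreover have "D b (g j) = j" using geodesic_seqD(2)[OF g(1), of 0 j] g jP by simp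
      ultimately show ?thesis using ub jP nm by linarith
    qed
    ultimately show ?thesis using jP kP by blast
  qed
  then show ?thesis by (intro exI[of _ L] exI[of _ "s + m"] exI[of _ "real m * e"]) blast
qed

lemma two_points:
  assumes "x \<in> V" "y \<in> V" "2 * K + W < D x y"
  obtains u v where "u \<in> interval x y" "v \<in> interval x y" "W \<le> D u v"
    "K \<le> D u x" "K \<le> D u y" "K \<le> D v x" "K \<le> D v y"
proof -
  obtain u where u: "u \<in> interval x y" "D x u = K" "D u y = D x y - K"
    using between_interval[of x y K] assms by auto
  obtain v where v: "v \<in> interval x y" "D x v = K + W" "D v y = D x y - (K + W)"
    using between_interval[of x y "K + W"] assms by auto
  have V: "u \<in> V" "v \<in> V" using u v interval_V by auto
  have "D x v \<le> D x u + D u v" using V assms by (simp add: tri)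
  then have "W \<le> D u v" using u v by simp
  moreover have "D u x = K" "D v x = K + W" using sym[OF assms(1)] V u v by simp_all
  ultimately show ?thesis using that[OF u(1) v(1)] u v assms(3) by simp
qed

text \<open>Long fellow-travelling would yield \<open>d\<close>-close pairs at two distant places, hence two distant points
  in the coarse intersection of \<open>B\<close> and \<open>B'\<close>.\<close>

lemma geometric_separation:
  "\<exists>M. \<forall>B\<in>\<F>. \<forall>B'\<in>\<F>. \<forall>x\<in>B. \<forall>y\<in>B. \<forall>x'\<in>B'. \<forall>y'\<in>B'.
     B \<noteq> B' \<longrightarrow> D x x' \<le> r \<longrightarrow> D y y' \<le> r \<longrightarrow> D x y \<le> M"
proof -
  from metric_close_points[of r] obtain L M R where LMR:
    "\<forall>B\<in>\<F>. \<forall>B'\<in>\<F>. \<forall>x\<in>B. \<forall>y\<in>B. \<forall>x'\<in>B'. \<forall>y'\<in>B'. \<forall>u.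
     B \<noteq> B' \<longrightarrow> D x x' \<le> r \<longrightarrow> D y y' \<le> r \<longrightarrow> u \<in> interval x y \<longrightarrow> L \<le> D u x \<longrightarrow> L \<le> D u y \<longrightarrow>
     (\<exists>v\<in>B. \<exists>v'\<in>B'. d v v' \<le> R \<and> D u v \<le> M)" by (elim exE)
  note LMR = LMR[rule_format]
  from fam_sep[of "\<bar>R\<bar>"] obtain \<rho> where \<rho>: "\<forall>B\<in>\<F>. \<forall>B'\<in>\<F>. \<forall>x\<in>V. \<forall>y\<in>V. B \<noteq> B' \<longrightarrow>
      (\<exists>b\<in>B. d x b \<le> \<bar>R\<bar>) \<longrightarrow> (\<exists>b\<in>B'. d x b \<le> \<bar>R\<bar>) \<longrightarrow> (\<exists>b\<in>B. d y b \<le> \<bar>R\<bar>) \<longrightarrow> (\<exists>b\<in>B'. d y b \<le> \<bar>R\<bar>) \<longrightarrow>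
      d x y \<le> \<rho>" ..
  note \<rho> = \<rho>[rule_format]
  from metric_dist[of \<rho>] obtain w where w: "\<forall>x\<in>V. \<forall>y\<in>V. d x y \<le> \<rho> \<longrightarrow> D x y \<le> w" ..
  note w = w[rule_format]
  define W where "W = 2 * M + w + 1"
  have "D x y \<le> 2 * L + W"
    if BB: "B \<in> \<F>" "B' \<in> \<F>" "B \<noteq> B'" and xy: "x \<in> B" "y \<in> B" "x' \<in> B'" "y' \<in> B'"
      and r: "D x x' \<le> r" "D y y' \<le> r" for B B' x y x' y'
  proof (rule ccontr)
    assume "\<not> D x y \<le> 2 * L + W"
    then have big: "2 * L + W < D x y" by simp
    have V: "x \<in> V" "y \<in> V" using fam_V[OF BB(1)] xy by blast+
    obtain u v where uv: "u \<in> interval x y" "v \<in> interval x y" "W \<le> D u v"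
      "L \<le> D u x" "L \<le> D u y" "L \<le> D v x" "L \<le> D v y"
      by (rule two_points[OF V big])
    obtain p p' where p: "p \<in> B" "p' \<in> B'" "d p p' \<le> R" "D u p \<le> M"
      using LMR[OF BB(1,2) xy BB(3) r uv(1,4,5)] by blast
    obtain q q' where q: "q \<in> B" "q' \<in> B'" "d q q' \<le> R" "D v q \<le> M"
      using LMR[OF BB(1,2) xy BB(3) r uv(2,6,7)] by blast
    have pV: "p \<in> V" "q \<in> V" using fam_V[OF BB(1)] p q by blast+
    have uV: "u \<in> V" "v \<in> V" using uv interval_V by blast+
    have "d p q \<le> \<rho>"
    proof (rule \<rho>[OF BB(1,2) pV BB(3)])
      show "\<exists>b\<in>B. d p b \<le> \<bar>R\<bar>" "\<exists>b\<in>B. d q b \<le> \<bar>R\<bar>"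
        using p q pV metric_self by (auto intro: bexI[of _ p] bexI[of _ q])
      have "d p p' \<le> \<bar>R\<bar>" "d q q' \<le> \<bar>R\<bar>" using p q by linarith+
      then show "\<exists>b\<in>B'. d p b \<le> \<bar>R\<bar>" "\<exists>b\<in>B'. d q b \<le> \<bar>R\<bar>" using p q by blast+
    qed
    then have "D p q \<le> w" by (rule w[OF pV])
    moreover have "D u v \<le> D u p + D p v" "D p v \<le> D p q + D q v" using pV uV by (simp_all add: tri)
    ultimately show False using p q uv(3) sym[OF pV(2) uV(2)] by (simp add: W_def)
  qed
  then show ?thesis by blast
qed

definition nearest :: "'a set \<Rightarrow> 'a \<Rightarrow> 'a" where
  "nearest B z = (ARG_MIN (D z) b. b \<in> B)"

lemma nearest:
  assumes "B \<in> \<F>"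
  shows "nearest B z \<in> B" "\<And>c. c \<in> B \<Longrightarrow> D z (nearest B z) \<le> D z c" "nearest B z \<in> V"
proof -
  obtain c where "c \<in> B" using fam_nonempty assms by blast
  then show "nearest B z \<in> B" "\<And>c. c \<in> B \<Longrightarrow> D z (nearest B z) \<le> D z c"
    unfolding nearest_def using arg_min_nat_lemma[of "\<lambda>b. b \<in> B" c "D z"] by auto
  then show "nearest B z \<in> V" using fam_V[OF assms] by blast
qed

lemma nearest_id:
  assumes "B \<in> \<F>" "z \<in> B"
  shows "nearest B z = z"
proof -
  have z: "z \<in> V" using fam_V[OF assms(1)] assms(2) by blast
  then have "D z (nearest B z) = 0" using nearest(2)[OF assms, of z] by simp
  then show ?thesis using dist_eq_0[OF z nearest(3)[OF assms(1)]] by metis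
qed

text \<open>If \<open>v\<close> is close to \<open>B\<close> and also to a geodesic from \<open>z\<close> to its nearest point, then it is close to that
  nearest point, because such a geodesic leaves \<open>B\<close> at full speed.\<close>

lemma nearest_close:
  assumes B: "B \<in> \<F>" and z: "z \<in> V" and w: "w \<in> interval (nearest B z) z" and v: "v \<in> V" "D v w \<le> k"
    and c: "c \<in> B" "D v c \<le> s"
  shows "D v (nearest B z) \<le> 2 * k + s"
proof -
  let ?b = "nearest B z"
  have V: "w \<in> V" "c \<in> V" "?b \<in> V" using interval_V[OF w] fam_V[OF B] c(1) nearest(3)[OF B] by blast+
  have "D z ?b \<le> D z c" by (rule nearest(2)[OF B c(1)])
  moreover have "D ?b w + D w z = D ?b z" using w by (simp add: interval_def)
  moreover have "D z c \<le> D z w + D w c" "D w c \<le> D w v + D v c" "D v ?b \<le> D v w + D w ?b"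
    using V z v by (simp_all add: tri)
  ultimately show ?thesis
    using v(2) c(2) sym[OF V(1) v(1)] sym[OF V(3) z] sym[OF V(1) z] sym[OF V(1,3)] by linarith
qed

text \<open>The middle part of a long geodesic between the two nearest points is close to \<open>B\<close> by quasiconvexity,
  hence away from the sides leading to \<open>z\<close> and \<open>z'\<close>, hence close to the interval between \<open>z\<close> and \<open>z'\<close>.
  That interval is short, or it is close to another member of the family, which is separated from
  \<open>B\<close>.\<close>

lemma nearest_dist_bounded:
  "\<exists>M. \<forall>B\<in>\<F>. \<forall>z\<in>V. \<forall>z'\<in>V. D z z' \<le> 1 \<or> (\<exists>B'\<in>\<F>. B' \<noteq> B \<and> z \<in> B' \<and> z' \<in> B') \<longrightarrow>
     D (nearest B z) (nearest B z') \<le> M"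
proof -
  from metric_dist[of \<sigma>] obtain s where s: "\<forall>x\<in>V. \<forall>y\<in>V. d x y \<le> \<sigma> \<longrightarrow> D x y \<le> s" ..
  note s = s[rule_format]
  from geometric_separation[of "2 * \<delta> + 2 * s"] obtain M where M: "\<forall>B\<in>\<F>. \<forall>B'\<in>\<F>. \<forall>x\<in>B. \<forall>y\<in>B. \<forall>x'\<in>B'. \<forall>y'\<in>B'.
     B \<noteq> B' \<longrightarrow> D x x' \<le> 2 * \<delta> + 2 * s \<longrightarrow> D y y' \<le> 2 * \<delta> + 2 * s \<longrightarrow> D x y \<le> M" ..
  note M = M[rule_format]
  \<comment> \<open>Points at distance \<open>K\<close> from both ends are beyond the reach of \<open>nearest_close\<close> with \<open>k = 2 \<delta>\<close>.\<close>
  define K where "K = 4 * \<delta> + s + 1"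
  define W where "W = 4 * \<delta> + 3 + (2 * s + M)"
  have "D (nearest B z) (nearest B z') \<le> 2 * K + W"
    if B: "B \<in> \<F>" and z: "z \<in> V" "z' \<in> V" and
      zz: "D z z' \<le> 1 \<or> (\<exists>B'\<in>\<F>. B' \<noteq> B \<and> z \<in> B' \<and> z' \<in> B')" for B z z'
  proof (rule ccontr)
    let ?b = "nearest B z" and ?c = "nearest B z'"
    assume "\<not> D ?b ?c \<le> 2 * K + W"
    then have big: "2 * K + W < D ?b ?c" by simp
    note bV = nearest(3)[OF B, of z] nearest(3)[OF B, of z']
    have mid: "\<exists>w\<in>interval z z'. \<exists>c\<in>B. D v w \<le> 2 * \<delta> \<and> D v c \<le> s"
      if v: "v \<in> interval ?b ?c" "K \<le> D v ?b" "K \<le> D v ?c" for v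
    proof -
      have vV: "v \<in> V" using interval_V[OF v(1)] .
      obtain c where c: "c \<in> B" "d v c \<le> \<sigma>" using fam_qc[OF B nearest(1)[OF B] nearest(1)[OF B] v(1)] by blast
      have cV: "c \<in> V" using fam_V[OF B] c(1) by blast
      have vc: "D v c \<le> s" by (rule s[OF vV cV c(2)])
      obtain w where w: "w \<in> interval ?b z \<union> interval z z' \<union> interval z' ?c" "D v w \<le> 2 * \<delta>"
        using slim_quad[OF bV z v(1)] by blast
      have "w \<notin> interval ?b z"
        using nearest_close[OF B z(1) _ vV w(2) c(1) vc] v(2) by (auto simp: K_def)
      moreover have "w \<notin> interval z' ?c"
        using nearest_close[OF B z(2) _ vV w(2) c(1) vc] v(3) interval_commute[OF z(2) bV(2)] by (auto simp: K_def)
      ultimately show ?thesis using w c vc by blast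
    qed
    obtain u v where uv: "u \<in> interval ?b ?c" "v \<in> interval ?b ?c" "W \<le> D u v"
      "K \<le> D u ?b" "K \<le> D u ?c" "K \<le> D v ?b" "K \<le> D v ?c"
      by (rule two_points[OF bV big])
    obtain p p' where p: "p' \<in> interval z z'" "p \<in> B" "D u p' \<le> 2 * \<delta>" "D u p \<le> s"
      using mid[OF uv(1,4,5)] by blast
    obtain q q' where q: "q' \<in> interval z z'" "q \<in> B" "D v q' \<le> 2 * \<delta>" "D v q \<le> s"
      using mid[OF uv(2,6,7)] by blast
    have V: "u \<in> V" "v \<in> V" "p' \<in> V" "q' \<in> V" "p \<in> V" "q \<in> V"
      using uv(1,2) p(1) q(1) interval_V fam_V[OF B] p(2) q(2) by blast+
    from zz show False
    proof
      assume zz: "D z z' \<le> 1"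
      have "D p' q' \<le> D p' z + D z q'" "D u v \<le> D u p' + D p' v" "D p' v \<le> D p' q' + D q' v"
        using V z by (simp_all add: tri)
      moreover have "D p' z \<le> 1" "D z q' \<le> 1"
        using interval_dist_le(1)[OF p(1)] interval_dist_le(1)[OF q(1)] zz sym[OF V(3) z(1)] by simp_all
      ultimately show False using p q uv(3) sym[OF V(4,2)] by (simp add: W_def)
    next
      assume "\<exists>B'\<in>\<F>. B' \<noteq> B \<and> z \<in> B' \<and> z' \<in> B'"
      then obtain B' where B': "B' \<in> \<F>" "B' \<noteq> B" "z \<in> B'" "z' \<in> B'" by blast
      obtain x' where x': "x' \<in> B'" "d p' x' \<le> \<sigma>" using fam_qc[OF B'(1,3,4) p(1)] by blast
      obtain y' where y': "y' \<in> B'" "d q' y' \<le> \<sigma>" using fam_qc[OF B'(1,3,4) q(1)] by blast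
      have V': "x' \<in> V" "y' \<in> V" using fam_V[OF B'(1)] x' y' by blast+
      have "D p' x' \<le> s" "D q' y' \<le> s" using s[OF V(3) V'(1) x'(2)] s[OF V(4) V'(2) y'(2)] .
      moreover have "D p x' \<le> D p u + D u x'" "D u x' \<le> D u p' + D p' x'"
        "D q y' \<le> D q v + D v y'" "D v y' \<le> D v q' + D q' y'"
        using V V' by (simp_all add: tri)
      ultimately have "D p x' \<le> 2 * \<delta> + 2 * s" "D q y' \<le> 2 * \<delta> + 2 * s"
        using p q sym[OF V(5,1)] sym[OF V(6,2)] by linarith+
      then have "D p q \<le> M" using M[OF B B'(1) p(2) q(2) x'(1) y'(1)] B'(2) by blast
      moreover have "D u v \<le> D u p + D p v" "D p v \<le> D p q + D q v" using V by (simp_all add: tri)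
      ultimately show False using uv(3) p q sym[OF V(6,2)] by (simp add: W_def)
    qed
  qed
  then show ?thesis by blast
qed

text \<open>Given the bound in \<open>D\<close>, it suffices to bound each edge of a geodesic between the nearest points.  An
  edge in some \<open>P\<close> not contained in \<open>B\<close> is in the coarse intersection of \<open>P\<close> and \<open>B\<close>.  If \<open>P \<subseteq> B\<close>,
  the other three sides of the quadrilateral meet \<open>P\<close> so little that the projection to \<open>P\<close> moves by
  a bounded amount along them.\<close>

lemma nearest_bounded:
  "\<exists>R. \<forall>B\<in>\<F>. \<forall>z\<in>V. \<forall>z'\<in>V.
     D z z' \<le> 1 \<and> \<not> (z \<in> B \<and> z' \<in> B) \<or> (\<exists>B'\<in>\<F>. B' \<noteq> B \<and> z \<in> B' \<and> z' \<in> B') \<longrightarrow>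
     d (nearest B z) (nearest B z') \<le> R"
proof -
  from edges obtain r1 where r1: "\<forall>x\<in>V. \<forall>y\<in>V. D x y \<le> 1 \<longrightarrow> d x y \<le> r1 \<or> (\<exists>P\<in>\<P>. x \<in> P \<and> y \<in> P)" ..
  note r1 = r1[rule_format]
  from proj_bounded_if_meets_once obtain R0 where R0:
    "\<forall>P\<in>\<P>. \<forall>z\<in>V. \<forall>z'\<in>V. meets_once P z z' \<longrightarrow> d (proj P z) (proj P z') \<le> R0" ..
  note R0 = R0[rule_format]
  from proj_bounded_along_family obtain R1 where R1:
    "\<forall>B\<in>\<F>. \<forall>P\<in>\<P>. \<forall>p\<in>B. \<forall>q\<in>B. \<not> P \<subseteq> B \<longrightarrow> d (proj P p) (proj P q) \<le> R1" ..
  note R1 = R1[rule_format]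
  from nearest_dist_bounded obtain M where M: "\<forall>B\<in>\<F>. \<forall>z\<in>V. \<forall>z'\<in>V.
     D z z' \<le> 1 \<or> (\<exists>B'\<in>\<F>. B' \<noteq> B \<and> z \<in> B' \<and> z' \<in> B') \<longrightarrow> D (nearest B z) (nearest B z') \<le> M" ..
  note M = M[rule_format]
  from fam_per obtain k where k: "\<forall>B\<in>\<F>. \<forall>P\<in>\<P>. \<forall>x\<in>P. \<forall>y\<in>P. \<not> P \<subseteq> B \<longrightarrow>
      (\<exists>b\<in>B. d x b \<le> \<sigma>) \<longrightarrow> (\<exists>b\<in>B. d y b \<le> \<sigma>) \<longrightarrow> d x y \<le> k" ..
  note k = k[rule_format]
  define e where "e = \<bar>r1\<bar> + \<bar>k\<bar> + (5 * \<bar>R0\<bar> + \<bar>R1\<bar>)"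
  have "d (nearest B z) (nearest B z') \<le> real M * e"
    if B: "B \<in> \<F>" and z: "z \<in> V" "z' \<in> V" and
      zz: "D z z' \<le> 1 \<and> \<not> (z \<in> B \<and> z' \<in> B) \<or> (\<exists>B'\<in>\<F>. B' \<noteq> B \<and> z \<in> B' \<and> z' \<in> B')" for B z z'
  proof -
    define b c where "b = nearest B z" and "c = nearest B z'"
    have bV: "b \<in> V" "c \<in> V" and bB: "b \<in> B" "c \<in> B" using nearest[OF B] by (simp_all add: b_def c_def)
    have bc: "D b c \<le> M" unfolding b_def c_def using zz by (intro M[OF B z]) blast
    obtain g where g: "geodesic_seq g (D b c)" "g 0 = b" "g (D b c) = c"
      using geodesic_exists[OF bV] .
    define n where "n = D b c"
    note g = g[folded n_def]
    have gV: "g i \<in> V" if "i \<le> n" for i using geodesic_seqD(1)[OF g(1) that] .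
    have gI: "g i \<in> interval b c" if "i \<le> n" for i using geodesic_seq_interval[OF g(1) that] g by simp
    have edge: "d (g i) (g (Suc i)) \<le> e" if i: "i < n" for i
    proof -
      have iV: "g i \<in> V" "g (Suc i) \<in> V" using gV i by simp_all
      have "D (g i) (g (Suc i)) \<le> 1" using geodesic_seqD(2)[OF g(1), of i "Suc i"] i by simp
      then consider "d (g i) (g (Suc i)) \<le> r1" | P where "P \<in> \<P>" "g i \<in> P" "g (Suc i) \<in> P"
        using r1[OF iV(1,2)] by blast
      then show ?thesis
      proof cases
        case 1 then show ?thesis by (simp add: e_def)
      next
        case P: 2
        show ?thesis
        proof (cases "P \<subseteq> B")
          case False
          have "d (g i) (g (Suc i)) \<le> k"
            using fam_qc[OF B bB gI[of i]] fam_qc[OF B bB gI[of "Suc i"]] i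
            by (intro k[OF B P False]) simp_all
          then show ?thesis by (simp add: e_def)
        next
          case True
          let ?p = "proj P"
          have pV: "?p z \<in> V" if "z \<in> V" for z using proj_V[OF P(1) that] .
          have Dg: "D b (g i) = i" "D b (g (Suc i)) = Suc i" "D c (g i) = n - i" "D c (g (Suc i)) = n - Suc i"
            using geodesic_seqD(2)[OF g(1), of 0 i] geodesic_seqD(2)[OF g(1), of 0 "Suc i"]
              geodesic_seqD(2)[OF g(1), of i n] geodesic_seqD(2)[OF g(1), of "Suc i" n]
              g(2,3) i sym[OF bV(2) iV(1)] sym[OF bV(2) iV(2)] by simp_all
          have "meets_once P b (g i)" by (rule meets_once_before_edge[OF P(1) bV(1) P(2,3)]) (simp add: Dg)
          from R0[OF P(1) bV(1) iV(1) this] have 1: "d (?p b) (g i) \<le> R0" using proj_id[OF P(1,2)] by simp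
          have "meets_once P c (g (Suc i))"
            by (rule meets_once_before_edge[OF P(1) bV(2) P(3,2)]) (use i in \<open>simp add: Dg\<close>)
          from R0[OF P(1) bV(2) iV(2) this] have 2: "d (?p c) (g (Suc i)) \<le> R0" using proj_id[OF P(1,3)] by simp
          have "meets_once P b z"
            by (rule meets_once_proj[OF P(1) z(1) True _ bV(1)]) (simp add: b_def nearest(2)[OF B])
          from R0[OF P(1) bV(1) z(1) this] have 3: "d (?p b) (?p z) \<le> R0" .
          have "meets_once P c z'"
            by (rule meets_once_proj[OF P(1) z(2) True _ bV(2)]) (simp add: c_def nearest(2)[OF B])
          from R0[OF P(1) bV(2) z(2) this] have 4: "d (?p c) (?p z') \<le> R0" .
          have 5: "d (?p z) (?p z') \<le> \<bar>R0\<bar> + \<bar>R1\<bar>"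
            using zz
          proof
            assume zz: "D z z' \<le> 1 \<and> \<not> (z \<in> B \<and> z' \<in> B)"
            then have "meets_once P z z'" using True by (intro meets_once_edge[OF z]) blast+
            from R0[OF P(1) z this] show ?thesis by linarith
          next
            assume "\<exists>B'\<in>\<F>. B' \<noteq> B \<and> z \<in> B' \<and> z' \<in> B'"
            then obtain B' where B': "B' \<in> \<F>" "B' \<noteq> B" "z \<in> B'" "z' \<in> B'" by blast
            have "\<not> P \<subseteq> B'" using fam_disjoint[OF B B'(1)] B'(2) True P(2) by blast
            from R1[OF B'(1) P(1) B'(3,4) this] show ?thesis by linarith
          qed
          have "d (g i) (g (Suc i)) \<le> d (g i) (?p b) + d (?p b) (g (Suc i))"
            "d (?p b) (g (Suc i)) \<le> d (?p b) (?p z) + d (?p z) (g (Suc i))"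
            "d (?p z) (g (Suc i)) \<le> d (?p z) (?p z') + d (?p z') (g (Suc i))"
            "d (?p z') (g (Suc i)) \<le> d (?p z') (?p c) + d (?p c) (g (Suc i))"
            using iV bV z pV by (simp_all add: metric_tri)
          moreover have "d (g i) (?p b) = d (?p b) (g i)" "d (?p z') (?p c) = d (?p c) (?p z')"
            using iV bV z pV by (blast intro: metric_sym)+
          ultimately show ?thesis using 1 2 3 4 5 unfolding e_def by linarith
        qed
      qed
    qed
    have "d (g 0) (g n) \<le> real (n - 0) * e"
      using metric_along_seq[of n g 0 n e] gV edge by blast
    also have "\<dots> \<le> real M * e"
      using bc by (intro mult_right_mono) (simp_all add: e_def n_def)
    finally show ?thesis using g by (simp add: b_def c_def)
  qed
  then show ?thesis by blast
qed

end

section \<open>Walks and distances in relative Cayley graphs\<close>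

text \<open>Both the original and the coned-off Cayley graph are instances.\<close>

locale relative_graph = group G for G (structure) +
  fixes I :: "'i set" and H :: "'i \<Rightarrow> 'a set" and X :: "'a set"
  assumes peripheral_subgroup: "i \<in> I \<Longrightarrow> subgroup (H i) G"
    and generating: "finite_rel_generating_set G I H X"
begin

abbreviation "\<C> \<equiv> rel_cayley_graph G I H X"
abbreviation "\<L> \<equiv> letters G I H X"
abbreviation "walk \<equiv> pre_digraph.awalk \<C>"
abbreviation "vert \<equiv> path_vert \<C>"
abbreviation "gdist \<equiv> graph_dist \<C>"

lemma X_carrier: "X \<subseteq> carrier G" and X_finite: "finite X"
  using generating by (auto simp: finite_rel_generating_set_def)

lemma letter_carrier: "a \<in> \<L> \<Longrightarrow> letter_val a \<in> carrier G"
  by (rule letter_val_in_carrier[OF peripheral_subgroup X_carrier])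

lemma letter_cases:
  assumes "a \<in> \<L>"
  obtains (Gen) s where "a = Gen s" "s \<in> X" | (Per) i h where "a = Per i h" "i \<in> I" "h \<in> H i"
  using assms unfolding letters_def by blast

lemma Per_letter: "Per i h \<in> \<L> \<Longrightarrow> i \<in> I \<and> h \<in> H i"
  by (auto simp: letters_def)

lemma walk_Nil: "walk u [] v \<longleftrightarrow> u = v \<and> u \<in> carrier G"
  by (auto simp: pre_digraph.awalk_def pre_digraph.cas.simps rel_cayley_graph_def)

lemma walk_Cons:
  "walk u (e # p) v \<longleftrightarrow> u \<in> carrier G \<and> fst e = u \<and> snd e \<in> \<L> \<and> walk (u \<otimes> letter_val (snd e)) p v"
  using letter_carrier
  by (cases e) (auto simp: pre_digraph.awalk_def pre_digraph.cas.simps rel_cayley_graph_def)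

lemma walk_carrier: "walk u p v \<Longrightarrow> u \<in> carrier G \<and> v \<in> carrier G"
  by (induction p arbitrary: u) (auto simp: walk_Nil walk_Cons)

lemma vert_Nil: "vert u [] 0 = u"
  by (simp add: path_vert_def pre_digraph.awalk_verts.simps)

lemma vert_Cons:
  "vert u (e # p) 0 = fst e" "vert u (e # p) (Suc k) = vert (fst e \<otimes> letter_val (snd e)) p k"
  by (cases e; simp add: path_vert_def pre_digraph.awalk_verts.simps rel_cayley_graph_def split_def)+

lemma vert_0: "walk u p v \<Longrightarrow> vert u p 0 = u"
  by (cases p) (auto simp: vert_Nil vert_Cons walk_Cons)

lemma vert_length: "walk u p v \<Longrightarrow> vert u p (length p) = v"
  by (induction p arbitrary: u) (auto simp: vert_Nil vert_Cons walk_Nil walk_Cons)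

lemma walk_split:
  assumes "walk u p v" "k \<le> length p"
  shows "walk u (take k p) (vert u p k)" "walk (vert u p k) (drop k p) v"
  using assms
proof (induction p arbitrary: u k)
  case Nil
  { case 1 then show ?case by (auto simp: vert_Nil walk_Nil) }
  { case 2 then show ?case by (auto simp: vert_Nil walk_Nil) }
next
  case (Cons e p)
  { case 1 then show ?case using Cons.IH(1) by (cases k) (auto simp: vert_Cons walk_Cons walk_Nil) }
  { case 2 then show ?case using Cons.IH(2) by (cases k) (auto simp: vert_Cons walk_Cons walk_Nil) }
qed

lemma vert_carrier: "walk u p v \<Longrightarrow> k \<le> length p \<Longrightarrow> vert u p k \<in> carrier G"
  using walk_carrier walk_split by blast

lemma walk_nth:
  assumes "walk u p v" "k < length p"
  shows "fst (p ! k) = vert u p k" "snd (p ! k) \<in> \<L>"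
    "vert u p (Suc k) = vert u p k \<otimes> letter_val (snd (p ! k))"
proof -
  have "walk (vert u p k) (p ! k # drop (Suc k) p) v"
    using walk_split(2)[OF assms(1)] assms(2) by (simp add: Cons_nth_drop_Suc)
  then show e: "fst (p ! k) = vert u p k" "snd (p ! k) \<in> \<L>" by (simp_all add: walk_Cons)
  show "vert u p (Suc k) = vert u p k \<otimes> letter_val (snd (p ! k))"
    using assms e(1)
  proof (induction p arbitrary: u k)
    case (Cons e p)
    show ?case
    proof (cases k)
      case 0
      then show ?thesis using Cons.prems by (auto simp: vert_Cons walk_Cons vert_0)
    next
      case (Suc j)
      then show ?thesis using Cons.prems Cons.IH[of _ j] by (auto simp: vert_Cons walk_Cons)
    qed
  qed simp
qed

lemma walk_verts: "set (pre_digraph.awalk_verts \<C> u p) = vert u p ` {..length p}"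
  by (auto simp: path_vert_def set_conv_nth pre_digraph.length_awalk_verts less_Suc_eq_le)

lemma walk_of_seq:
  assumes "f 0 \<in> carrier G" "\<And>k. k < n \<Longrightarrow> a k \<in> \<L> \<and> f (Suc k) = f k \<otimes> letter_val (a k)"
  shows "walk (f 0) (map (\<lambda>k. (f k, a k)) [0..<n]) (f n) \<and>
    (\<forall>k\<le>n. vert (f 0) (map (\<lambda>k. (f k, a k)) [0..<n]) k = f k)"
proof -
  let ?p = "map (\<lambda>k. (f k, a k)) [0..<n]"
  have "walk (f 0) (map (\<lambda>k. (f k, a k)) [0..<m]) (f m)" if "m \<le> n" for m
    using that
  proof (induction m)
    case 0
    then show ?case using assms(1) by (simp add: walk_Nil)
  next
    case (Suc m)
    then have w: "walk (f 0) (map (\<lambda>k. (f k, a k)) [0..<m]) (f m)" by simp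
    have "walk (f m) [(f m, a m)] (f (Suc m))"
      using walk_letter[of "f m" G "a m" I H X] walk_carrier[OF w] assms(2)[of m] Suc.prems by simp
    from walk_append[OF w this] show ?case by simp
  qed
  then have w: "walk (f 0) ?p (f n)" by simp
  have "vert (f 0) ?p k = f k" if "k \<le> n" for k
    using that
  proof (induction k)
    case 0
    show ?case using vert_0[OF w] .
  next
    case (Suc k)
    then show ?case using walk_nth(3)[OF w, of k] assms(2)[of k] by simp
  qed
  then show ?thesis using w by blast
qed

definition steps :: "('a \<times> 'a) set" where
  "steps = {(u, v). u \<in> carrier G \<and> (\<exists>a\<in>\<L>. v = u \<otimes> letter_val a)}"

lemma steps_sym: "(u, v) \<in> steps \<Longrightarrow> (v, u) \<in> steps"
proof -
  assume "(u, v) \<in> steps"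
  then obtain a where a: "u \<in> carrier G" "a \<in> \<L>" "v = u \<otimes> letter_val a" by (auto simp: steps_def)
  obtain b where b: "b \<in> \<L>" "letter_val b = inv (letter_val a)"
    using inverse_letter[OF is_group peripheral_subgroup generating a(2)] by blast
  then have "u = v \<otimes> letter_val b" using a letter_carrier[OF a(2)] by (simp add: m_assoc)
  moreover have "v \<in> carrier G" using a letter_carrier[OF a(2)] by simp
  ultimately show ?thesis unfolding steps_def using b(1) by blast
qed

text \<open>For distances only the relation between consecutive vertices matters, not the labels.\<close>

lemma relpow_walk:
  assumes "u \<in> carrier G"
  shows "(u, v) \<in> steps ^^ n \<longleftrightarrow> (\<exists>p. walk u p v \<and> length p = n)"
  using assms
proof (induction n arbitrary: u)
  case 0
  then show ?case by (auto simp: walk_Nil)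
next
  case (Suc n)
  have "(u, v) \<in> steps ^^ Suc n \<longleftrightarrow> (\<exists>w. (u, w) \<in> steps \<and> (w, v) \<in> steps ^^ n)"
  proof
    assume "(u, v) \<in> steps ^^ Suc n"
    then show "\<exists>w. (u, w) \<in> steps \<and> (w, v) \<in> steps ^^ n" by (rule relpow_Suc_E2) blast
  next
    assume "\<exists>w. (u, w) \<in> steps \<and> (w, v) \<in> steps ^^ n"
    then obtain w where "(u, w) \<in> steps" "(w, v) \<in> steps ^^ n" by blast
    then show "(u, v) \<in> steps ^^ Suc n" by (rule relpow_Suc_I2)
  qed
  also have "\<dots> \<longleftrightarrow> (\<exists>a\<in>\<L>. (u \<otimes> letter_val a, v) \<in> steps ^^ n)"
    using Suc.prems by (auto simp: steps_def)
  also have "\<dots> \<longleftrightarrow> (\<exists>a\<in>\<L>. \<exists>p. walk (u \<otimes> letter_val a) p v \<and> length p = n)"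
    using Suc.IH Suc.prems letter_carrier by (intro bex_cong) auto
  also have "\<dots> \<longleftrightarrow> (\<exists>p. walk u p v \<and> length p = Suc n)"
  proof
    assume "\<exists>a\<in>\<L>. \<exists>p. walk (u \<otimes> letter_val a) p v \<and> length p = n"
    then obtain a p where "a \<in> \<L>" "walk (u \<otimes> letter_val a) p v" "length p = n" by blast
    then have "walk u ((u, a) # p) v \<and> length ((u, a) # p) = Suc n" using Suc.prems by (simp add: walk_Cons)
    then show "\<exists>p. walk u p v \<and> length p = Suc n" ..
  next
    assume "\<exists>p. walk u p v \<and> length p = Suc n"
    then obtain e p where "walk u (e # p) v" "length p = n" by (auto simp: length_Suc_conv)
    then show "\<exists>a\<in>\<L>. \<exists>p. walk (u \<otimes> letter_val a) p v \<and> length p = n" by (auto simp: walk_Cons)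
  qed
  finally show ?case .
qed

lemma dist_le: "walk u p v \<Longrightarrow> gdist u v \<le> length p"
  unfolding graph_dist_def by (rule Least_le) blast

lemma dist_walk:
  assumes "u \<in> carrier G" "v \<in> carrier G"
  obtains p where "walk u p v" "length p = gdist u v"
proof -
  obtain p where "walk u p v" using walk_exists[OF is_group peripheral_subgroup generating assms] by blast
  then have "\<exists>p. walk u p v \<and> length p = gdist u v"
    unfolding graph_dist_def by (intro LeastI[where P = "\<lambda>n. \<exists>p. walk u p v \<and> length p = n"]) blast
  then show ?thesis using that by blast
qed

lemma relpow_sym: "(u, v) \<in> steps ^^ n \<Longrightarrow> (v, u) \<in> steps ^^ n"
proof (induction n arbitrary: v)
  case (Suc n)
  obtain w where w: "(u, w) \<in> steps ^^ n" "(w, v) \<in> steps" by (rule relpow_Suc_E[OF Suc.prems])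
  show ?case by (rule relpow_Suc_I2[OF steps_sym[OF w(2)] Suc.IH[OF w(1)]])
qed simp

lemma dist_le_relpow: "u \<in> carrier G \<Longrightarrow> (u, v) \<in> steps ^^ n \<Longrightarrow> gdist u v \<le> n"
  using relpow_walk[of u v n] dist_le by auto

lemma dist_relpow: "u \<in> carrier G \<Longrightarrow> v \<in> carrier G \<Longrightarrow> (u, v) \<in> steps ^^ gdist u v"
  by (rule dist_walk[of u v]) (auto simp: relpow_walk)

lemma dist_sym: "u \<in> carrier G \<Longrightarrow> v \<in> carrier G \<Longrightarrow> gdist u v = gdist v u"
  by (rule antisym; rule dist_le_relpow; (rule relpow_sym)?; (rule dist_relpow)?)

lemma relpow_left: "g \<in> carrier G \<Longrightarrow> (u, v) \<in> steps ^^ n \<Longrightarrow> (g \<otimes> u, g \<otimes> v) \<in> steps ^^ n"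
proof (induction n arbitrary: v)
  case (Suc n)
  obtain w where w: "(u, w) \<in> steps ^^ n" "(w, v) \<in> steps" by (rule relpow_Suc_E[OF Suc.prems(2)])
  then have "(g \<otimes> w, g \<otimes> v) \<in> steps" using Suc.prems(1) letter_carrier by (auto simp: steps_def m_assoc)
  then show ?case using Suc.IH[OF Suc.prems(1) w(1)] by (rule relpow_Suc_I[rotated])
qed simp

lemma dist_left:
  assumes "g \<in> carrier G" "u \<in> carrier G" "v \<in> carrier G"
  shows "gdist (g \<otimes> u) (g \<otimes> v) = gdist u v"
proof (rule antisym)
  show "gdist (g \<otimes> u) (g \<otimes> v) \<le> gdist u v"
    using assms by (intro dist_le_relpow relpow_left dist_relpow) auto
  have "(inv g \<otimes> (g \<otimes> u), inv g \<otimes> (g \<otimes> v)) \<in> steps ^^ gdist (g \<otimes> u) (g \<otimes> v)"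
    using assms by (intro relpow_left dist_relpow) auto
  then show "gdist u v \<le> gdist (g \<otimes> u) (g \<otimes> v)"
    using assms by (intro dist_le_relpow) (auto simp: m_assoc[symmetric])
qed

lemma dist_le_1:
  assumes "u \<in> carrier G" "v \<in> carrier G"
  shows "gdist u v \<le> 1 \<longleftrightarrow> u = v \<or> (u, v) \<in> steps"
proof
  assume "gdist u v \<le> 1"
  then have "gdist u v = 0 \<or> gdist u v = 1" by linarith
  then show "u = v \<or> (u, v) \<in> steps" using dist_relpow[OF assms] by auto
next
  assume "u = v \<or> (u, v) \<in> steps"
  then have "(u, v) \<in> steps ^^ 0 \<or> (u, v) \<in> steps ^^ 1" by auto
  then show "gdist u v \<le> 1" using dist_le_relpow[OF assms(1), of v 0] dist_le_relpow[OF assms(1), of v 1] by auto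
qed

sublocale discrete_geodesic_space "carrier G" gdist
proof
  fix x y assume xy: "x \<in> carrier G" "y \<in> carrier G"
  have "x = y" if "gdist x y = 0" using dist_relpow[OF xy] that by simp
  moreover have "gdist x x = 0" using dist_le_relpow[OF xy(1), of x 0] by simp
  ultimately show "gdist x y = 0 \<longleftrightarrow> x = y" by blast
  show "gdist x y = gdist y x" by (rule dist_sym[OF xy])
next
  fix x y z assume "x \<in> carrier G" "y \<in> carrier G" "z \<in> carrier G"
  then show "gdist x z \<le> gdist x y + gdist y z"
    by (intro dist_le_relpow relpow_trans[OF dist_relpow dist_relpow])
next
  fix x y k assume xy: "x \<in> carrier G" "y \<in> carrier G" "k \<le> gdist x y"
  obtain p where p: "walk x p y" "length p = gdist x y" by (rule dist_walk[OF xy(1,2)])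
  let ?w = "vert x p k"
  note s = walk_split[OF p(1), of k]
  have w: "?w \<in> carrier G" using vert_carrier[OF p(1)] xy(3) p(2) by simp
  have "gdist x ?w \<le> k" "gdist ?w y \<le> gdist x y - k" using dist_le[OF s(1)] dist_le[OF s(2)] xy(3) p(2) by auto
  moreover have "gdist x y \<le> gdist x ?w + gdist ?w y"
    using xy w by (intro dist_le_relpow relpow_trans[OF dist_relpow dist_relpow]) auto
  ultimately show "\<exists>w\<in>carrier G. gdist x w = k \<and> gdist w y = gdist x y - k"
    using w xy(3) by (intro bexI[of _ ?w]) auto
qed

lemma walk_dist:
  assumes "walk u p v" "j \<le> k" "k \<le> length p"
  shows "gdist (vert u p j) (vert u p k) \<le> k - j"
  using assms(2,3)
proof (induction k)
  case (Suc k)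
  show ?case
  proof (cases "j = Suc k")
    case False
    have V: "vert u p j \<in> carrier G" "vert u p k \<in> carrier G" "vert u p (Suc k) \<in> carrier G"
      using vert_carrier[OF assms(1)] Suc.prems by simp_all
    have "(vert u p k, vert u p (Suc k)) \<in> steps"
      using walk_nth[OF assms(1), of k] Suc.prems V by (auto simp: steps_def)
    then have "gdist (vert u p k) (vert u p (Suc k)) \<le> 1" using dist_le_1 V by blast
    moreover have "gdist (vert u p j) (vert u p k) \<le> k - j" using Suc False by simp
    moreover have "gdist (vert u p j) (vert u p (Suc k)) \<le> gdist (vert u p j) (vert u p k) + gdist (vert u p k) (vert u p (Suc k))"
      using V by (rule tri)
    ultimately show ?thesis using False Suc.prems by linarith
  qed (use vert_carrier[OF assms(1)] Suc.prems in simp)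
qed (use vert_carrier[OF assms(1), of 0] in simp)

lemma geodesic_walk_seq:
  assumes "geodesic \<C> u p v"
  shows "geodesic_seq (vert u p) (length p)" "walk u p v"
proof -
  show w: "walk u p v" using assms by (simp add: geodesic_def)
  have l: "length p = gdist u v" using assms by (simp add: geodesic_def)
  note V = vert_carrier[OF w]
  have "gdist (vert u p j) (vert u p k) = k - j" if jk: "j \<le> k" "k \<le> length p" for j k
  proof -
    have uv: "u \<in> carrier G" "v \<in> carrier G" using walk_carrier[OF w] by blast+
    have "gdist u v \<le> gdist u (vert u p j) + gdist (vert u p j) v"
      "gdist (vert u p j) v \<le> gdist (vert u p j) (vert u p k) + gdist (vert u p k) v"
      using V jk uv by (simp_all add: tri)
    moreover have "gdist u (vert u p j) \<le> j" "gdist (vert u p k) v \<le> length p - k"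
      using walk_dist[OF w, of 0 j] walk_dist[OF w, of k "length p"] jk vert_0[OF w] vert_length[OF w] by simp_all
    moreover have "gdist (vert u p j) (vert u p k) \<le> k - j" by (rule walk_dist[OF w jk])
    ultimately show ?thesis using l jk by linarith
  qed
  then show "geodesic_seq (vert u p) (length p)" using V by (auto simp: geodesic_seq_def)
qed

lemma geodesic_seq_walk:
  assumes "geodesic_seq f n"
  obtains p where "geodesic \<C> (f 0) p (f n)" "length p = n" "\<And>k. k \<le> n \<Longrightarrow> vert (f 0) p k = f k"
proof -
  have "\<exists>a\<in>\<L>. f (Suc k) = f k \<otimes> letter_val a" if "k < n" for k
  proof -
    have V: "f k \<in> carrier G" "f (Suc k) \<in> carrier G" and d: "gdist (f k) (f (Suc k)) = 1"
      using geodesic_seqD[OF assms] that by simp_all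
    then have "f k \<noteq> f (Suc k)" using dist_eq_0[OF V] by auto
    then show ?thesis using dist_le_1[OF V] d by (auto simp: steps_def)
  qed
  then obtain a where a: "\<And>k. k < n \<Longrightarrow> a k \<in> \<L> \<and> f (Suc k) = f k \<otimes> letter_val (a k)" by metis
  have f0: "f 0 \<in> carrier G" using geodesic_seqD(1)[OF assms] by simp
  let ?p = "map (\<lambda>k. (f k, a k)) [0..<n]"
  have p: "walk (f 0) ?p (f n)" "\<And>k. k \<le> n \<Longrightarrow> vert (f 0) ?p k = f k"
    using walk_of_seq[OF f0 a] by blast+
  have "geodesic \<C> (f 0) ?p (f n)"
    using p(1) geodesic_seqD(2)[OF assms, of 0 n] by (simp add: geodesic_def)
  then show ?thesis using that p(2) by simp
qed

text \<open>Translates membership in an interval to the language of walks.\<close>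

lemma geodesic_through:
  assumes "x \<in> carrier G" "y \<in> carrier G" "v \<in> interval x y"
  obtains p where "geodesic \<C> x p y" "v \<in> set (pre_digraph.awalk_verts \<C> x p)"
proof -
  have v: "v \<in> carrier G" "gdist x v + gdist v y = gdist x y" using assms(3) by (simp_all add: interval_def)
  obtain p where p: "walk x p v" "length p = gdist x v" by (rule dist_walk[OF assms(1) v(1)])
  obtain q where q: "walk v q y" "length q = gdist v y" by (rule dist_walk[OF v(1) assms(2)])
  have w: "walk x (p @ q) y" by (rule walk_append[OF p(1) q(1)])
  have "vert x (p @ q) (length p) = v"
    using walk_split(1)[OF w, of "length p"] vert_length[OF p(1)] vert_length[of x p "vert x (p @ q) (length p)"]
    by simp
  then have "v \<in> set (pre_digraph.awalk_verts \<C> x (p @ q))" by (force simp: walk_verts)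
  moreover have "geodesic \<C> x (p @ q) y" using w p q v by (simp add: geodesic_def)
  ultimately show ?thesis using that by blast
qed

lemma slim_space_if_hyperbolic:
  assumes "hyperbolic_graph \<C>"
  obtains \<delta> where "slim_space (carrier G) gdist \<delta>"
proof -
  obtain \<delta> :: real where \<delta>: "\<delta> \<ge> 0" and slim: "\<And>x y z p q r v. geodesic \<C> x p y \<Longrightarrow> geodesic \<C> y q z \<Longrightarrow>
      geodesic \<C> z r x \<Longrightarrow> v \<in> set (pre_digraph.awalk_verts \<C> x p) \<Longrightarrow>
      \<exists>w \<in> set (pre_digraph.awalk_verts \<C> y q) \<union> set (pre_digraph.awalk_verts \<C> z r). real (gdist v w) \<le> \<delta>"
    using assms unfolding hyperbolic_graph_def by blast
  have "slim_space (carrier G) gdist (nat \<lfloor>\<delta>\<rfloor>)"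
  proof (unfold_locales)
    fix x y z v g n
    assume V: "x \<in> carrier G" "y \<in> carrier G" "z \<in> carrier G" and v: "v \<in> interval x y"
      and g: "geodesic_seq g n" "g 0 = y" "g n = z"
    obtain p where p: "geodesic \<C> x p y" "v \<in> set (pre_digraph.awalk_verts \<C> x p)"
      by (rule geodesic_through[OF V(1,2) v])
    obtain q where q: "geodesic \<C> y q z" "length q = n" "\<And>k. k \<le> n \<Longrightarrow> vert y q k = g k"
      using geodesic_seq_walk[OF g(1)] g(2,3) by metis
    obtain f where f: "geodesic_seq f (gdist z x)" "f 0 = z" "f (gdist z x) = x"
      by (rule geodesic_exists[OF V(3,1)])
    obtain r where r: "geodesic \<C> z r x" using geodesic_seq_walk[OF f(1)] f(2,3) by metis
    obtain w where w: "w \<in> set (pre_digraph.awalk_verts \<C> y q) \<union> set (pre_digraph.awalk_verts \<C> z r)"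
      "real (gdist v w) \<le> \<delta>" using slim[OF p(1) q(1) r p(2)] by blast
    have dw: "gdist v w \<le> nat \<lfloor>\<delta>\<rfloor>" using w(2) by (simp add: le_nat_floor)
    from w(1) show "(\<exists>k\<le>n. gdist v (g k) \<le> nat \<lfloor>\<delta>\<rfloor>) \<or> (\<exists>w\<in>interval z x. gdist v w \<le> nat \<lfloor>\<delta>\<rfloor>)"
    proof
      assume "w \<in> set (pre_digraph.awalk_verts \<C> y q)"
      then obtain k where "k \<le> n" "w = g k" using q by (auto simp: walk_verts)
      then show ?thesis using dw by blast
    next
      assume "w \<in> set (pre_digraph.awalk_verts \<C> z r)"
      then obtain k where k: "k \<le> length r" "w = vert z r k" by (auto simp: walk_verts)
      note gr = geodesic_walk_seq[OF r]
      have "w \<in> interval z x"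
        using geodesic_seq_interval[OF gr(1) k(1)] k(2) vert_0[OF gr(2)] vert_length[OF gr(2)] by simp
      then show ?thesis using dw by blast
    qed
  qed
  then show ?thesis by (rule that)
qed

lemma mem_lcoset:
  assumes "subgroup K G" "x \<in> carrier G"
  shows "y \<in> x <# K \<longleftrightarrow> y \<in> carrier G \<and> inv x \<otimes> y \<in> K"
proof -
  interpret K: subgroup K G by fact
  show ?thesis
  proof
    assume "y \<in> x <# K"
    then obtain k where "k \<in> K" "y = x \<otimes> k" by (auto simp: l_coset_def)
    then show "y \<in> carrier G \<and> inv x \<otimes> y \<in> K" using assms(2) K.mem_carrier by (simp add: m_assoc[symmetric])
  next
    assume "y \<in> carrier G \<and> inv x \<otimes> y \<in> K"
    moreover have "y = x \<otimes> (inv x \<otimes> y)" if "y \<in> carrier G" using that assms(2) by (simp add: m_assoc[symmetric])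
    ultimately show "y \<in> x <# K" by (auto simp: l_coset_def)
  qed
qed

end

section \<open>Components of walks\<close>

lemma labelled_by_subpath:
  assumes "n \<le> length p"
  shows "labelled_by i (subpath p m n) \<longleftrightarrow> (\<forall>k. m \<le> k \<and> k < n \<longrightarrow> (\<exists>h. snd (p ! k) = Per i h))"
proof -
  have "subpath p m n = map ((!) p) [m..<n]"
    using assms by (intro nth_equalityI) (auto simp: subpath_def)
  then show ?thesis by (auto simp: labelled_by_def)
qed

lemma component_edge:
  assumes "component i p m n" "m \<le> k" "k < n"
  shows "\<exists>h. snd (p ! k) = Per i h"
  using assms labelled_by_subpath[of n p i m] by (simp add: component_def)

lemma component_unique:
  assumes "component i p m n" "component i p m n'"
  shows "n = n'"
proof -
  have "k = l" if "component i p m k" "component i p m l" "k \<le> l" for k l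
    using that unfolding component_def by blast
  then show ?thesis using assms by (metis nle_le)
qed

text \<open>Among all subpaths through the edge with labels of one type, take a longest one.\<close>

lemma component_exists:
  assumes "k < length p" "snd (p ! k) = Per i h"
  shows "\<exists>m n. component i p m n \<and> m \<le> k \<and> k < n"
proof -
  define R where "R = (\<lambda>(m, n). m \<le> k \<and> k < n \<and> n \<le> length p \<and> labelled_by i (subpath p m n))"
  have "R (k, Suc k)" using assms by (auto simp: R_def labelled_by_subpath less_Suc_eq)
  moreover have "\<forall>mn. R mn \<longrightarrow> snd mn - fst mn < Suc (length p)" by (auto simp: R_def)
  ultimately obtain mn where mn: "R mn" "\<forall>mn'. R mn' \<longrightarrow> snd mn' - fst mn' \<le> snd mn - fst mn"
    using ex_has_greatest_nat[of R "(k, Suc k)" "\<lambda>mn. snd mn - fst mn" "Suc (length p)"] by blast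
  obtain m n where e: "mn = (m, n)" by (cases mn)
  have "m' = m \<and> n' = n" if "m' \<le> m" "n \<le> n'" "n' \<le> length p" "labelled_by i (subpath p m' n')" for m' n'
  proof -
    have "R (m', n')" using that mn(1) by (auto simp: R_def e)
    then have "n' - m' \<le> n - m" using mn(2) e by fastforce
    then show ?thesis using that mn(1) by (auto simp: R_def e)
  qed
  then have "component i p m n" using mn(1) by (auto simp: R_def e component_def)
  then show ?thesis using mn(1) by (auto simp: R_def e)
qed

context relative_graph
begin

lemma lcoset_eq: "\<lbrakk>subgroup K G; x \<in> carrier G; y \<in> x <# K\<rbrakk> \<Longrightarrow> y <# K = x <# K"
  using l_repr_independence by blast

lemma lcoset_self: "\<lbrakk>subgroup K G; x \<in> carrier G\<rbrakk> \<Longrightarrow> x \<in> x <# K"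
  using mem_lcoset subgroup.one_closed by force

lemma lcoset_carrier: "\<lbrakk>subgroup K G; x \<in> carrier G\<rbrakk> \<Longrightarrow> x <# K \<subseteq> carrier G"
  using mem_lcoset by blast

lemma lcoset_mult: "\<lbrakk>subgroup K G; x \<in> carrier G; k \<in> K\<rbrakk> \<Longrightarrow> x \<otimes> k \<in> x <# K"
  by (auto simp: l_coset_def)

text \<open>An edge labelled by an element of \<open>K\<close> stays in its coset of \<open>K\<close>.\<close>

lemma lcoset_mult_iff:
  assumes "subgroup K G" "x \<in> carrier G" "u \<in> carrier G" "k \<in> K"
  shows "u \<otimes> k \<in> x <# K \<longleftrightarrow> u \<in> x <# K"
proof
  have k: "k \<in> carrier G" using assms subgroup.mem_carrier by metis
  have m: "u \<otimes> k \<in> u <# K" by (rule lcoset_mult[OF assms(1,3,4)])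
  { assume "u \<otimes> k \<in> x <# K"
    then have "x <# K = u <# K" using lcoset_eq[OF assms(1,2)] lcoset_eq[OF assms(1,3) m] by simp
    then show "u \<in> x <# K" using lcoset_self[OF assms(1,3)] by simp }
  { assume "u \<in> x <# K"
    then show "u \<otimes> k \<in> x <# K" using lcoset_eq[OF assms(1,2)] m by blast }
qed

lemma labelled_coset:
  assumes w: "walk u p v" and i: "i \<in> I" and "m \<le> n" "n \<le> length p"
    and lab: "\<And>k. m \<le> k \<Longrightarrow> k < n \<Longrightarrow> \<exists>h. snd (p ! k) = Per i h"
  shows "vert u p n \<in> vert u p m <# H i"
  using assms(3,4) lab
proof (induction n rule: dec_induct)
  case base
  then show ?case using lcoset_self[OF peripheral_subgroup[OF i]] vert_carrier[OF w] by simp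
next
  case (step n)
  have V: "vert u p m \<in> carrier G" "vert u p n \<in> carrier G" using vert_carrier[OF w] step by simp_all
  have "vert u p n \<in> vert u p m <# H i" using step by simp
  moreover obtain h where h: "snd (p ! n) = Per i h" using step by blast
  moreover have "h \<in> H i" using walk_nth(2)[OF w, of n] h step Per_letter by auto
  ultimately show ?case
    using walk_nth(3)[OF w, of n] step lcoset_mult_iff[OF peripheral_subgroup[OF i] V, of h] by simp
qed

lemma component_index:
  assumes "walk u p v" "component i p m n"
  shows "i \<in> I"
proof -
  have "m < n" "n \<le> length p" using assms(2) by (auto simp: component_def)
  then show ?thesis
    using component_edge[OF assms(2), of m] walk_nth(2)[OF assms(1), of m] Per_letter by auto
qed

lemma component_coset:
  assumes w: "walk u p v" and c: "component i p m n" and k: "m \<le> k" "k \<le> n"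
  shows "vert u p k \<in> vert u p m <# H i"
  using component_edge[OF c] k c
  by (intro labelled_coset[OF w component_index[OF w c]]) (auto simp: component_def)

lemma coset_connected_iff:
  assumes i: "i \<in> I" and v: "v \<in> carrier G"
  shows "coset_connected \<C> i v w \<longleftrightarrow> w \<in> v <# H i"
proof
  note K = peripheral_subgroup[OF i]
  assume "coset_connected \<C> i v w"
  then obtain c where c: "walk v c w" "labelled_by i c" by (auto simp: coset_connected_def)
  have "vert v c (length c) \<in> vert v c 0 <# H i"
    using c(2) by (intro labelled_coset[OF c(1) i]) (auto simp: labelled_by_def)
  then show "w \<in> v <# H i" using vert_0[OF c(1)] vert_length[OF c(1)] by simp
next
  assume "w \<in> v <# H i"
  then have w: "w \<in> carrier G" "inv v \<otimes> w \<in> H i" using mem_lcoset[OF peripheral_subgroup[OF i] v] by auto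
  show "coset_connected \<C> i v w"
  proof (cases "v = w")
    case True
    then have "walk v [] w" using v by (simp add: walk_Nil)
    then show ?thesis unfolding coset_connected_def labelled_by_def by (intro exI[of _ "[]"]) simp
  next
    case False
    have e: "v \<otimes> (inv v \<otimes> w) = w" using v w by (simp add: m_assoc[symmetric])
    then have "inv v \<otimes> w \<noteq> \<one>" using False v by auto
    then have "Per i (inv v \<otimes> w) \<in> \<L>" using i w by (auto simp: letters_def)
    then have "walk v [(v, Per i (inv v \<otimes> w))] w" using v w e by (simp add: walk_Cons walk_Nil)
    then show ?thesis unfolding coset_connected_def labelled_by_def
      by (intro exI[of _ "[(v, Per i (inv v \<otimes> w))]"]) simp
  qed
qed

text \<open>Otherwise the edge would belong to a second component, connected to the given one.\<close>

lemma without_backtracking_edge: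
  assumes w: "walk u p v" and nb: "without_backtracking \<C> u p" and c: "component i p m n"
    and k: "k < length p" "snd (p ! k) = Per i h" "vert u p k \<in> vert u p m <# H i"
  shows "m \<le> k \<and> k < n"
proof (rule ccontr)
  assume no: "\<not> (m \<le> k \<and> k < n)"
  note i = component_index[OF w c]
  note K = peripheral_subgroup[OF i]
  obtain m' n' where c': "component i p m' n'" "m' \<le> k" "k < n'" using component_exists[OF k(1,2)] by blast
  have V: "vert u p m \<in> carrier G" "vert u p m' \<in> carrier G" "vert u p k \<in> carrier G"
    using vert_carrier[OF w] c c' k by (auto simp: component_def)
  have "vert u p k \<in> vert u p m' <# H i" using component_coset[OF w c'(1)] c' by simp
  then have "vert u p m' <# H i = vert u p m <# H i"
    using lcoset_eq[OF K V(1) k(3)] lcoset_eq[OF K V(2)] by simp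
  then have "vert u p m' \<in> vert u p m <# H i" using lcoset_self[OF K V(2)] by simp
  then have "coset_connected \<C> i (vert u p m) (vert u p m')" using coset_connected_iff[OF i V(1)] by simp
  moreover have "(m', n') \<noteq> (m, n)" using no c' by auto
  moreover have "isolated \<C> i u p m n" using nb c by (simp add: without_backtracking_def)
  ultimately show False using c'(1) by (auto simp: isolated_def)
qed

section \<open>Penetration of cosets and loops\<close>

text \<open>The steps allowed to a path that bypasses \<open>C\<close>.  Edges of other types may join two points of \<open>C\<close>.\<close>

definition off :: "'i \<Rightarrow> 'a set \<Rightarrow> ('a \<times> 'a) set" where
  "off i C = {(u, v). u \<in> carrier G \<and> (\<exists>a\<in>\<L>. v = u \<otimes> letter_val a \<and> \<not> (u \<in> C \<and> (\<exists>h. a = Per i h)))}"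

text \<open>A substitute for bounded coset penetration that does not refer to quasigeodesics.  In terms of
  loops: an edge that is isolated in a loop of length \<open>N + 1\<close> is bounded in \<open>d\<close>.\<close>

definition fine_wrt :: "('a \<Rightarrow> 'a \<Rightarrow> real) \<Rightarrow> bool" where
  "fine_wrt d \<longleftrightarrow> (\<forall>N. \<exists>r. \<forall>i\<in>I. \<forall>x\<in>carrier G. \<forall>y \<in> x <# H i. \<forall>n\<le>N.
     (x, y) \<in> off i (x <# H i) ^^ n \<longrightarrow> d x y \<le> r)"

lemma off_walk:
  "\<lbrakk>x \<in> carrier G; (x, y) \<in> off i C ^^ n\<rbrakk> \<Longrightarrow>
    \<exists>p. walk x p y \<and> length p = n \<and> (\<forall>e\<in>set p. \<not> (fst e \<in> C \<and> (\<exists>h. snd e = Per i h)))"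
proof (induction n arbitrary: x)
  case 0
  then show ?case by (simp add: walk_Nil)
next
  case (Suc n)
  obtain z where z: "(x, z) \<in> off i C" "(z, y) \<in> off i C ^^ n" by (rule relpow_Suc_E2[OF Suc.prems(2)])
  obtain a where a: "a \<in> \<L>" "z = x \<otimes> letter_val a" "\<not> (x \<in> C \<and> (\<exists>h. a = Per i h))"
    using z(1) by (auto simp: off_def)
  then have "z \<in> carrier G" using letter_carrier Suc.prems(1) by simp
  then obtain p where p: "walk z p y" "length p = n" "\<forall>e\<in>set p. \<not> (fst e \<in> C \<and> (\<exists>h. snd e = Per i h))"
    using Suc.IH[OF _ z(2)] by blast
  have "walk x ((x, a) # p) y" using Suc.prems(1) a p(1) by (simp add: walk_Cons)
  moreover have "length ((x, a) # p) = Suc n" using p by simp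
  moreover have "\<forall>e\<in>set ((x, a) # p). \<not> (fst e \<in> C \<and> (\<exists>h. snd e = Per i h))" using a p by simp
  ultimately show ?case by blast
qed

text \<open>The walk leaves and re-enters the coset, and any two points of the coset are joined by an edge of
  type \<open>j\<close>.\<close>

lemma shortcut:
  assumes w: "walk x r y" and jk: "m < k" "k < length r"
    and l: "snd (r ! m) = Per j h" "snd (r ! k) = Per j h'" and co: "vert x r k \<in> vert x r m <# H j"
  obtains s where "walk x s y" "length s < length r"
    "\<forall>e\<in>set s. e \<in> set r \<or> (\<exists>h. e = (vert x r m, Per j h))"
proof -
  have V: "vert x r m \<in> carrier G" "vert x r k \<in> carrier G" "vert x r (Suc k) \<in> carrier G"
    using vert_carrier[OF w] jk by simp_all
  have j: "j \<in> I" "h' \<in> H j" using walk_nth(2)[OF w, of k] l jk Per_letter by auto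
  note K = peripheral_subgroup[OF j(1)]
  have "vert x r (Suc k) \<in> vert x r m <# H j"
    using walk_nth(3)[OF w jk(2)] l co lcoset_mult_iff[OF K V(1,2) j(2)] by simp
  then have q: "inv (vert x r m) \<otimes> vert x r (Suc k) \<in> H j" using mem_lcoset[OF K V(1)] by simp
  let ?q = "inv (vert x r m) \<otimes> vert x r (Suc k)"
  have e: "vert x r m \<otimes> ?q = vert x r (Suc k)" using V by (simp add: m_assoc[symmetric])
  define mid where "mid = (if vert x r m = vert x r (Suc k) then [] else [(vert x r m, Per j ?q)])"
  have "walk (vert x r m) mid (vert x r (Suc k))"
  proof (cases "vert x r m = vert x r (Suc k)")
    case True
    then show ?thesis using V by (simp add: mid_def walk_Nil)
  next
    case False
    then have "?q \<noteq> \<one>" using e V by auto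
    then have "Per j ?q \<in> \<L>" using j q by (auto simp: letters_def)
    then show ?thesis using False V e by (simp add: mid_def walk_Cons walk_Nil)
  qed
  then have mid_walk: "walk x (take m r @ mid @ drop (Suc k) r) y"
    using walk_split(1)[OF w, of m] walk_split(2)[OF w, of "Suc k"] jk by (auto intro!: walk_append)
  have mid_short: "length (take m r @ mid @ drop (Suc k) r) < length r" using jk by (auto simp: mid_def)
  have "\<forall>e \<in> set (take m r @ mid @ drop (Suc k) r). e \<in> set r \<or> (\<exists>h. e = (vert x r m, Per j h))"
    by (auto simp: mid_def dest: in_set_takeD in_set_dropD split: if_splits)
  from that[OF mid_walk mid_short this] show ?thesis .
qed

text \<open>Backtracking could be removed by a shortcut, and a shortcut does not create edges of type \<open>i\<close> in
  \<open>C\<close>: its new edge lies in a coset that already contains an edge of the walk of the same type.\<close>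

lemma shortest_without_backtracking:
  assumes w: "walk x r y"
    and good: "\<And>e. e \<in> set r \<Longrightarrow> \<not> (fst e \<in> C \<and> (\<exists>h. snd e = Per i h))"
    and shortest: "\<And>s. walk x s y \<Longrightarrow> (\<And>e. e \<in> set s \<Longrightarrow> \<not> (fst e \<in> C \<and> (\<exists>h. snd e = Per i h))) \<Longrightarrow>
      length r \<le> length s"
  shows "without_backtracking \<C> x r"
proof -
  have no: "vert x r k \<notin> vert x r m <# H j"
    if mk: "m < k" "k < length r" and l: "snd (r ! m) = Per j h" "snd (r ! k) = Per j h'" for m k j h h'
  proof
    assume co: "vert x r k \<in> vert x r m <# H j"
    obtain s where s: "walk x s y" "length s < length r"
      "\<forall>e\<in>set s. e \<in> set r \<or> (\<exists>h. e = (vert x r m, Per j h))"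
      by (rule shortcut[OF w mk l co])
    have "r ! m \<in> set r" "fst (r ! m) = vert x r m" using mk walk_nth(1)[OF w, of m] by simp_all
    then have "\<not> (vert x r m \<in> C \<and> j = i)" using good[of "r ! m"] l(1) by auto
    then have "length r \<le> length s" using s(3) good by (intro shortest[OF s(1)]) fastforce
    then show False using s(2) by simp
  qed
  show ?thesis
    unfolding without_backtracking_def isolated_def
  proof (intro allI impI)
    fix j m n m' n'
    assume c: "component j r m n" and "component j r m' n' \<and> (m', n') \<noteq> (m, n)"
    then have c': "component j r m' n'" and ne: "(m', n') \<noteq> (m, n)" by blast+
    note j = component_index[OF w c]
    note K = peripheral_subgroup[OF j]
    have mn: "m < n" "n \<le> length r" "m' < n'" "n' \<le> length r" using c c' by (auto simp: component_def)
    have V: "vert x r m \<in> carrier G" "vert x r m' \<in> carrier G" using vert_carrier[OF w] mn by simp_all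
    obtain h h' where l: "snd (r ! m) = Per j h" "snd (r ! m') = Per j h'"
      using component_edge[OF c, of m] component_edge[OF c', of m'] mn by auto
    have "m \<noteq> m'"
      using ne component_unique[OF c, of n'] c' by auto
    then consider "m < m'" | "m' < m" by linarith
    then have "vert x r m' \<notin> vert x r m <# H j"
    proof cases
      case 1 then show ?thesis using no[OF 1 _ l] mn by simp
    next
      case 2
      then have "vert x r m \<notin> vert x r m' <# H j" using no[OF 2 _ l(2,1)] mn by simp
      then show ?thesis using lcoset_eq[OF K V(1)] lcoset_self[OF K V(1)] by blast
    qed
    then show "\<not> coset_connected \<C> j (vert x r m) (vert x r m')" using coset_connected_iff[OF j V(1)] by simp
  qed
qed

lemma trivial_quasigeodesic:
  assumes "walk u p v" "length p \<le> N"
  shows "quasigeodesic \<C> 1 (real N) u p v"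
  using assms by (auto simp: quasigeodesic_def subpath_def)

text \<open>Compare the single edge from \<open>x\<close> to \<open>y\<close> with a shortest walk from \<open>x\<close> to \<open>y\<close> that has no edge of type
  \<open>i\<close> in the coset.  The latter cannot penetrate the coset, so the edge is not long.\<close>

lemma fine_if_penetration:
  assumes self: "\<And>x. x \<in> carrier G \<Longrightarrow> d x x = 0"
    and pen: "\<And>u v p q i m n. \<lbrakk>quasigeodesic \<C> 1 (real N) u p v; without_backtracking \<C> u p;
      quasigeodesic \<C> 1 (real N) u q v; without_backtracking \<C> u q; i \<in> I;
      component i p m n; d (vert u p m) (vert u p n) > a\<rbrakk> \<Longrightarrow>
      \<exists>m' n'. component i q m' n' \<and> coset_connected \<C> i (vert u p m) (vert u q m')"
    and i: "i \<in> I" and x: "x \<in> carrier G" and y: "y \<in> x <# H i" and n: "n \<le> N"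
    and xy: "(x, y) \<in> off i (x <# H i) ^^ n"
  shows "d x y \<le> max a (0::real)"
proof (cases "x = y")
  case True
  then show ?thesis using self x by simp
next
  case False
  let ?C = "x <# H i"
  define good where "good p \<longleftrightarrow> walk x p y \<and> (\<forall>e\<in>set p. \<not> (fst e \<in> ?C \<and> (\<exists>h. snd e = Per i h)))" for p
  note K = peripheral_subgroup[OF i]
  obtain p where p: "good p" "length p = n" using off_walk[OF x xy] by (auto simp: good_def)
  obtain r where r: "good r" "\<And>s. good s \<Longrightarrow> length r \<le> length s"
    using ex_has_least_nat[of good p length] p(1) by blast
  have rw: "walk x r y" using r(1) by (simp add: good_def)
  have rN: "length r \<le> N" using r(2)[OF p(1)] p(2) n by simp
  have rb: "without_backtracking \<C> x r"
    using r by (intro shortest_without_backtracking[OF rw, of ?C i]) (auto simp: good_def)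
  have q: "y \<in> carrier G" "inv x \<otimes> y \<in> H i" using y mem_lcoset[OF K x] by auto
  let ?s = "[(x, Per i (inv x \<otimes> y))]"
  have e: "x \<otimes> (inv x \<otimes> y) = y" using x q by (simp add: m_assoc[symmetric])
  then have "inv x \<otimes> y \<noteq> \<one>" using False x by auto
  then have "Per i (inv x \<otimes> y) \<in> \<L>" using i q by (auto simp: letters_def)
  then have sw: "walk x ?s y" using x q e by (simp add: walk_Cons walk_Nil)
  have "r \<noteq> []" using rw False by (auto simp: walk_Nil)
  then have "length ?s \<le> N" using rN by (cases r) auto
  have comp: "component j ?s m n' \<longleftrightarrow> j = i \<and> m = 0 \<and> n' = 1" for j m n'
  proof
    assume c: "component j ?s m n'"
    then have mn: "m = 0 \<and> n' = 1" by (auto simp: component_def)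
    then show "j = i \<and> m = 0 \<and> n' = 1" using component_edge[OF c, of 0] by auto
  next
    assume "j = i \<and> m = 0 \<and> n' = 1"
    then show "component j ?s m n'" by (auto simp: component_def labelled_by_subpath)
  qed
  have sb: "without_backtracking \<C> x ?s" by (auto simp: without_backtracking_def isolated_def comp)
  have sv: "vert x ?s 0 = x" "vert x ?s 1 = y" using vert_0[OF sw] vert_length[OF sw] by simp_all
  show ?thesis
  proof (rule ccontr)
    assume "\<not> d x y \<le> max a 0"
    then have far: "d (vert x ?s 0) (vert x ?s 1) > a" unfolding sv by simp
    have "component i ?s 0 1" by (simp add: comp)
    from pen[OF trivial_quasigeodesic[OF sw \<open>length ?s \<le> N\<close>] sb trivial_quasigeodesic[OF rw rN] rb i this far]
    obtain m' n' where c: "component i r m' n'" "coset_connected \<C> i x (vert x r m')" unfolding sv by blast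
    then have m': "m' < length r" "vert x r m' \<in> ?C"
      using coset_connected_iff[OF i x] by (auto simp: component_def)
    have "m' < n'" using c(1) by (auto simp: component_def)
    then have "\<exists>h. snd (r ! m') = Per i h" using component_edge[OF c(1), of m'] by simp
    moreover have "r ! m' \<in> set r" "fst (r ! m') \<in> ?C" using m' walk_nth(1)[OF rw m'(1)] by simp_all
    ultimately show False using r(1) by (auto simp: good_def)
  qed
qed

text \<open>The two conditions that the bounded coset penetration property imposes on the constant \<open>a\<close>.\<close>

definition penetration_bound :: "('a \<Rightarrow> 'a \<Rightarrow> real) \<Rightarrow> real \<Rightarrow> real \<Rightarrow> real \<Rightarrow> bool" where
  "penetration_bound d l c a \<longleftrightarrow> (\<forall>u v p q.
     quasigeodesic \<C> l c u p v \<and> without_backtracking \<C> u p \<and>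
     quasigeodesic \<C> l c u q v \<and> without_backtracking \<C> u q \<longrightarrow>
     (\<forall>i \<in> I. \<forall>m n.
        component i p m n \<and> d (vert u p m) (vert u p n) > a \<longrightarrow>
        (\<exists>m' n'. component i q m' n' \<and> coset_connected \<C> i (vert u p m) (vert u q m'))) \<and>
     (\<forall>i \<in> I. \<forall>m n m' n'.
        component i p m n \<and> component i q m' n' \<and> coset_connected \<C> i (vert u p m) (vert u q m') \<longrightarrow>
        d (vert u p m) (vert u q m') < a \<and> d (vert u p n) (vert u q n') < a))"

lemma BCP_iff:
  "BCP G I H X \<longleftrightarrow> (\<exists>d. proper_left_inv_metric G d \<and>
     (\<forall>l c. l \<ge> 1 \<and> c \<ge> 0 \<longrightarrow> (\<exists>a. penetration_bound d l c a)))"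
  unfolding BCP_def penetration_bound_def Let_def ..

lemma BCP_imp_fine:
  assumes "BCP G I H X"
  obtains d where "proper_left_inv_metric G d" "fine_wrt d"
proof -
  obtain d where d: "proper_left_inv_metric G d"
    and bcp: "\<And>l c. l \<ge> 1 \<Longrightarrow> c \<ge> 0 \<Longrightarrow> \<exists>a. penetration_bound d l c a"
    using assms unfolding BCP_iff by blast
  interpret M: Metric_space "carrier G" d using d by (simp add: proper_left_inv_metric_def)
  have "\<exists>r. \<forall>i\<in>I. \<forall>x\<in>carrier G. \<forall>y \<in> x <# H i. \<forall>n\<le>N. (x, y) \<in> off i (x <# H i) ^^ n \<longrightarrow> d x y \<le> r" for N
  proof -
    obtain a where a: "penetration_bound d 1 (real N) a" using bcp[of 1 "real N"] by auto
    have pen: "\<exists>m' n'. component i q m' n' \<and> coset_connected \<C> i (vert u p m) (vert u q m')"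
      if "quasigeodesic \<C> 1 (real N) u p v" "without_backtracking \<C> u p"
        "quasigeodesic \<C> 1 (real N) u q v" "without_backtracking \<C> u q" "i \<in> I"
        "component i p m n" "d (vert u p m) (vert u p n) > a" for u v p q i m n
      using a that unfolding penetration_bound_def by blast
    have self: "d x x = 0" if "x \<in> carrier G" for x using that by simp
    have "d x y \<le> max a 0" if "i \<in> I" "x \<in> carrier G" "y \<in> x <# H i" "n \<le> N" "(x, y) \<in> off i (x <# H i) ^^ n"
      for i x y n
      by (rule fine_if_penetration[OF self pen that])
    then show ?thesis by blast
  qed
  then have "fine_wrt d" by (simp add: fine_wrt_def)
  then show ?thesis using that d by blast
qed

end

section \<open>Bounded coset penetration from loops of bounded length\<close>

context relative_graph
begin

lemma coset_diam:
  assumes i: "i \<in> I" and x: "x \<in> carrier G" and "u \<in> x <# H i" "v \<in> x <# H i"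
  shows "gdist u v \<le> 1"
proof -
  note K = peripheral_subgroup[OF i]
  have V: "u \<in> carrier G" "v \<in> carrier G" using lcoset_carrier[OF K x] assms(3,4) by auto
  have "v \<in> u <# H i" using lcoset_eq[OF K x assms(3)] assms(4) by simp
  then have q: "inv u \<otimes> v \<in> H i" using mem_lcoset[OF K V(1)] by simp
  have e: "u \<otimes> (inv u \<otimes> v) = v" using V by (simp add: m_assoc[symmetric])
  show ?thesis
  proof (cases "u = v")
    case False
    then have "inv u \<otimes> v \<noteq> \<one>" using e V by auto
    then have "Per i (inv u \<otimes> v) \<in> \<L>" using i q by (auto simp: letters_def)
    then have "(u, v) \<in> steps" unfolding steps_def using V e by force
    then show ?thesis using dist_le_1[OF V] by simp
  qed (use V in simp)
qed

definition reach_off :: "'i \<Rightarrow> 'a set \<Rightarrow> nat \<Rightarrow> 'a \<Rightarrow> 'a \<Rightarrow> bool" where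
  "reach_off i C N x y \<longleftrightarrow> (\<exists>n\<le>N. (x, y) \<in> off i C ^^ n)"

text \<open>The opposite edge has a label of the same type and stays in the same coset.\<close>

lemma off_sym:
  assumes i: "i \<in> I" and x: "x \<in> carrier G" and uv: "(u, v) \<in> off i (x <# H i)"
  shows "(v, u) \<in> off i (x <# H i)"
proof -
  let ?C = "x <# H i"
  note K = peripheral_subgroup[OF i]
  obtain a where a: "u \<in> carrier G" "a \<in> \<L>" "v = u \<otimes> letter_val a" "\<not> (u \<in> ?C \<and> (\<exists>h. a = Per i h))"
    using uv by (auto simp: off_def)
  have ac: "letter_val a \<in> carrier G" by (rule letter_carrier[OF a(2)])
  have v: "v \<in> carrier G" using a ac by simp
  have backward: "v \<otimes> inv (letter_val a) = u" using a ac by (simp add: m_assoc)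
  from a(2) show ?thesis
  proof (cases rule: letter_cases)
    case (Gen s)
    then have "inv s \<in> X" using generating by (auto simp: finite_rel_generating_set_def)
    then have "Gen (inv s) \<in> \<L>" by (auto simp: letters_def)
    then show ?thesis unfolding off_def using v backward Gen by (auto intro!: bexI[of _ "Gen (inv s)"])
  next
    case (Per j k)
    interpret K: subgroup "H j" G by (rule peripheral_subgroup[OF Per(2)])
    have "k \<noteq> \<one>" using a(2) Per by (auto simp: letters_def)
    then have "inv k \<noteq> \<one>" using Per by simp
    moreover have "inv k \<in> H j" using Per by simp
    ultimately have l: "Per j (inv k) \<in> \<L>" unfolding letters_def using Per(2) by blast
    have "\<not> (v \<in> ?C \<and> j = i)"
    proof
      assume "v \<in> ?C \<and> j = i"
      then have "u \<in> ?C" using lcoset_mult_iff[OF K x a(1), of k] a(3) Per by simp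
      then show False using a(4) Per \<open>v \<in> ?C \<and> j = i\<close> by auto
    qed
    then show ?thesis unfolding off_def using v backward Per l by (auto intro!: bexI[of _ "Per j (inv k)"])
  qed
qed

lemma reach_off_trans:
  assumes "reach_off i C m x y" "reach_off i C n y z"
  shows "reach_off i C (m + n) x z"
proof -
  obtain j k where jk: "j \<le> m" "(x, y) \<in> off i C ^^ j" "k \<le> n" "(y, z) \<in> off i C ^^ k"
    using assms by (auto simp: reach_off_def)
  have "(x, z) \<in> off i C ^^ (j + k)" by (rule relpow_trans[OF jk(2,4)])
  moreover have "j + k \<le> m + n" using jk by simp
  ultimately show ?thesis unfolding reach_off_def by blast
qed

lemma reach_off_mono: "\<lbrakk>reach_off i C m x y; m \<le> n\<rbrakk> \<Longrightarrow> reach_off i C n x y"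
  unfolding reach_off_def using order_trans by blast

lemma reach_off_sym:
  assumes "i \<in> I" "x \<in> carrier G" "reach_off i (x <# H i) n u v"
  shows "reach_off i (x <# H i) n v u"
proof -
  have "(v, u) \<in> off i (x <# H i) ^^ m" if "(u, v) \<in> off i (x <# H i) ^^ m" for m v
    using that
  proof (induction m arbitrary: v)
    case (Suc m)
    obtain w where w: "(u, w) \<in> off i (x <# H i) ^^ m" "(w, v) \<in> off i (x <# H i)"
      by (rule relpow_Suc_E[OF Suc.prems])
    show ?case by (rule relpow_Suc_I2[OF off_sym[OF assms(1,2) w(2)] Suc.IH[OF w(1)]])
  qed simp
  then show ?thesis using assms(3) unfolding reach_off_def by blast
qed

lemma reach_off_seq:
  assumes "j \<le> m" "\<And>k. j \<le> k \<Longrightarrow> k < m \<Longrightarrow> (f k, f (Suc k)) \<in> off i C"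
  shows "reach_off i C (m - j) (f j) (f m)"
proof -
  have "(f j, f m) \<in> off i C ^^ (m - j)"
    unfolding relpow_fun_conv using assms by (intro exI[of _ "\<lambda>k. f (j + k)"]) auto
  then show ?thesis unfolding reach_off_def by blast
qed

lemma reach_off_seq_between:
  assumes ix: "i \<in> I" "x \<in> carrier G" and "j \<le> n" "k \<le> n"
    and st: "\<And>k. k < n \<Longrightarrow> (f k, f (Suc k)) \<in> off i (x <# H i)" and "\<bar>int j - int k\<bar> \<le> int N"
  shows "reach_off i (x <# H i) N (f j) (f k)"
proof (cases "j \<le> k")
  case True
  then have "reach_off i (x <# H i) (k - j) (f j) (f k)" using assms by (intro reach_off_seq st) auto
  then show ?thesis by (rule reach_off_mono) (use assms True in auto)
next
  case False
  then have "reach_off i (x <# H i) (j - k) (f k) (f j)" using assms by (intro reach_off_seq st) auto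
  then show ?thesis by (rule reach_off_mono[OF reach_off_sym[OF ix]]) (use assms False in auto)
qed

text \<open>A path whose initial point is farther from \<open>C\<close> than the path is long cannot meet \<open>C\<close>.\<close>

lemma reach_off_far:
  assumes "u \<in> carrier G" "t \<in> carrier G" "gdist u t \<le> R" "\<And>c. c \<in> C \<Longrightarrow> c \<in> carrier G \<Longrightarrow> R < gdist u c"
  shows "reach_off i C R u t"
proof -
  obtain g where g: "geodesic_seq g (gdist u t)" "g 0 = u" "g (gdist u t) = t"
    by (rule geodesic_exists[OF assms(1,2)])
  have "(g k, g (Suc k)) \<in> off i C" if "k < gdist u t" for k
  proof -
    have V: "g k \<in> carrier G" "g (Suc k) \<in> carrier G" and d: "gdist (g k) (g (Suc k)) = 1" "gdist u (g k) = k"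
      using geodesic_seqD[OF g(1)] geodesic_seqD(2)[OF g(1), of 0 k] g(2) that by simp_all
    have "g k \<noteq> g (Suc k)" using d dist_eq_0[OF V] by auto
    then have "(g k, g (Suc k)) \<in> steps" using dist_le_1[OF V] d by auto
    moreover have "g k \<notin> C" using assms(3) assms(4)[of "g k"] V d that by auto
    ultimately show ?thesis by (auto simp: steps_def off_def)
  qed
  then have "reach_off i C (gdist u t - 0) (g 0) (g (gdist u t))" by (intro reach_off_seq) auto
  then have "reach_off i C (gdist u t) u t" using g by simp
  then show ?thesis by (rule reach_off_mono[OF _ assms(3)])
qed

lemma reach_off_gdist:
  assumes "x \<in> carrier G" "reach_off i C n x y"
  shows "gdist x y \<le> n"
proof -
  obtain m where m: "m \<le> n" "(x, y) \<in> off i C ^^ m" using assms(2) by (auto simp: reach_off_def)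
  have "off i C \<subseteq> steps" by (auto simp: off_def steps_def)
  then have "(x, y) \<in> steps ^^ m" using m(2) unfolding relpow_fun_conv by blast
  then show ?thesis using dist_le_relpow[OF assms(1)] m(1) order_trans by blast
qed

end

text \<open>The distance \<open>D\<close> is auxiliary: its geodesics serve as a reference that all quasigeodesics of the
  relative Cayley graph fellow-travel with.\<close>

locale stable_relative_graph =
  relative_graph G I H X + M: coned_space "carrier G" D gdist \<delta> h
  for G (structure) and I :: "'i set" and H X D \<delta> h +
  fixes d :: "'a \<Rightarrow> 'a \<Rightarrow> real"
  assumes proper: "proper_left_inv_metric G d" and fine: "fine_wrt d"
begin

lemma quasi_seq_rev:
  assumes "M.quasi_seq l c f n"
  shows "M.quasi_seq l c (\<lambda>k. f (n - k)) n"
proof -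
  note f = M.quasi_seqD[OF assms]
  have 1: "gdist (f (n - k)) (f (n - Suc k)) \<le> 1" if "k < n" for k
    using f(2)[of "n - Suc k"] f(1) that sym[of "f (n - k)" "f (n - Suc k)"]
    by (simp add: Suc_diff_Suc)
  have 2: "j - i \<le> l * gdist (f (n - i)) (f (n - j)) + c" if "i \<le> j" "j \<le> n" for i j
    using f(3)[of "n - j" "n - i"] f(1) that sym[of "f (n - i)" "f (n - j)"] by simp
  show ?thesis unfolding M.quasi_seq_def using f(1) 1 2 by simp
qed

lemma quasi_seq_prefix: "M.quasi_seq l c f n \<Longrightarrow> m \<le> n \<Longrightarrow> M.quasi_seq l c f m"
  by (simp add: M.quasi_seq_def)

lemma quasigeodesic_seq:
  assumes q: "quasigeodesic \<C> l c u p v"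
  shows "M.quasi_seq (nat \<lceil>l\<rceil>) (nat \<lceil>c\<rceil>) (vert u p) (length p)" "walk u p v"
proof -
  show w: "walk u p v" using q by (simp add: quasigeodesic_def)
  note V = vert_carrier[OF w]
  have "j - i \<le> nat \<lceil>l\<rceil> * gdist (vert u p i) (vert u p j) + nat \<lceil>c\<rceil>" if ij: "i \<le> j" "j \<le> length p" for i j
  proof -
    let ?g = "gdist (vert u p i) (vert u p j)"
    have len: "length (subpath p i j) = j - i" using ij by (simp add: subpath_def)
    have "real (length (subpath p i j)) \<le> l * real ?g + c" using q ij by (simp add: quasigeodesic_def)
    then have "real (j - i) \<le> l * real ?g + c" using len by simp
    also have "\<dots> \<le> real (nat \<lceil>l\<rceil>) * real ?g + real (nat \<lceil>c\<rceil>)"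
      by (intro add_mono mult_right_mono real_nat_ceiling_ge) simp
    also have "\<dots> = real (nat \<lceil>l\<rceil> * ?g + nat \<lceil>c\<rceil>)" by simp
    finally show ?thesis using of_nat_le_iff by blast
  qed
  moreover have "gdist (vert u p k) (vert u p (Suc k)) \<le> 1" if "k < length p" for k
    using walk_dist[OF w, of k "Suc k"] that by simp
  ultimately show "M.quasi_seq (nat \<lceil>l\<rceil>) (nat \<lceil>c\<rceil>) (vert u p) (length p)"
    using V by (simp add: M.quasi_seq_def)
qed

text \<open>Follow the quasigeodesic backwards from \<open>f n\<close> until its distance from \<open>f n\<close>, hence from the coset,
  exceeds \<open>R + 1\<close>; from there cross over to \<open>T\<close> along a geodesic of length at most \<open>R\<close>, which is too
  short to touch the coset.\<close>

lemma escape: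
  assumes i: "i \<in> I" and x: "x \<in> carrier G" and f: "M.quasi_seq l c f n" and fn: "f n \<in> x <# H i"
    and st: "\<And>k. k < n \<Longrightarrow> (f k, f (Suc k)) \<in> off i (x <# H i)"
    and T: "f 0 \<in> T" "T \<subseteq> carrier G"
    and near: "\<And>k. k \<le> n \<Longrightarrow> (\<exists>t\<in>T. gdist (f k) t \<le> R) \<or> gdist (f k) (f n) \<le> R"
  shows "\<exists>t\<in>T. reach_off i (x <# H i) (l * (R + 1) + c + 1 + R) (f n) t"
proof -
  let ?C = "x <# H i"
  define m where "m = l * (R + 1) + c + 1"
  note fV = M.quasi_seqD(1)[OF f]
  have backward: "reach_off i ?C (n - k) (f n) (f k)" if "k \<le> n" for k
  proof -
    have "reach_off i ?C (n - k) (f k) (f n)" using that st by (intro reach_off_seq) auto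
    then show ?thesis by (rule reach_off_sym[OF i x])
  qed
  show ?thesis
  proof (cases "n \<le> m")
    case True
    have "reach_off i ?C (m + R) (f n) (f 0)" by (rule reach_off_mono[OF backward[of 0]]) (use True in auto)
    then show ?thesis using T by (auto simp: m_def)
  next
    case False
    define k where "k = n - m"
    have k: "k \<le> n" "n - k = m" using False by (auto simp: k_def)
    have "m \<le> l * gdist (f k) (f n) + c" using M.quasi_seqD(3)[OF f, of k n] k by simp
    then have "l * (R + 1) < l * gdist (f k) (f n)" by (simp add: m_def)
    then have far: "R + 1 < gdist (f k) (f n)" using mult_less_cancel1[of l "R + 1" "gdist (f k) (f n)"] by blast
    then obtain t where t: "t \<in> T" "gdist (f k) t \<le> R" using near[OF k(1)] by auto
    have "R < gdist (f k) z" if z: "z \<in> ?C" "z \<in> carrier G" for z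
    proof -
      have "gdist z (f n) \<le> 1" by (rule coset_diam[OF i x z(1) fn])
      moreover have "gdist (f k) (f n) \<le> gdist (f k) z + gdist z (f n)" using fV k z by (intro tri) auto
      ultimately show ?thesis using far by linarith
    qed
    then have "reach_off i ?C R (f k) t" using fV[OF k(1)] t T by (intro reach_off_far) auto
    then have "reach_off i ?C (m + R) (f n) t" using reach_off_trans[OF backward[OF k(1)]] k(2) by simp
    then show ?thesis using t by (auto simp: m_def)
  qed
qed

text \<open>Two quasigeodesics that start at the same point and arrive in the same coset fellow-travel, so one
  can go back along \<open>f\<close>, cross over, and return along \<open>g\<close>.  Proves the second half of bounded coset
  penetration.\<close>

lemma endpoints_close:
  "\<exists>N. \<forall>i\<in>I. \<forall>x\<in>carrier G. \<forall>f n g m. M.quasi_seq l c f n \<longrightarrow> M.quasi_seq l c g m \<longrightarrow> f 0 = g 0 \<longrightarrow>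
     f n \<in> x <# H i \<longrightarrow> g m \<in> x <# H i \<longrightarrow> (\<forall>k<n. (f k, f (Suc k)) \<in> off i (x <# H i)) \<longrightarrow>
     (\<forall>k<m. (g k, g (Suc k)) \<in> off i (x <# H i)) \<longrightarrow> reach_off i (x <# H i) N (f n) (g m)"
proof -
  from M.interval_near_quasi_seq[of l c] obtain T where
    "\<forall>f n v. M.quasi_seq l c f n \<longrightarrow> v \<in> M.interval (f 0) (f n) \<longrightarrow> (\<exists>j\<le>n. gdist v (f j) \<le> T)" ..
  note T = this[rule_format]
  from M.quasi_seq_near_interval[of l c] obtain S where
    "\<forall>f n j. M.quasi_seq l c f n \<longrightarrow> j \<le> n \<longrightarrow> (\<exists>v\<in>M.interval (f 0) (f n). gdist (f j) v \<le> S)" ..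
  note S = this[rule_format]
  define R where "R = S + \<delta> + T + h"
  define N0 where "N0 = l * (R + 1) + c + 1 + R"
  define N1 where "N1 = l * (N0 + 1) + c"
  have "reach_off i (x <# H i) (N0 + N1) (f n) (g m)"
    if i: "i \<in> I" and x: "x \<in> carrier G" and f: "M.quasi_seq l c f n" and g: "M.quasi_seq l c g m" and fg: "f 0 = g 0"
      and fn: "f n \<in> x <# H i" and gm: "g m \<in> x <# H i"
      and fs: "\<And>k. k < n \<Longrightarrow> (f k, f (Suc k)) \<in> off i (x <# H i)"
      and gs: "\<And>k. k < m \<Longrightarrow> (g k, g (Suc k)) \<in> off i (x <# H i)" for i x f n g m
  proof -
    note V = M.quasi_seqD(1)[OF f] M.quasi_seqD(1)[OF g]
    have d1: "gdist (f n) (g m) \<le> 1" by (rule coset_diam[OF i x fn gm])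
    have "(\<exists>t\<in>g ` {..m}. gdist (f k) t \<le> R) \<or> gdist (f k) (f n) \<le> R" if k: "k \<le> n" for k
    proof -
      obtain v where v: "v \<in> M.interval (f 0) (f n)" "gdist (f k) v \<le> S" using S[OF f k] by blast
      have "f 0 \<in> carrier G" "f n \<in> carrier G" "g m \<in> carrier G" using V by simp_all
      from M.slim[OF this v(1)] obtain w where
        w: "w \<in> M.interval (f 0) (g m) \<union> M.interval (g m) (f n)" "D v w \<le> \<delta>" ..
      have W: "v \<in> carrier G" "w \<in> carrier G" using v w M.interval_V by blast+
      have "gdist (f k) w \<le> gdist (f k) v + gdist v w" using V k W by (simp add: tri)
      moreover have "gdist v w \<le> D v w" using M.coned_le W by simp
      ultimately have kw: "gdist (f k) w \<le> S + \<delta>" using v(2) w(2) by linarith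
      from w(1) show ?thesis
      proof
        assume "w \<in> M.interval (f 0) (g m)"
        then obtain j where j: "j \<le> m" "gdist w (g j) \<le> T" using T[OF g] fg by auto
        have "gdist (f k) (g j) \<le> gdist (f k) w + gdist w (g j)" using V k W j by (simp add: tri)
        then have "gdist (f k) (g j) \<le> R" using kw j unfolding R_def by linarith
        then show ?thesis using j(1) by blast
      next
        assume "w \<in> M.interval (g m) (f n)"
        then have wI: "w \<in> M.interval (f n) (g m)" using M.interval_commute V by simp
        have "gdist (f n) w \<le> h" using V d1 wI by (intro M.interval_bounded) auto
        then have "gdist w (f n) \<le> h" using sym V W by simp
        moreover have "gdist (f k) (f n) \<le> gdist (f k) w + gdist w (f n)" using V k W by (simp add: tri)
        ultimately show ?thesis using kw by (simp add: R_def)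
      qed
    qed
    moreover have "f 0 \<in> g ` {..m}" "g ` {..m} \<subseteq> carrier G" using fg V by auto
    ultimately obtain t where t: "t \<in> g ` {..m}" "reach_off i (x <# H i) N0 (f n) t"
      using escape[OF i x f fn fs, of "g ` {..m}" R] unfolding N0_def by blast
    then obtain j where j: "j \<le> m" "t = g j" by auto
    have "gdist (f n) (g j) \<le> N0" using reach_off_gdist[OF _ t(2)] V j by simp
    moreover have "gdist (g j) (g m) \<le> gdist (g j) (f n) + gdist (f n) (g m)" using V j by (simp add: tri)
    moreover have "gdist (g j) (f n) = gdist (f n) (g j)" using V j by (simp add: sym)
    ultimately have "gdist (g j) (g m) \<le> N0 + 1" using d1 by linarith
    then have "l * gdist (g j) (g m) + c \<le> N1" unfolding N1_def by (intro add_le_mono1 mult_le_mono2)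
    then have "m - j \<le> N1" using M.quasi_seqD(3)[OF g j(1)] by simp
    then have "reach_off i (x <# H i) N1 (g j) (g m)"
      using j gs by (intro reach_off_mono[OF reach_off_seq]) auto
    then show ?thesis using reach_off_trans[OF t(2)] j by simp
  qed
  then show ?thesis by (intro exI[of _ "N0 + N1"]) blast
qed

text \<open>If \<open>g\<close> has no edge in a coset that \<open>f\<close> penetrates between \<open>f j\<close> and \<open>f k\<close>, one can cross over to \<open>g\<close>
  before and after and follow \<open>g\<close> in between.  Proves the first half of bounded coset penetration.\<close>

lemma bypass_close:
  "\<exists>N. \<forall>i\<in>I. \<forall>x\<in>carrier G. \<forall>f n g m j k. M.quasi_seq l c f n \<longrightarrow> M.quasi_seq l c g m \<longrightarrow> f 0 = g 0 \<longrightarrow>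
     f n = g m \<longrightarrow> j \<le> k \<longrightarrow> k \<le> n \<longrightarrow> f j \<in> x <# H i \<longrightarrow> f k \<in> x <# H i \<longrightarrow>
     (\<forall>e<n. e < j \<or> k \<le> e \<longrightarrow> (f e, f (Suc e)) \<in> off i (x <# H i)) \<longrightarrow>
     (\<forall>e<m. (g e, g (Suc e)) \<in> off i (x <# H i)) \<longrightarrow> reach_off i (x <# H i) N (f j) (f k)"
proof -
  from M.interval_near_quasi_seq[of l c] obtain T where
    "\<forall>f n v. M.quasi_seq l c f n \<longrightarrow> v \<in> M.interval (f 0) (f n) \<longrightarrow> (\<exists>j\<le>n. gdist v (f j) \<le> T)" ..
  note T = this[rule_format]
  from M.quasi_seq_near_interval[of l c] obtain S where
    "\<forall>f n j. M.quasi_seq l c f n \<longrightarrow> j \<le> n \<longrightarrow> (\<exists>v\<in>M.interval (f 0) (f n). gdist (f j) v \<le> S)" ..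
  note S = this[rule_format]
  define R where "R = S + T"
  define N0 where "N0 = l * (R + 1) + c + 1 + R"
  define N1 where "N1 = l * (2 * N0 + 1) + c"
  have "reach_off i (x <# H i) (N0 + N1 + N0) (f j) (f k)"
    if i: "i \<in> I" and x: "x \<in> carrier G" and f: "M.quasi_seq l c f n" and g: "M.quasi_seq l c g m" and fg: "f 0 = g 0" "f n = g m"
      and jk: "j \<le> k" "k \<le> n" and fj: "f j \<in> x <# H i" and fk: "f k \<in> x <# H i"
      and fs: "\<And>e. e < n \<Longrightarrow> e < j \<or> k \<le> e \<Longrightarrow> (f e, f (Suc e)) \<in> off i (x <# H i)"
      and gs: "\<And>e. e < m \<Longrightarrow> (g e, g (Suc e)) \<in> off i (x <# H i)" for i x f n g m j k
  proof -
    note V = M.quasi_seqD(1)[OF f] M.quasi_seqD(1)[OF g]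
    have near: "\<exists>t\<in>g ` {..m}. gdist (f e) t \<le> R" if e: "e \<le> n" for e
    proof -
      obtain v where v: "v \<in> M.interval (f 0) (f n)" "gdist (f e) v \<le> S" using S[OF f e] by blast
      then obtain b where b: "b \<le> m" "gdist v (g b) \<le> T" using T[OF g] fg by auto
      have "v \<in> carrier G" using v(1) M.interval_V by blast
      then have "gdist (f e) (g b) \<le> gdist (f e) v + gdist v (g b)" using V e b by (simp add: tri)
      then have "gdist (f e) (g b) \<le> R" using v b unfolding R_def by linarith
      then show ?thesis using b(1) by blast
    qed
    have gT: "g ` {..m} \<subseteq> carrier G" using V by auto
    have "\<exists>t\<in>g ` {..m}. reach_off i (x <# H i) N0 (f j) t"
      unfolding N0_def
      by (rule escape[OF i x quasi_seq_prefix[OF f] fj fs _ gT]) (use jk near fg in auto)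
    then obtain a where a: "a \<le> m" "reach_off i (x <# H i) N0 (f j) (g a)" by auto
    define f' where "f' = (\<lambda>e. f (n - e))"
    have backward: "(f' e, f' (Suc e)) \<in> off i (x <# H i)" if "e < n - k" for e
    proof -
      have "(f (n - Suc e), f (Suc (n - Suc e))) \<in> off i (x <# H i)" using that by (intro fs) auto
      moreover have "Suc (n - Suc e) = n - e" using that by simp
      ultimately show ?thesis unfolding f'_def using off_sym[OF i x] by simp
    qed
    have qf': "M.quasi_seq l c f' (n - k)" unfolding f'_def by (rule quasi_seq_prefix[OF quasi_seq_rev[OF f]]) simp
    have fk': "f' (n - k) = f k" and f'0: "f' 0 \<in> g ` {..m}" using fg jk by (simp_all add: f'_def)
    have near': "(\<exists>t\<in>g ` {..m}. gdist (f' e) t \<le> R) \<or> gdist (f' e) (f' (n - k)) \<le> R" for e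
      unfolding f'_def by (rule disjI1, rule near) simp
    have "f' (n - k) \<in> x <# H i" using fk fk' by simp
    from escape[OF i x qf' this backward f'0 gT near']
    obtain b where b: "b \<le> m" "reach_off i (x <# H i) N0 (f k) (g b)" by (auto simp: N0_def fk')
    have W: "f j \<in> carrier G" "f k \<in> carrier G" "g a \<in> carrier G" "g b \<in> carrier G" using V a b jk by simp_all
    have "gdist (g a) (g b) \<le> gdist (g a) (f j) + gdist (f j) (g b)"
      "gdist (f j) (g b) \<le> gdist (f j) (f k) + gdist (f k) (g b)" using W by (simp_all add: tri)
    moreover have "gdist (f j) (g a) \<le> N0" "gdist (f k) (g b) \<le> N0"
      using reach_off_gdist[OF _ a(2)] reach_off_gdist[OF _ b(2)] W by simp_all
    moreover have "gdist (f j) (f k) \<le> 1" by (rule coset_diam[OF i x fj fk])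
    moreover have "gdist (g a) (f j) = gdist (f j) (g a)" using W by (simp add: sym)
    ultimately have ab: "gdist (g a) (g b) \<le> 2 * N0 + 1" by linarith
    then have le: "l * gdist (g a) (g b) + c \<le> N1" unfolding N1_def by (intro add_le_mono1 mult_le_mono2)
    have ba: "gdist (g b) (g a) = gdist (g a) (g b)" using W by (simp add: sym)
    have "\<bar>int a - int b\<bar> \<le> int N1"
    proof (cases "a \<le> b")
      case True
      then show ?thesis using M.quasi_seqD(3)[OF g True b(1)] le by linarith
    next
      case False
      then have "b \<le> a" by simp
      have "a - b \<le> N1" using M.quasi_seqD(3)[OF g \<open>b \<le> a\<close> a(1)] le unfolding ba by simp
      then show ?thesis using \<open>b \<le> a\<close> by linarith
    qed
    then have "reach_off i (x <# H i) N1 (g a) (g b)"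
      using gs by (intro reach_off_seq_between[OF i x a(1) b(1)])
    from reach_off_trans[OF reach_off_trans[OF a(2) this] reach_off_sym[OF i x b(2)]] show ?thesis .
  qed
  then show ?thesis by (intro exI[of _ "N0 + N1 + N0"]) blast
qed

lemma walk_off:
  assumes w: "walk u p v" and k: "k < length p" and no: "\<And>h. snd (p ! k) = Per i h \<Longrightarrow> vert u p k \<notin> C"
  shows "(vert u p k, vert u p (Suc k)) \<in> off i C"
proof -
  have "vert u p k \<in> carrier G" using vert_carrier[OF w] k by simp
  moreover have "\<not> (vert u p k \<in> C \<and> (\<exists>h. snd (p ! k) = Per i h))" using no by blast
  ultimately show ?thesis using walk_nth(2,3)[OF w k] by (auto simp: off_def)
qed

lemma BCP: "BCP G I H X"
proof -
  have "\<exists>a. penetration_bound d l c a" for l c :: real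
  proof -
    let ?l = "nat \<lceil>l\<rceil>" and ?c = "nat \<lceil>c\<rceil>"
    from endpoints_close[of ?l ?c] obtain N1 where "\<forall>i\<in>I. \<forall>x\<in>carrier G. \<forall>f n g m.
      M.quasi_seq ?l ?c f n \<longrightarrow> M.quasi_seq ?l ?c g m \<longrightarrow> f 0 = g 0 \<longrightarrow>
      f n \<in> x <# H i \<longrightarrow> g m \<in> x <# H i \<longrightarrow> (\<forall>k<n. (f k, f (Suc k)) \<in> off i (x <# H i)) \<longrightarrow>
      (\<forall>k<m. (g k, g (Suc k)) \<in> off i (x <# H i)) \<longrightarrow> reach_off i (x <# H i) N1 (f n) (g m)" ..
    note N1 = this[rule_format]
    from bypass_close[of ?l ?c] obtain N2 where "\<forall>i\<in>I. \<forall>x\<in>carrier G. \<forall>f n g m j k.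
      M.quasi_seq ?l ?c f n \<longrightarrow> M.quasi_seq ?l ?c g m \<longrightarrow> f 0 = g 0 \<longrightarrow>
      f n = g m \<longrightarrow> j \<le> k \<longrightarrow> k \<le> n \<longrightarrow> f j \<in> x <# H i \<longrightarrow> f k \<in> x <# H i \<longrightarrow>
      (\<forall>e<n. e < j \<or> k \<le> e \<longrightarrow> (f e, f (Suc e)) \<in> off i (x <# H i)) \<longrightarrow>
      (\<forall>e<m. (g e, g (Suc e)) \<in> off i (x <# H i)) \<longrightarrow> reach_off i (x <# H i) N2 (f j) (f k)" ..
    note N2 = this[rule_format]
    obtain a where a: "\<forall>i\<in>I. \<forall>x\<in>carrier G. \<forall>y \<in> x <# H i. \<forall>n\<le>N1 + N2.
      (x, y) \<in> off i (x <# H i) ^^ n \<longrightarrow> d x y \<le> a"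
      using fine unfolding fine_wrt_def by blast
    have close: "d x y \<le> a"
      if i: "i \<in> I" and z: "z \<in> carrier G" and x: "x \<in> z <# H i" and y: "y \<in> z <# H i"
        and r: "reach_off i (z <# H i) N x y" and N: "N \<le> N1 + N2" for i x y z N
    proof -
      note K = peripheral_subgroup[OF i]
      have e: "x <# H i = z <# H i" by (rule lcoset_eq[OF K z x])
      have "x \<in> carrier G" using lcoset_carrier[OF K z] x by blast
      moreover obtain n where "n \<le> N" "(x, y) \<in> off i (z <# H i) ^^ n" using r by (auto simp: reach_off_def)
      moreover have "n \<le> N1 + N2" using N \<open>n \<le> N\<close> by simp
      ultimately show ?thesis using a i y e by metis
    qed
    have "(component i p m n \<and> d (vert u p m) (vert u p n) > a + 1 \<longrightarrow>
               (\<exists>m' n'. component i q m' n' \<and> coset_connected \<C> i (vert u p m) (vert u q m'))) \<and>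
          (component i p m n \<and> component i q m' n' \<and> coset_connected \<C> i (vert u p m) (vert u q m') \<longrightarrow>
               d (vert u p m) (vert u q m') < a + 1 \<and> d (vert u p n) (vert u q n') < a + 1)"
      if qp: "quasigeodesic \<C> l c u p v" and bp: "without_backtracking \<C> u p"
        and qq: "quasigeodesic \<C> l c u q v" and bq: "without_backtracking \<C> u q" and i: "i \<in> I"
      for u v p q i m n m' n'
    proof -
      note K = peripheral_subgroup[OF i]
      note p = quasigeodesic_seq[OF qp] note q = quasigeodesic_seq[OF qq]
      let ?f = "vert u p" and ?g = "vert u q"
      note V = vert_carrier[OF p(2)] vert_carrier[OF q(2)]
      have ends: "?f 0 = ?g 0" "?f (length p) = ?g (length q)"
        using vert_0[OF p(2)] vert_0[OF q(2)] vert_length[OF p(2)] vert_length[OF q(2)] by simp_all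
      have mem: "?f m \<in> ?f m <# H i" "?f n \<in> ?f m <# H i" "?f m \<in> carrier G" "m < n" "n \<le> length p"
        if c: "component i p m n"
      proof -
        show mn: "m < n" "n \<le> length p" using c by (auto simp: component_def)
        show "?f m \<in> carrier G" using V mn by simp
        then show "?f m \<in> ?f m <# H i" by (rule lcoset_self[OF K])
        show "?f n \<in> ?f m <# H i" using component_coset[OF p(2) c, of n] mn by simp
      qed
      have fs: "(?f e, ?f (Suc e)) \<in> off i (?f m <# H i)"
        if c: "component i p m n" and e: "e < length p" "e < m \<or> n \<le> e" for e
        using without_backtracking_edge[OF p(2) bp c e(1)] e by (intro walk_off[OF p(2) e(1)]) auto
      show ?thesis
      proof (intro conjI impI; elim conjE)
        assume c: "component i p m n" and far: "d (?f m) (?f n) > a + 1"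
        show "\<exists>m' n'. component i q m' n' \<and> coset_connected \<C> i (?f m) (?g m')"
        proof (rule ccontr)
          assume none: "\<not> ?thesis"
          have gs: "(?g e, ?g (Suc e)) \<in> off i (?f m <# H i)" if e: "e < length q" for e
          proof (rule walk_off[OF q(2) e])
            fix h assume h: "snd (q ! e) = Per i h"
            show "?g e \<notin> ?f m <# H i"
            proof
              assume ge: "?g e \<in> ?f m <# H i"
              obtain m' n' where c': "component i q m' n'" "m' \<le> e" "e < n'" using component_exists[OF e h] by blast
              have "?g m' \<in> carrier G" using V(2) c'(2) e by simp
              moreover have "?g e \<in> ?g m' <# H i" using component_coset[OF q(2) c'(1)] c' by simp
              ultimately have "?g m' \<in> ?f m <# H i"
                using lcoset_eq[OF K mem(3)[OF c] ge] lcoset_eq[OF K] lcoset_self[OF K] by metis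
              then show False using none c'(1) coset_connected_iff[OF i mem(3)[OF c]] by blast
            qed
          qed
          have "reach_off i (?f m <# H i) N2 (?f m) (?f n)"
            using mem[OF c] ends fs[OF c] gs by (intro N2[OF i _ p(1) q(1)]) auto
          then have "d (?f m) (?f n) \<le> a" using mem[OF c] by (intro close[OF i]) auto
          then show False using far by simp
        qed
      next
        assume c: "component i p m n" and c': "component i q m' n'" and co: "coset_connected \<C> i (?f m) (?g m')"
        have mn': "m' < n'" "n' \<le> length q" using c' by (auto simp: component_def)
        have g1: "?g m' \<in> ?f m <# H i" using co coset_connected_iff[OF i mem(3)[OF c]] by simp
        have e: "?g m' <# H i = ?f m <# H i" by (rule lcoset_eq[OF K mem(3)[OF c] g1])
        have g2: "?g n' \<in> ?f m <# H i" using component_coset[OF q(2) c', of n'] mn' e by simp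
        have gs: "(?g k, ?g (Suc k)) \<in> off i (?f m <# H i)" if k: "k < length q" "k < m' \<or> n' \<le> k" for k
          using without_backtracking_edge[OF q(2) bq c' k(1)] k e by (intro walk_off[OF q(2) k(1)]) auto
        have "reach_off i (?f m <# H i) N1 (?f m) (?g m')"
          using mem[OF c] mn' ends fs[OF c] gs g1
          by (intro N1[OF i _ quasi_seq_prefix[OF p(1)] quasi_seq_prefix[OF q(1)]]) auto
        then have "d (?f m) (?g m') \<le> a" using mem[OF c] g1 by (intro close[OF i]) auto
        moreover have "d (?f n) (?g n') \<le> a"
        proof -
          define f' g' where "f' = (\<lambda>k. ?f (length p - k))" and "g' = (\<lambda>k. ?g (length q - k))"
          have fs': "(f' k, f' (Suc k)) \<in> off i (?f m <# H i)" if "k < length p - n" for k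
          proof (rule off_sym[OF i mem(3)[OF c]])
            have "(?f (length p - Suc k), ?f (Suc (length p - Suc k))) \<in> off i (?f m <# H i)"
              using that by (intro fs[OF c]) auto
            then show "(f' (Suc k), f' k) \<in> off i (?f m <# H i)" using that by (simp add: f'_def Suc_diff_Suc)
          qed
          have gs': "(g' k, g' (Suc k)) \<in> off i (?f m <# H i)" if "k < length q - n'" for k
          proof (rule off_sym[OF i mem(3)[OF c]])
            have "(?g (length q - Suc k), ?g (Suc (length q - Suc k))) \<in> off i (?f m <# H i)"
              using that by (intro gs) auto
            then show "(g' (Suc k), g' k) \<in> off i (?f m <# H i)" using that by (simp add: g'_def Suc_diff_Suc)
          qed
          have qf': "M.quasi_seq ?l ?c f' (length p - n)"
            unfolding f'_def by (rule quasi_seq_prefix[OF quasi_seq_rev[OF p(1)]]) simp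
          have qg': "M.quasi_seq ?l ?c g' (length q - n')"
            unfolding g'_def by (rule quasi_seq_prefix[OF quasi_seq_rev[OF q(1)]]) simp
          have e': "f' (length p - n) = ?f n" "g' (length q - n') = ?g n'" "f' 0 = g' 0"
            using mem[OF c] mn' ends by (simp_all add: f'_def g'_def)
          have "reach_off i (?f m <# H i) N1 (f' (length p - n)) (g' (length q - n'))"
            using e' mem[OF c] g2 fs' gs' by (intro N1[OF i mem(3)[OF c] qf' qg']) simp_all
          then show ?thesis using mem[OF c] g2 e' by (intro close[OF i]) auto
        qed
        ultimately show "d (?f m) (?g m') < a + 1" "d (?f n) (?g n') < a + 1" by simp_all
      qed
    qed
    then show ?thesis unfolding penetration_bound_def by (intro exI[of _ "a + 1"]) blast
  qed
  then show ?thesis using proper unfolding BCP_iff by blast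
qed

end

section \<open>Coarse intersections of cosets\<close>

lemma relpow_drop_loops:
  assumes "\<And>u v. (u, v) \<in> E \<Longrightarrow> u = v \<or> (u, v) \<in> F" "(x, y) \<in> E ^^ n"
  shows "\<exists>m\<le>n. (x, y) \<in> F ^^ m"
  using assms(2)
proof (induction n arbitrary: y)
  case 0
  then show ?case by auto
next
  case (Suc n)
  obtain z where z: "(x, z) \<in> E ^^ n" "(z, y) \<in> E" by (rule relpow_Suc_E[OF Suc.prems])
  obtain m where m: "m \<le> n" "(x, z) \<in> F ^^ m" using Suc.IH[OF z(1)] by blast
  from assms(1)[OF z(2)] show ?case
  proof
    assume "z = y"
    then show ?case using m by (intro exI[of _ m]) simp
  next
    assume "(z, y) \<in> F"
    then have "(x, y) \<in> F ^^ Suc m" by (rule relpow_Suc_I[OF m(2)])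
    then show ?case using m(1) by (intro exI[of _ "Suc m"]) simp
  qed
qed

locale metric_group = group G for G (structure) +
  fixes d :: "'a \<Rightarrow> 'a \<Rightarrow> real"
  assumes proper_metric: "proper_left_inv_metric G d"
begin

sublocale dm: Metric_space "carrier G" d
  using proper_metric by (simp add: proper_left_inv_metric_def)

lemma metric_left: "\<lbrakk>g \<in> carrier G; x \<in> carrier G; y \<in> carrier G\<rbrakk> \<Longrightarrow> d (g \<otimes> x) (g \<otimes> y) = d x y"
  using proper_metric by (simp add: proper_left_inv_metric_def)

lemma metric_norm:
  assumes "x \<in> carrier G" "y \<in> carrier G"
  shows "d x y = d \<one> (inv x \<otimes> y)"
  using metric_left[of "inv x" x y] assms by simp

lemma finite_ball: "finite {g \<in> carrier G. d \<one> g \<le> R}"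
proof -
  have "{g \<in> carrier G. d \<one> g \<le> R} \<subseteq> dm.mcball \<one> R" by (auto simp: dm.mcball_def)
  then have "dm.mbounded {g \<in> carrier G. d \<one> g \<le> R}" unfolding dm.mbounded_def by blast
  then show ?thesis using proper_metric unfolding proper_left_inv_metric_def by blast
qed

lemma finite_bounded: "finite T \<Longrightarrow> \<exists>r\<ge>0. \<forall>g\<in>T. d \<one> g \<le> r"
proof -
  assume "finite T"
  then have "d \<one> g \<le> Max (insert 0 (d \<one> ` T))" if "g \<in> T" for g using that by simp
  moreover have "0 \<le> Max (insert 0 (d \<one> ` T))" using \<open>finite T\<close> by simp
  ultimately show ?thesis by blast
qed

text \<open>Two elements \<open>k\<close>, \<open>k\<^sub>0\<close> of this set differ by \<open>inv k\<^sub>0 \<otimes> k\<close>, which is in \<open>K\<close> and in the conjugate of \<open>L\<close>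
  by \<open>w\<close>.\<close>

lemma finite_coset_intersection:
  assumes K: "subgroup K G" and L: "subgroup L G" and u: "u \<in> carrier G" and w: "w \<in> carrier G"
    and fin: "finite (K \<inter> conjugate_set G w L)"
  shows "finite {k \<in> K. inv u \<otimes> k \<otimes> w \<in> L}"
proof (cases "{k \<in> K. inv u \<otimes> k \<otimes> w \<in> L} = {}")
  case False
  interpret K: subgroup K G by fact
  interpret L: subgroup L G by fact
  obtain k\<^sub>0 where k0: "k\<^sub>0 \<in> K" "inv u \<otimes> k\<^sub>0 \<otimes> w \<in> L" using False by blast
  have "k \<in> (\<lambda>t. k\<^sub>0 \<otimes> t) ` (K \<inter> conjugate_set G w L)" if k: "k \<in> K" "inv u \<otimes> k \<otimes> w \<in> L" for k
  proof -
    have c: "k\<^sub>0 \<in> carrier G" "k \<in> carrier G" using k0 k by auto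
    define s where "s = inv (inv u \<otimes> k\<^sub>0 \<otimes> w) \<otimes> (inv u \<otimes> k \<otimes> w)"
    have s: "s \<in> L" using k0 k by (simp add: s_def)
    have "inv u \<otimes> k \<otimes> w = inv u \<otimes> k\<^sub>0 \<otimes> w \<otimes> s" using c u w by (simp add: s_def m_assoc[symmetric])
    then have "inv u \<otimes> (k \<otimes> w) = inv u \<otimes> (k\<^sub>0 \<otimes> w \<otimes> s)" using c u w s by (simp add: m_assoc)
    then have kw: "k \<otimes> w = k\<^sub>0 \<otimes> w \<otimes> s" using c u w s by simp
    have "inv k\<^sub>0 \<otimes> k = inv k\<^sub>0 \<otimes> (k \<otimes> w) \<otimes> inv w" using c w by (simp add: m_assoc)
    also have "\<dots> = w \<otimes> s \<otimes> inv w" unfolding kw using c w s by (simp add: m_assoc[symmetric])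
    finally have "inv k\<^sub>0 \<otimes> k \<in> conjugate_set G w L"
      using s unfolding conjugate_set_def l_coset_def r_coset_def by blast
    moreover have "inv k\<^sub>0 \<otimes> k \<in> K" using k0 k by simp
    moreover have "k = k\<^sub>0 \<otimes> (inv k\<^sub>0 \<otimes> k)" using c by (simp add: m_assoc[symmetric])
    ultimately show ?thesis by blast
  qed
  then have "{k \<in> K. inv u \<otimes> k \<otimes> w \<in> L} \<subseteq> (\<lambda>t. k\<^sub>0 \<otimes> t) ` (K \<inter> conjugate_set G w L)" by blast
  then show ?thesis using fin finite_surj by blast
next
  case True
  then show ?thesis by (simp only: finite.emptyI)
qed

text \<open>The coarse intersection of a coset of \<open>K\<close> and a coset of \<open>L\<close>: if \<open>x\<close>, \<open>y\<close> are in the former and \<open>x u\<close>,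
  \<open>y w\<close> in the latter, then \<open>k = inv x \<otimes> y\<close> satisfies the condition.  Properness of \<open>d\<close> leaves finitely
  many \<open>u\<close> and \<open>w\<close>.\<close>

lemma coset_intersection_bounded:
  assumes K: "subgroup K G" and L: "subgroup L G" and W: "finite W" "W \<subseteq> carrier G"
    and fin: "\<And>w. w \<in> W \<Longrightarrow> finite (K \<inter> conjugate_set G w L)"
  shows "\<exists>r\<ge>0. \<forall>k\<in>K. \<forall>u\<in>W. \<forall>w\<in>W. inv u \<otimes> k \<otimes> w \<in> L \<longrightarrow> d \<one> k \<le> r"
proof -
  have "finite (\<Union>u\<in>W. \<Union>w\<in>W. {k \<in> K. inv u \<otimes> k \<otimes> w \<in> L})"
    using W fin by (intro finite_UN_I finite_coset_intersection[OF K L]) auto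
  from finite_bounded[OF this] show ?thesis by blast
qed

lemma metric_along_relpow:
  assumes "(x, y) \<in> E ^^ n" "x \<in> carrier G" "\<And>u. u \<in> carrier G \<Longrightarrow> \<pi> u \<in> carrier G"
    and step: "\<And>u v. (u, v) \<in> E \<Longrightarrow> u \<in> carrier G \<Longrightarrow> v \<in> carrier G \<and> d (\<pi> u) (\<pi> v) \<le> R"
  shows "y \<in> carrier G \<and> d (\<pi> x) (\<pi> y) \<le> real n * R"
  using assms(1)
proof (induction n arbitrary: y)
  case 0
  then show ?case using assms(2,3) by simp
next
  case (Suc n)
  obtain z where z: "(x, z) \<in> E ^^ n" "(z, y) \<in> E" by (rule relpow_Suc_E[OF Suc.prems])
  have zc: "z \<in> carrier G" "d (\<pi> x) (\<pi> z) \<le> real n * R" using Suc.IH[OF z(1)] by auto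
  have yc: "y \<in> carrier G" "d (\<pi> z) (\<pi> y) \<le> R" using step[OF z(2) zc(1)] by auto
  have "d (\<pi> x) (\<pi> y) \<le> d (\<pi> x) (\<pi> z) + d (\<pi> z) (\<pi> y)"
    using assms(2,3) zc yc by (intro dm.triangle) auto
  then show ?case using zc yc by (simp add: algebra_simps)
qed

end

section \<open>Coning off the cosets of \<open>\<Gamma>\<close>\<close>

text \<open>The original graph is \<open>base\<close>; the graph for the new family of subgroups will be called \<open>cone\<close>.\<close>

locale cone_setup = metric_group G d + base: relative_graph G I H X
  for G (structure) and I J :: "'i set" and H :: "'i \<Rightarrow> 'a set" and \<Gamma> :: "'a set" and X :: "'a set"
    and d :: "'a \<Rightarrow> 'a \<Rightarrow> real" +
  fixes \<delta> :: nat and \<sigma> :: real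
  assumes I_finite: "finite I" and J_subset: "J \<subseteq> I"
    and \<Gamma>_subgroup: "subgroup \<Gamma> G" and J_\<Gamma>: "i \<in> J \<Longrightarrow> H i \<subseteq> \<Gamma>"
    and base_fine: "base.fine_wrt d"
    and base_slim: "slim_space (carrier G) base.gdist \<delta>"
    and quasiconvex: "\<lbrakk>u \<in> \<Gamma>; v \<in> \<Gamma>; x \<in> base.interval u v\<rbrakk> \<Longrightarrow> \<exists>w\<in>\<Gamma>. d x w \<le> \<sigma>"
    and malnormal: "weakly_malnormal G \<Gamma>"
    and thin: "\<lbrakk>g \<in> carrier G; i \<in> I - J\<rbrakk> \<Longrightarrow> finite (conjugate_set G g \<Gamma> \<inter> H i)"
begin

definition peripheral_cosets :: "'a set set" where
  "peripheral_cosets = {x <# H i | x i. x \<in> carrier G \<and> i \<in> I}"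

definition \<Gamma>_cosets :: "'a set set" where
  "\<Gamma>_cosets = {x <# \<Gamma> | x. x \<in> carrier G}"

lemma peripheral_cosetE:
  assumes "P \<in> peripheral_cosets" "x \<in> P"
  obtains i where "i \<in> I" "P = x <# H i" "x \<in> carrier G"
proof -
  obtain z i where z: "P = z <# H i" "z \<in> carrier G" "i \<in> I" using assms(1) by (auto simp: peripheral_cosets_def)
  note K = base.peripheral_subgroup[OF z(3)]
  have "x <# H i = P" using base.lcoset_eq[OF K z(2)] assms(2) z(1) by simp
  moreover have "x \<in> carrier G" using base.lcoset_carrier[OF K z(2)] assms(2) z(1) by blast
  ultimately show ?thesis using that z(3) by simp
qed

lemma \<Gamma>_cosetE:
  assumes "B \<in> \<Gamma>_cosets" "x \<in> B"
  shows "B = x <# \<Gamma>" "x \<in> carrier G"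
proof -
  obtain z where z: "B = z <# \<Gamma>" "z \<in> carrier G" using assms(1) by (auto simp: \<Gamma>_cosets_def)
  show "B = x <# \<Gamma>" using base.lcoset_eq[OF \<Gamma>_subgroup z(2)] assms(2) z(1) by simp
  show "x \<in> carrier G" using base.lcoset_carrier[OF \<Gamma>_subgroup z(2)] assms(2) z(1) by blast
qed

lemma \<Gamma>_coset: "x \<in> carrier G \<Longrightarrow> x <# \<Gamma> \<in> \<Gamma>_cosets" "x \<in> carrier G \<Longrightarrow> x \<in> x <# \<Gamma>"
  using base.lcoset_self[OF \<Gamma>_subgroup] by (auto simp: \<Gamma>_cosets_def)

lemma \<Gamma>_coset_diff: "\<lbrakk>B \<in> \<Gamma>_cosets; x \<in> B; y \<in> B\<rbrakk> \<Longrightarrow> inv x \<otimes> y \<in> \<Gamma>"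
  using \<Gamma>_cosetE[of B x] base.mem_lcoset[OF \<Gamma>_subgroup] by blast

lemma gdist_of_metric: "\<exists>N. \<forall>x\<in>carrier G. \<forall>y\<in>carrier G. d x y \<le> R \<longrightarrow> base.gdist x y \<le> N"
proof -
  define N where "N = Max (insert 0 (base.gdist \<one> ` {g \<in> carrier G. d \<one> g \<le> R}))"
  have "base.gdist x y \<le> N" if xy: "x \<in> carrier G" "y \<in> carrier G" "d x y \<le> R" for x y
  proof -
    have "base.gdist x y = base.gdist (inv x \<otimes> x) (inv x \<otimes> y)" using base.dist_left[of "inv x" x y] xy by simp
    also have "\<dots> = base.gdist \<one> (inv x \<otimes> y)" using xy by simp
    also have "\<dots> \<le> N" unfolding N_def using xy metric_norm[OF xy(1,2)] finite_ball[of R]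
      by (intro Max_ge) auto
    finally show ?thesis .
  qed
  then show ?thesis by blast
qed

lemma coset_metric_edges:
  "\<exists>r. \<forall>x\<in>carrier G. \<forall>y\<in>carrier G. base.gdist x y \<le> 1 \<longrightarrow>
     d x y \<le> r \<or> (\<exists>P\<in>peripheral_cosets. x \<in> P \<and> y \<in> P)"
proof -
  obtain r where r: "r \<ge> 0" "\<forall>g\<in>X. d \<one> g \<le> r" using finite_bounded[OF base.X_finite] by blast
  have "d x y \<le> r \<or> (\<exists>P\<in>peripheral_cosets. x \<in> P \<and> y \<in> P)"
    if xy: "x \<in> carrier G" "y \<in> carrier G" "base.gdist x y \<le> 1" for x y
  proof (cases "x = y")
    case True
    then show ?thesis using xy r(1) by simp
  next
    case False
    then obtain a where a: "a \<in> base.\<L>" "y = x \<otimes> letter_val a"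
      using base.dist_le_1[OF xy(1,2)] xy(3) by (auto simp: base.steps_def)
    from a(1) show ?thesis
    proof (cases rule: base.letter_cases)
      case (Gen s)
      have "s \<in> carrier G" using base.X_carrier Gen by blast
      then have "inv x \<otimes> y = s" using a Gen xy by (simp add: m_assoc[symmetric])
      then show ?thesis using metric_norm[OF xy(1,2)] r Gen by simp
    next
      case (Per i k)
      note K = base.peripheral_subgroup[OF Per(2)]
      have "x \<in> x <# H i" by (rule base.lcoset_self[OF K xy(1)])
      moreover have "y \<in> x <# H i" using base.lcoset_mult[OF K xy(1) Per(3)] a(2) Per(1) by simp
      moreover have "x <# H i \<in> peripheral_cosets" using xy(1) Per(2) by (auto simp: peripheral_cosets_def)
      ultimately show ?thesis by blast
    qed
  qed
  then show ?thesis by blast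
qed

text \<open>Weak malnormality as a geometric statement: the coarse intersection of two distinct cosets of
  \<open>\<Gamma>\<close> is bounded, uniformly in the two cosets.\<close>

lemma \<Gamma>_separated:
  "\<exists>r. \<forall>B\<in>\<Gamma>_cosets. \<forall>B'\<in>\<Gamma>_cosets. \<forall>x\<in>carrier G. \<forall>y\<in>carrier G. B \<noteq> B' \<longrightarrow>
     (\<exists>b\<in>B. d x b \<le> R) \<longrightarrow> (\<exists>b\<in>B'. d x b \<le> R) \<longrightarrow> (\<exists>b\<in>B. d y b \<le> R) \<longrightarrow> (\<exists>b\<in>B'. d y b \<le> R) \<longrightarrow>
     d x y \<le> r"
proof -
  \<comment> \<open>For \<open>a \<in> B\<close> and \<open>a' \<in> B'\<close> near the same point, \<open>inv a \<otimes> a'\<close> is in \<open>W\<close>.\<close>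
  define W where "W = {g \<in> carrier G. d \<one> g \<le> 2 * R} - \<Gamma>"
  have W: "finite W" "W \<subseteq> carrier G" using finite_ball[of "2 * R"] by (auto simp: W_def)
  have "finite (\<Gamma> \<inter> conjugate_set G w \<Gamma>)" if "w \<in> W" for w
    using that malnormal by (auto simp: W_def weakly_malnormal_def)
  from coset_intersection_bounded[OF \<Gamma>_subgroup \<Gamma>_subgroup W this] obtain r where
    r: "\<forall>k\<in>\<Gamma>. \<forall>u\<in>W. \<forall>w\<in>W. inv u \<otimes> k \<otimes> w \<in> \<Gamma> \<longrightarrow> d \<one> k \<le> r" by blast
  have "d x y \<le> 2 * R + r"
    if B: "B \<in> \<Gamma>_cosets" "B' \<in> \<Gamma>_cosets" "B \<noteq> B'" and xy: "x \<in> carrier G" "y \<in> carrier G"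
      and a: "a \<in> B" "d x a \<le> R" "a' \<in> B'" "d x a' \<le> R" and b: "b \<in> B" "d y b \<le> R" "b' \<in> B'" "d y b' \<le> R"
    for B B' x y a a' b b'
  proof -
    have V: "a \<in> carrier G" "b \<in> carrier G" "a' \<in> carrier G" "b' \<in> carrier G"
      using \<Gamma>_cosetE(2)[OF B(1)] \<Gamma>_cosetE(2)[OF B(2)] a b by blast+
    have inW: "inv p \<otimes> p' \<in> W" if p: "p \<in> B" "p' \<in> B'" "z \<in> carrier G" "d z p \<le> R" "d z p' \<le> R" for p p' z
    proof -
      have c: "p \<in> carrier G" "p' \<in> carrier G" using \<Gamma>_cosetE(2)[OF B(1) p(1)] \<Gamma>_cosetE(2)[OF B(2) p(2)] .
      have "d p p' \<le> d p z + d z p'" using c p(3) by (intro dm.triangle)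
      then have "d \<one> (inv p \<otimes> p') \<le> 2 * R" using p dm.commute[of p z] metric_norm[OF c] by simp
      moreover have "inv p \<otimes> p' \<notin> \<Gamma>"
      proof
        assume "inv p \<otimes> p' \<in> \<Gamma>"
        then have "p' \<in> B" using base.mem_lcoset[OF \<Gamma>_subgroup c(1)] c(2) \<Gamma>_cosetE(1)[OF B(1) p(1)] by simp
        then show False using \<Gamma>_cosetE(1)[OF B(1)] \<Gamma>_cosetE(1)[OF B(2) p(2)] B(3) by simp
      qed
      ultimately show ?thesis using c by (simp add: W_def)
    qed
    have "inv (inv a \<otimes> a') \<otimes> (inv a \<otimes> b) \<otimes> (inv b \<otimes> b') = inv a' \<otimes> b'"
    proof -
      have "inv (inv a \<otimes> a') \<otimes> (inv a \<otimes> b) \<otimes> (inv b \<otimes> b') = inv a' \<otimes> (a \<otimes> (inv a \<otimes> (b \<otimes> (inv b \<otimes> b'))))"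
        using V by (simp add: inv_mult_group m_assoc)
      also have "b \<otimes> (inv b \<otimes> b') = b'" using V by (simp add: m_assoc[symmetric])
      also have "a \<otimes> (inv a \<otimes> b') = b'" using V by (simp add: m_assoc[symmetric])
      finally show ?thesis .
    qed
    then have "inv (inv a \<otimes> a') \<otimes> (inv a \<otimes> b) \<otimes> (inv b \<otimes> b') \<in> \<Gamma>"
      using \<Gamma>_coset_diff[OF B(2) a(3) b(3)] by simp
    then have "d \<one> (inv a \<otimes> b) \<le> r"
      using r \<Gamma>_coset_diff[OF B(1) a(1) b(1)] inW[OF a(1,3) xy(1) a(2,4)] inW[OF b(1,3) xy(2) b(2,4)] by blast
    then have "d a b \<le> r" using metric_norm[OF V(1,2)] by simp
    moreover have "d x y \<le> d x a + d a y" "d a y \<le> d a b + d b y" using V xy by (auto intro: dm.triangle)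
    ultimately show ?thesis using a b dm.commute[of b y] by linarith
  qed
  then show ?thesis by (intro exI[of _ "2 * R + r"]) blast
qed

text \<open>The same for a coset of \<open>\<Gamma>\<close> and a coset of one of the remaining subgroups.\<close>

lemma \<Gamma>_peripheral_separated:
  "\<exists>r\<ge>0. \<forall>B\<in>\<Gamma>_cosets. \<forall>i\<in>I - J. \<forall>z\<in>carrier G. \<forall>x \<in> z <# H i. \<forall>y \<in> z <# H i.
     (\<exists>b\<in>B. d x b \<le> R) \<longrightarrow> (\<exists>b\<in>B. d y b \<le> R) \<longrightarrow> d x y \<le> r"
proof -
  define W where "W = {g \<in> carrier G. d \<one> g \<le> R}"
  have W: "finite W" "W \<subseteq> carrier G" using finite_ball[of R] by (auto simp: W_def)
  have "\<exists>r\<ge>0. \<forall>k\<in>H i. \<forall>u\<in>W. \<forall>w\<in>W. inv u \<otimes> k \<otimes> w \<in> \<Gamma> \<longrightarrow> d \<one> k \<le> r" if i: "i \<in> I - J" for i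
    using thin[OF _ i] W i by (intro coset_intersection_bounded base.peripheral_subgroup \<Gamma>_subgroup W)
      (auto simp: Int_commute)
  then obtain r where r: "\<And>i. i \<in> I - J \<Longrightarrow> r i \<ge> 0"
    "\<And>i k u w. i \<in> I - J \<Longrightarrow> k \<in> H i \<Longrightarrow> u \<in> W \<Longrightarrow> w \<in> W \<Longrightarrow> inv u \<otimes> k \<otimes> w \<in> \<Gamma> \<Longrightarrow> d \<one> k \<le> r i"
    by metis
  define r' where "r' = (\<Sum>i\<in>I - J. r i)"
  have r': "r i \<le> r'" if "i \<in> I - J" for i
    unfolding r'_def using that I_finite r(1) by (intro member_le_sum) auto
  have "d x y \<le> r'" if B: "B \<in> \<Gamma>_cosets" and i: "i \<in> I - J" and z: "z \<in> carrier G" "x \<in> z <# H i" "y \<in> z <# H i"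
    and b: "b \<in> B" "d x b \<le> R" and c: "c \<in> B" "d y c \<le> R" for B i z x y b c
  proof -
    have K: "subgroup (H i) G" using base.peripheral_subgroup i by blast
    have V: "x \<in> carrier G" "y \<in> carrier G" "b \<in> carrier G" "c \<in> carrier G"
      using base.lcoset_carrier[OF K z(1)] z \<Gamma>_cosetE(2)[OF B] b c by blast+
    have "y \<in> x <# H i" using base.lcoset_eq[OF K z(1,2)] z(3) by simp
    then have k: "inv x \<otimes> y \<in> H i" using base.mem_lcoset[OF K V(1)] by simp
    have uw: "inv x \<otimes> b \<in> W" "inv y \<otimes> c \<in> W"
      using V b c metric_norm[OF V(1,3)] metric_norm[OF V(2,4)] by (simp_all add: W_def)
    have "inv (inv x \<otimes> b) \<otimes> (inv x \<otimes> y) \<otimes> (inv y \<otimes> c) = inv b \<otimes> c"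
    proof -
      have "inv (inv x \<otimes> b) \<otimes> (inv x \<otimes> y) \<otimes> (inv y \<otimes> c) = inv b \<otimes> (x \<otimes> (inv x \<otimes> (y \<otimes> (inv y \<otimes> c))))"
        using V by (simp add: inv_mult_group m_assoc)
      also have "y \<otimes> (inv y \<otimes> c) = c" using V by (simp add: m_assoc[symmetric])
      also have "x \<otimes> (inv x \<otimes> c) = c" using V by (simp add: m_assoc[symmetric])
      finally show ?thesis .
    qed
    then have "d \<one> (inv x \<otimes> y) \<le> r i" using r(2)[OF i k uw] \<Gamma>_coset_diff[OF B b(1) c(1)] by simp
    then show ?thesis using metric_norm[OF V(1,2)] r'[OF i] by simp
  qed
  moreover have "r' \<ge> 0" unfolding r'_def using r(1) by (intro sum_nonneg) auto
  ultimately show ?thesis by blast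
qed

text \<open>By left invariance of both metrics it suffices to know this for \<open>\<Gamma>\<close> itself.\<close>

lemma \<Gamma>_coset_quasiconvex:
  assumes B: "B \<in> \<Gamma>_cosets" "x \<in> B" "y \<in> B" and v: "v \<in> base.interval x y"
  shows "\<exists>w\<in>B. d v w \<le> \<sigma>"
proof -
  have V: "x \<in> carrier G" "y \<in> carrier G" "v \<in> carrier G"
    using \<Gamma>_cosetE(2)[OF B(1)] B base.interval_V[OF v] by blast+
  have "inv x \<otimes> v \<in> base.interval \<one> (inv x \<otimes> y)"
    using v V base.dist_left[of "inv x" x v] base.dist_left[of "inv x" v y] base.dist_left[of "inv x" x y]
    by (simp add: base.interval_def)
  then obtain w where w: "w \<in> \<Gamma>" "d (inv x \<otimes> v) w \<le> \<sigma>"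
    using quasiconvex[OF subgroup.one_closed[OF \<Gamma>_subgroup] \<Gamma>_coset_diff[OF B]] by blast
  have wc: "w \<in> carrier G" using subgroup.mem_carrier[OF \<Gamma>_subgroup w(1)] .
  have "x \<otimes> (inv x \<otimes> v) = v" using V by (simp add: m_assoc[symmetric])
  then have "d v (x \<otimes> w) = d (inv x \<otimes> v) w" using metric_left[of x "inv x \<otimes> v" w] V wc by simp
  moreover have "x \<otimes> w \<in> B" using base.lcoset_mult[OF \<Gamma>_subgroup V(1) w(1)] \<Gamma>_cosetE(1)[OF B(1,2)] by simp
  ultimately show ?thesis using w(2) by (intro bexI[of _ "x \<otimes> w"]) simp_all
qed

text \<open>A coset of \<open>H i\<close> with \<open>i \<in> J\<close> is contained in one coset of \<open>\<Gamma>\<close>, and its coarse intersection with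
  any other coset of \<open>\<Gamma>\<close> is bounded because distinct cosets of \<open>\<Gamma>\<close> are separated; this gives the
  separation of \<open>\<Gamma>\<close>-cosets from peripheral cosets that they do not contain.\<close>

sublocale fam: separated_family "carrier G" base.gdist \<delta> d peripheral_cosets \<Gamma>_cosets \<sigma>
proof -
  interpret slim_space "carrier G" base.gdist \<delta> by (rule base_slim)
  show "separated_family (carrier G) base.gdist \<delta> d peripheral_cosets \<Gamma>_cosets \<sigma>"
  proof (unfold_locales)
    show "d x x = 0" if "x \<in> carrier G" for x using that by simp
    show "d x y = d y x" for x y by (rule dm.commute)
    show "d x z \<le> d x y + d y z" if "x \<in> carrier G" "y \<in> carrier G" "z \<in> carrier G" for x y z
      using that by (rule dm.triangle)
    show "\<exists>N. \<forall>x\<in>carrier G. \<forall>y\<in>carrier G. d x y \<le> R \<longrightarrow> base.gdist x y \<le> N" for R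
      by (rule gdist_of_metric)
    show "P \<subseteq> carrier G" if "P \<in> peripheral_cosets" for P
      using peripheral_cosetE[OF that] by blast
    show "P \<noteq> {}" if "P \<in> peripheral_cosets" for P
      using that base.lcoset_self[OF base.peripheral_subgroup] by (auto simp: peripheral_cosets_def)
    show "base.gdist x y \<le> 1" if P: "P \<in> peripheral_cosets" "x \<in> P" "y \<in> P" for P x y
    proof -
      obtain i where i: "i \<in> I" "P = x <# H i" "x \<in> carrier G" by (rule peripheral_cosetE[OF P(1,2)])
      then show ?thesis using base.coset_diam[OF i(1,3)] P by simp
    qed
    show "\<exists>r. \<forall>x\<in>carrier G. \<forall>y\<in>carrier G. base.gdist x y \<le> 1 \<longrightarrow>
      d x y \<le> r \<or> (\<exists>P\<in>peripheral_cosets. x \<in> P \<and> y \<in> P)" by (rule coset_metric_edges)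
    show "\<exists>r. \<forall>P\<in>peripheral_cosets. \<forall>x\<in>P. \<forall>y\<in>P. \<forall>n\<le>N.
      (x, y) \<in> {(u, v). u \<in> carrier G \<and> v \<in> carrier G \<and> base.gdist u v \<le> 1 \<and> \<not> (u \<in> P \<and> v \<in> P)} ^^ n \<longrightarrow>
      d x y \<le> r" for N
    proof -
      obtain r where r: "\<forall>i\<in>I. \<forall>x\<in>carrier G. \<forall>y \<in> x <# H i. \<forall>n\<le>N.
          (x, y) \<in> base.off i (x <# H i) ^^ n \<longrightarrow> d x y \<le> r"
        using base_fine unfolding base.fine_wrt_def by blast
      have "d x y \<le> r" if P: "P \<in> peripheral_cosets" "x \<in> P" "y \<in> P" and n: "n \<le> N" and
        xy: "(x, y) \<in> {(u, v). u \<in> carrier G \<and> v \<in> carrier G \<and> base.gdist u v \<le> 1 \<and> \<not> (u \<in> P \<and> v \<in> P)} ^^ n"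
        for P x y n
      proof -
        obtain i where i: "i \<in> I" "P = x <# H i" "x \<in> carrier G" by (rule peripheral_cosetE[OF P(1,2)])
        have "u = v \<or> (u, v) \<in> base.off i P"
          if "(u, v) \<in> {(u, v). u \<in> carrier G \<and> v \<in> carrier G \<and> base.gdist u v \<le> 1 \<and> \<not> (u \<in> P \<and> v \<in> P)}" for u v
        proof -
          have uv: "u \<in> carrier G" "v \<in> carrier G" "base.gdist u v \<le> 1" "\<not> (u \<in> P \<and> v \<in> P)" using that by auto
          show ?thesis
          proof (cases "u = v")
            case False
            then obtain a where a: "a \<in> base.\<L>" "v = u \<otimes> letter_val a"
              using base.dist_le_1[OF uv(1,2)] uv(3) by (auto simp: base.steps_def)
            have "\<not> (u \<in> P \<and> (\<exists>h. a = Per i h))"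
            proof
              assume "u \<in> P \<and> (\<exists>h. a = Per i h)"
              then obtain k where k: "u \<in> P" "a = Per i k" by blast
              then have "k \<in> H i" using a(1) base.Per_letter by blast
              then have "v \<in> P"
                using base.lcoset_mult_iff[OF base.peripheral_subgroup[OF i(1)] i(3) uv(1)] k a(2) i(2) by simp
              then show False using uv(4) k(1) by blast
            qed
            then show ?thesis using uv(1) a by (auto simp: base.off_def)
          qed simp
        qed
        from relpow_drop_loops[OF this xy] obtain m where "m \<le> n" "(x, y) \<in> base.off i P ^^ m" by blast
        moreover have "m \<le> N" using \<open>m \<le> n\<close> n by simp
        ultimately show ?thesis using r i P(3) by blast
      qed
      then show ?thesis by blast
    qed
    show "B \<subseteq> carrier G" if "B \<in> \<Gamma>_cosets" for B using \<Gamma>_cosetE(2)[OF that] by blast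
    show "B \<noteq> {}" if "B \<in> \<Gamma>_cosets" for B using that \<Gamma>_coset(2) by (auto simp: \<Gamma>_cosets_def)
    show "B \<inter> B' = {}" if "B \<in> \<Gamma>_cosets" "B' \<in> \<Gamma>_cosets" "B \<noteq> B'" for B B'
      using \<Gamma>_cosetE(1)[OF that(1)] \<Gamma>_cosetE(1)[OF that(2)] that(3) by blast
    show "\<exists>w\<in>B. d v w \<le> \<sigma>" if "B \<in> \<Gamma>_cosets" "x \<in> B" "y \<in> B" "v \<in> base.interval x y" for B x y v
      by (rule \<Gamma>_coset_quasiconvex[OF that])
    show "\<exists>r. \<forall>B\<in>\<Gamma>_cosets. \<forall>B'\<in>\<Gamma>_cosets. \<forall>x\<in>carrier G. \<forall>y\<in>carrier G. B \<noteq> B' \<longrightarrow>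
      (\<exists>b\<in>B. d x b \<le> R) \<longrightarrow> (\<exists>b\<in>B'. d x b \<le> R) \<longrightarrow> (\<exists>b\<in>B. d y b \<le> R) \<longrightarrow> (\<exists>b\<in>B'. d y b \<le> R) \<longrightarrow>
      d x y \<le> r" for R by (rule \<Gamma>_separated)
    show "\<exists>r. \<forall>B\<in>\<Gamma>_cosets. \<forall>P\<in>peripheral_cosets. \<forall>x\<in>P. \<forall>y\<in>P. \<not> P \<subseteq> B \<longrightarrow>
      (\<exists>b\<in>B. d x b \<le> \<sigma>) \<longrightarrow> (\<exists>b\<in>B. d y b \<le> \<sigma>) \<longrightarrow> d x y \<le> r"
    proof -
      obtain r1 where "\<forall>B\<in>\<Gamma>_cosets. \<forall>B'\<in>\<Gamma>_cosets. \<forall>x\<in>carrier G. \<forall>y\<in>carrier G. B \<noteq> B' \<longrightarrow>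
        (\<exists>b\<in>B. d x b \<le> \<bar>\<sigma>\<bar>) \<longrightarrow> (\<exists>b\<in>B'. d x b \<le> \<bar>\<sigma>\<bar>) \<longrightarrow> (\<exists>b\<in>B. d y b \<le> \<bar>\<sigma>\<bar>) \<longrightarrow> (\<exists>b\<in>B'. d y b \<le> \<bar>\<sigma>\<bar>) \<longrightarrow>
        d x y \<le> r1" using \<Gamma>_separated[of "\<bar>\<sigma>\<bar>"] ..
      note r1 = this[rule_format]
      obtain r2 where r2: "\<forall>B\<in>\<Gamma>_cosets. \<forall>i\<in>I - J. \<forall>z\<in>carrier G. \<forall>x \<in> z <# H i. \<forall>y \<in> z <# H i.
        (\<exists>b\<in>B. d x b \<le> \<sigma>) \<longrightarrow> (\<exists>b\<in>B. d y b \<le> \<sigma>) \<longrightarrow> d x y \<le> r2" using \<Gamma>_peripheral_separated[of \<sigma>] by blast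
      have "d x y \<le> max r1 r2" if B: "B \<in> \<Gamma>_cosets" and P: "P \<in> peripheral_cosets" "x \<in> P" "y \<in> P" "\<not> P \<subseteq> B"
        and b: "\<exists>b\<in>B. d x b \<le> \<sigma>" "\<exists>b\<in>B. d y b \<le> \<sigma>" for B P x y
      proof -
        obtain i where i: "i \<in> I" "P = x <# H i" "x \<in> carrier G" by (rule peripheral_cosetE[OF P(1,2)])
        have yc: "y \<in> carrier G" using base.lcoset_carrier[OF base.peripheral_subgroup[OF i(1)] i(3)] P(3) i(2) by blast
        show ?thesis
        proof (cases "i \<in> J")
          case False
          then have "d x y \<le> r2" using r2 B i P b by blast
          then show ?thesis by simp
        next
          case True
          let ?B = "x <# \<Gamma>"
          have "P \<subseteq> ?B" using J_\<Gamma>[OF True] i(2) by (auto simp: l_coset_def)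
          then have "?B \<noteq> B" "x \<in> ?B" "y \<in> ?B" using P by auto
          moreover have "\<exists>b\<in>B. d x b \<le> \<bar>\<sigma>\<bar>" "\<exists>b\<in>B. d y b \<le> \<bar>\<sigma>\<bar>" using b by force+
          moreover have "\<exists>b\<in>?B. d x b \<le> \<bar>\<sigma>\<bar>" using \<open>x \<in> ?B\<close> i(3) by (intro bexI[of _ x]) auto
          moreover have "\<exists>b\<in>?B. d y b \<le> \<bar>\<sigma>\<bar>" using \<open>y \<in> ?B\<close> yc by (intro bexI[of _ y]) auto
          ultimately have "d x y \<le> r1" by (intro r1[OF \<Gamma>_coset(1)[OF i(3)] B i(3) yc])
          then show ?thesis by simp
        qed
      qed
      then show ?thesis by blast
    qed
  qed
qed

abbreviation "I' \<equiv> insert None (Some ` (I - J))"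
abbreviation "H' \<equiv> case_option \<Gamma> H"

lemma cone_relative_graph: "relative_graph G I' H' X"
proof (intro relative_graph.intro relative_graph_axioms.intro)
  show "group G" by (rule is_group)
  show "subgroup (H' i) G" if "i \<in> I'" for i
    using that \<Gamma>_subgroup base.peripheral_subgroup by auto
  have S: "X \<union> (\<Union>i\<in>I. H i) \<subseteq> X \<union> (\<Union>i\<in>I'. H' i)" using J_\<Gamma> by auto
  have C: "X \<union> (\<Union>i\<in>I'. H' i) \<subseteq> carrier G"
    using base.X_carrier subgroup.subset[OF \<Gamma>_subgroup] subgroup.subset[OF base.peripheral_subgroup] by fastforce
  have "carrier G \<subseteq> generate G (X \<union> (\<Union>i\<in>I'. H' i))"
    using mono_generate[OF S] base.generating by (simp add: finite_rel_generating_set_def)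
  then have "generate G (X \<union> (\<Union>i\<in>I'. H' i)) = carrier G"
    using generate_incl[OF C] by blast
  then show "finite_rel_generating_set G I' H' X"
    using base.generating by (simp add: finite_rel_generating_set_def)
qed

sublocale cone: relative_graph G I' H' X
  by (rule cone_relative_graph)

text \<open>An edge of type \<open>i \<in> J\<close> becomes an edge of type \<open>\<Gamma>\<close>.\<close>

lemma base_steps: "base.steps \<subseteq> cone.steps"
proof
  fix e assume "e \<in> base.steps"
  then obtain u a where e: "e = (u, u \<otimes> letter_val a)" "u \<in> carrier G" "a \<in> base.\<L>"
    by (cases e) (auto simp: base.steps_def)
  have "\<exists>b\<in>cone.\<L>. letter_val b = letter_val a"
  proof (cases a)
    case (Gen s)
    then show ?thesis using e(3) by (intro bexI[of _ "Gen s"]) (auto simp: letters_def)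
  next
    case (Per i k)
    then have k: "i \<in> I" "k \<in> H i" "k \<noteq> \<one>" using e(3) by (auto simp: letters_def)
    show ?thesis
    proof (cases "i \<in> J")
      case True
      then have "k \<in> \<Gamma>" using J_\<Gamma> k by blast
      then have "Per None k \<in> cone.\<L>" using k by (simp add: letters_def)
      then show ?thesis using Per by (intro bexI[of _ "Per None k"]) simp_all
    next
      case False
      then have "Per (Some i) k \<in> (\<Union>j\<in>I'. Per j ` (H' j - {\<one>}))"
        using k by (intro UN_I[of "Some i"]) auto
      then have "Per (Some i) k \<in> cone.\<L>" by (simp add: letters_def)
      then show ?thesis using Per by (intro bexI[of _ "Per (Some i) k"]) simp_all
    qed
  qed
  then obtain b where "b \<in> cone.\<L>" "letter_val b = letter_val a" by blast
  then show "e \<in> cone.steps" unfolding cone.steps_def using e(1,2) by force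
qed

lemma cone_gdist_le:
  assumes "x \<in> carrier G" "y \<in> carrier G"
  shows "cone.gdist x y \<le> base.gdist x y"
proof (rule cone.dist_le_relpow[OF assms(1)])
  have "(x, y) \<in> base.steps ^^ base.gdist x y" by (rule base.dist_relpow[OF assms])
  then show "(x, y) \<in> cone.steps ^^ base.gdist x y" using base_steps unfolding relpow_fun_conv by blast
qed

lemma cone_letter_cases:
  assumes "a \<in> cone.\<L>"
  obtains (Gen) s where "a = Gen s" "s \<in> X" | (Per) i k where "a = Per (Some i) k" "i \<in> I - J" "k \<in> H i"
  | (Cone) k where "a = Per None k" "k \<in> \<Gamma>"
  using assms
proof (cases rule: cone.letter_cases)
  case (Gen s)
  then show ?thesis using that(1) by blast
next
  case (Per i h)
  then show ?thesis using that(2,3) by auto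
qed

lemma base_edge:
  assumes "u \<in> carrier G" "(\<exists>s\<in>X. v = u \<otimes> s) \<or> (\<exists>i\<in>I. \<exists>k\<in>H i. v = u \<otimes> k)"
  shows "v \<in> carrier G" "base.gdist u v \<le> 1"
proof -
  show v: "v \<in> carrier G"
    using assms base.X_carrier subgroup.mem_carrier[OF base.peripheral_subgroup] by auto
  from assms(2) show "base.gdist u v \<le> 1"
  proof
    assume "\<exists>s\<in>X. v = u \<otimes> s"
    then obtain s where s: "s \<in> X" "v = u \<otimes> s" by blast
    then have "Gen s \<in> base.\<L>" by (simp add: letters_def)
    then have "(u, v) \<in> base.steps" unfolding base.steps_def using assms(1) s by force
    then show ?thesis using base.dist_le_1[OF assms(1) v] by blast
  next
    assume "\<exists>i\<in>I. \<exists>k\<in>H i. v = u \<otimes> k"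
    then obtain i k where k: "i \<in> I" "k \<in> H i" "v = u \<otimes> k" by blast
    note K = base.peripheral_subgroup[OF k(1)]
    show ?thesis
      using base.coset_diam[OF k(1) assms(1) base.lcoset_self[OF K assms(1)] base.lcoset_mult[OF K assms(1) k(2)]] k(3)
      by simp
  qed
qed

lemma cone_interval_bounded:
  "\<exists>h. \<forall>x\<in>carrier G. \<forall>y\<in>carrier G. \<forall>v\<in>base.interval x y. cone.gdist x y \<le> 1 \<longrightarrow> cone.gdist x v \<le> h"
proof -
  obtain N where N: "\<forall>x\<in>carrier G. \<forall>y\<in>carrier G. d x y \<le> \<sigma> \<longrightarrow> base.gdist x y \<le> N"
    using gdist_of_metric[of \<sigma>] ..
  have "cone.gdist x v \<le> N + 1"
    if xy: "x \<in> carrier G" "y \<in> carrier G" and v: "v \<in> base.interval x y" and d1: "cone.gdist x y \<le> 1" for x y v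
  proof -
    have vc: "v \<in> carrier G" by (rule base.interval_V[OF v])
    have le: ?thesis if "base.gdist x y \<le> 1"
      using cone_gdist_le[OF xy(1) vc] base.interval_dist_le(1)[OF v] that by linarith
    show ?thesis
    proof (cases "x = y")
      case True
      then show ?thesis using le xy by simp
    next
      case False
      then obtain a where a: "a \<in> cone.\<L>" "y = x \<otimes> letter_val a"
        using cone.dist_le_1[OF xy] d1 by (auto simp: cone.steps_def)
      from a(1) show ?thesis
      proof (cases rule: cone_letter_cases)
        case (Gen s)
        then show ?thesis using a(2) by (intro le base_edge(2)[OF xy(1)]) auto
      next
        case (Per i k)
        then show ?thesis using a(2) by (intro le base_edge(2)[OF xy(1)]) auto
      next
        case (Cone k)
        let ?B = "x <# \<Gamma>"
        note B = \<Gamma>_coset[OF xy(1)]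
        have "y \<in> ?B" using base.lcoset_mult[OF \<Gamma>_subgroup xy(1)] Cone a(2) by simp
        then obtain w where w: "w \<in> ?B" "d v w \<le> \<sigma>" using \<Gamma>_coset_quasiconvex[OF B(1,2) _ v] by blast
        have wc: "w \<in> carrier G" by (rule \<Gamma>_cosetE(2)[OF B(1) w(1)])
        have "base.gdist v w \<le> N" using N vc wc w(2) by blast
        then have "cone.gdist w v \<le> N" using cone_gdist_le[OF vc wc] cone.sym[OF wc vc] by linarith
        moreover have "cone.gdist x w \<le> 1" using cone.coset_diam[of None x x w] xy(1) B(2) w(1) by simp
        moreover have "cone.gdist x v \<le> cone.gdist x w + cone.gdist w v" using xy wc vc by (intro cone.tri)
        ultimately show ?thesis by linarith
      qed
    qed
  qed
  then show ?thesis by blast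
qed

lemma cone_coned_space: obtains h where "coned_space (carrier G) base.gdist cone.gdist \<delta> h"
proof -
  obtain h where h: "\<forall>x\<in>carrier G. \<forall>y\<in>carrier G. \<forall>v\<in>base.interval x y. cone.gdist x y \<le> 1 \<longrightarrow> cone.gdist x v \<le> h"
    using cone_interval_bounded ..
  interpret slim_space "carrier G" base.gdist \<delta> by (rule base_slim)
  have "coned_space (carrier G) base.gdist cone.gdist \<delta> h"
    by unfold_locales (use cone_gdist_le h in auto)
  then show ?thesis by (rule that)
qed

text \<open>An element of both groups labels two edges from \<open>\<one>\<close> with the same endpoint, and these form a loop of
  length two.\<close>

lemma peripheral_intersection_finite:
  assumes "i \<in> I" "j \<in> I" "i \<noteq> j"
  shows "finite (H i \<inter> H j)"
proof -
  obtain r where r: "\<forall>i\<in>I. \<forall>x\<in>carrier G. \<forall>y \<in> x <# H i. \<forall>n\<le>1.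
      (x, y) \<in> base.off i (x <# H i) ^^ n \<longrightarrow> d x y \<le> r"
    using base_fine unfolding base.fine_wrt_def by blast
  note K = base.peripheral_subgroup[OF assms(1)]
  have "k \<in> insert \<one> {g \<in> carrier G. d \<one> g \<le> r}" if k: "k \<in> H i" "k \<in> H j" for k
  proof (cases "k = \<one>")
    case False
    have kc: "k \<in> carrier G" using subgroup.mem_carrier[OF K k(1)] .
    have "Per j k \<in> base.\<L>" using assms(2) k False by (auto simp: letters_def)
    then have "(\<one>, k) \<in> base.off i (\<one> <# H i)" unfolding base.off_def using assms(3) kc by force
    then have "(\<one>, k) \<in> base.off i (\<one> <# H i) ^^ 1" by simp
    moreover have "k \<in> \<one> <# H i" using base.lcoset_mult[OF K one_closed k(1)] kc by simp
    moreover have "(1::nat) \<le> 1" by simp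
    ultimately have "d \<one> k \<le> r" using r assms(1) one_closed by blast
    then show ?thesis using kc by simp
  qed simp
  then have "H i \<inter> H j \<subseteq> insert \<one> {g \<in> carrier G. d \<one> g \<le> r}" by blast
  then show ?thesis using finite_ball finite_subset by blast
qed

text \<open>Project the loop to the coset.  An edge of type \<open>\<Gamma>\<close> lies in another coset, so \<open>nearest_bounded\<close> applies
  to it, as it does to an edge of the original graph unless both endpoints are in the coset; then its
  label belongs to a finite set.\<close>

lemma cone_fine_\<Gamma>:
  "\<exists>r. \<forall>x\<in>carrier G. \<forall>y \<in> x <# \<Gamma>. \<forall>n\<le>N. (x, y) \<in> cone.off None (x <# \<Gamma>) ^^ n \<longrightarrow> d x y \<le> r"
proof -
  obtain R where "\<forall>B\<in>\<Gamma>_cosets. \<forall>z\<in>carrier G. \<forall>z'\<in>carrier G.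
     base.gdist z z' \<le> 1 \<and> \<not> (z \<in> B \<and> z' \<in> B) \<or> (\<exists>B'\<in>\<Gamma>_cosets. B' \<noteq> B \<and> z \<in> B' \<and> z' \<in> B') \<longrightarrow>
     d (fam.nearest B z) (fam.nearest B z') \<le> R" using fam.nearest_bounded ..
  note R = this[rule_format]
  have "finite (\<Gamma> \<inter> H i)" if "i \<in> I - J" for i
  proof -
    have "conjugate_set G \<one> \<Gamma> = \<Gamma>"
      using subgroup.subset[OF \<Gamma>_subgroup] by (simp add: conjugate_set_def lcos_mult_one coset_mult_one)
    then show ?thesis using thin[OF one_closed that] by simp
  qed
  then have "finite (X \<union> (\<Union>i\<in>I - J. \<Gamma> \<inter> H i))" using base.X_finite I_finite
    by (intro finite_UnI finite_UN_I) auto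
  then obtain r where r: "r \<ge> 0" "\<forall>g \<in> X \<union> (\<Union>i\<in>I - J. \<Gamma> \<inter> H i). d \<one> g \<le> r" using finite_bounded by blast
  have "d x y \<le> real N * (\<bar>R\<bar> + r)"
    if x: "x \<in> carrier G" and y: "y \<in> x <# \<Gamma>" and n: "n \<le> N" and xy: "(x, y) \<in> cone.off None (x <# \<Gamma>) ^^ n" for x y n
  proof -
    let ?B = "x <# \<Gamma>"
    note B = \<Gamma>_coset[OF x]
    let ?\<pi> = "fam.nearest ?B"
    have step: "v \<in> carrier G \<and> d (?\<pi> u) (?\<pi> v) \<le> \<bar>R\<bar> + r" if uv: "(u, v) \<in> cone.off None ?B" and u: "u \<in> carrier G" for u v
    proof -
      obtain a where a: "a \<in> cone.\<L>" "v = u \<otimes> letter_val a" "\<not> (u \<in> ?B \<and> (\<exists>h. a = Per None h))"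
        using uv by (auto simp: cone.off_def)
      have v: "v \<in> carrier G" using a u cone.letter_carrier by simp
      have base: "d (?\<pi> u) (?\<pi> v) \<le> \<bar>R\<bar> + r"
        if b: "base.gdist u v \<le> 1" and s: "v = u \<otimes> s" "s \<in> carrier G" "s \<in> \<Gamma> \<Longrightarrow> d \<one> s \<le> r" for s
      proof (cases "u \<in> ?B \<and> v \<in> ?B")
        case True
        have e: "inv u \<otimes> v = s" using s u by (simp add: m_assoc[symmetric])
        then have "s \<in> \<Gamma>" using \<Gamma>_coset_diff[OF B(1), of u v] True by simp
        then have "d u v \<le> r" using s(3) metric_norm[OF u v] e by simp
        then show ?thesis using fam.nearest_id[OF B(1)] True by simp
      next
        case False
        then have "d (?\<pi> u) (?\<pi> v) \<le> R" using b by (intro R[OF B(1) u v]) blast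
        then show ?thesis using r(1) by linarith
      qed
      from a(1) have "d (?\<pi> u) (?\<pi> v) \<le> \<bar>R\<bar> + r"
      proof (cases rule: cone_letter_cases)
        case (Gen s)
        then show ?thesis using a(2) r(2) base.X_carrier
          by (intro base[of s] base_edge(2)[OF u]) auto
      next
        case (Per i k)
        then have "k \<in> carrier G" using subgroup.mem_carrier[OF base.peripheral_subgroup] by blast
        then show ?thesis using a(2) r(2) Per by (intro base[of k] base_edge(2)[OF u]) auto
      next
        case (Cone k)
        let ?B' = "u <# \<Gamma>"
        have "u \<notin> ?B" using a(3) Cone by blast
        then have "?B' \<noteq> ?B" using \<Gamma>_coset(2)[OF u] by blast
        moreover have "v \<in> ?B'" using base.lcoset_mult[OF \<Gamma>_subgroup u Cone(2)] a(2) Cone(1) by simp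
        ultimately have "d (?\<pi> u) (?\<pi> v) \<le> R" using \<Gamma>_coset[OF u] by (intro R[OF B(1) u v]) blast
        then show ?thesis using r(1) by linarith
      qed
      then show ?thesis using v by simp
    qed
    have "y \<in> carrier G \<and> d (?\<pi> x) (?\<pi> y) \<le> real n * (\<bar>R\<bar> + r)"
      by (rule metric_along_relpow[OF xy x fam.nearest(3)[OF B(1)] step])
    then have "d (?\<pi> x) (?\<pi> y) \<le> real n * (\<bar>R\<bar> + r)" ..
    also have "\<dots> \<le> real N * (\<bar>R\<bar> + r)" using n r(1) by (intro mult_right_mono) auto
    finally show ?thesis using fam.nearest_id[OF B(1)] B(2) y by simp
  qed
  then show ?thesis by blast
qed

text \<open>As before, now with the projection to the coset of \<open>H i\<close>.  Along an edge of type \<open>\<Gamma>\<close> the projection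
  moves little because coarse intersections with cosets of \<open>\<Gamma>\<close> are bounded, and labels of other
  edges inside the coset are in \<open>X\<close> or in some \<open>H i \<inter> H j\<close> with \<open>j \<noteq> i\<close>.\<close>

lemma cone_fine_peripheral:
  "\<exists>r\<ge>0. \<forall>i\<in>I - J. \<forall>x\<in>carrier G. \<forall>y \<in> x <# H i. \<forall>n\<le>N.
     (x, y) \<in> cone.off (Some i) (x <# H i) ^^ n \<longrightarrow> d x y \<le> r"
proof -
  obtain R0 where "\<forall>P\<in>peripheral_cosets. \<forall>z\<in>carrier G. \<forall>z'\<in>carrier G.
    fam.meets_once P z z' \<longrightarrow> d (fam.proj P z) (fam.proj P z') \<le> R0" using fam.proj_bounded_if_meets_once ..
  note R0 = this[rule_format]
  obtain k where k: "\<forall>B\<in>\<Gamma>_cosets. \<forall>i\<in>I - J. \<forall>z\<in>carrier G. \<forall>x \<in> z <# H i. \<forall>y \<in> z <# H i.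
     (\<exists>b\<in>B. d x b \<le> \<sigma>) \<longrightarrow> (\<exists>b\<in>B. d y b \<le> \<sigma>) \<longrightarrow> d x y \<le> k" using \<Gamma>_peripheral_separated[of \<sigma>] by blast
  obtain R1 where "\<forall>P\<in>peripheral_cosets. \<forall>z\<in>carrier G. \<forall>z'\<in>carrier G.
    (\<forall>a\<in>base.interval z z' \<inter> P. \<forall>b\<in>base.interval z z' \<inter> P. d a b \<le> k) \<longrightarrow>
     d (fam.proj P z) (fam.proj P z') \<le> R1" using fam.proj_bounded[of k] ..
  note R1 = this[rule_format]
  define T where "T = X \<union> (\<Union>i\<in>I. \<Union>j\<in>I - {i}. H i \<inter> H j)"
  have "finite T" unfolding T_def using base.X_finite I_finite peripheral_intersection_finite
    by (intro finite_UnI finite_UN_I) auto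
  then obtain r where r: "r \<ge> 0" "\<forall>g\<in>T. d \<one> g \<le> r" using finite_bounded by blast
  define R where "R = \<bar>R0\<bar> + \<bar>R1\<bar> + r"
  have "d x y \<le> real N * R"
    if i: "i \<in> I - J" and x: "x \<in> carrier G" and y: "y \<in> x <# H i" and n: "n \<le> N"
      and xy: "(x, y) \<in> cone.off (Some i) (x <# H i) ^^ n" for i x y n
  proof -
    let ?P = "x <# H i"
    have iI: "i \<in> I" using i by blast
    note K = base.peripheral_subgroup[OF iI]
    have P: "?P \<in> peripheral_cosets" using x iI by (auto simp: peripheral_cosets_def)
    let ?\<pi> = "fam.proj ?P"
    have step: "v \<in> carrier G \<and> d (?\<pi> u) (?\<pi> v) \<le> R" if uv: "(u, v) \<in> cone.off (Some i) ?P" and u: "u \<in> carrier G" for u v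
    proof -
      obtain a where a: "a \<in> cone.\<L>" "v = u \<otimes> letter_val a" "\<not> (u \<in> ?P \<and> (\<exists>h. a = Per (Some i) h))"
        using uv by (auto simp: cone.off_def)
      have v: "v \<in> carrier G" using a u cone.letter_carrier by simp
      have base: "d (?\<pi> u) (?\<pi> v) \<le> R"
        if b: "base.gdist u v \<le> 1" and s: "v = u \<otimes> s" "s \<in> carrier G" "u \<in> ?P \<Longrightarrow> s \<in> H i \<Longrightarrow> s \<in> T" for s
      proof (cases "u \<in> ?P \<and> v \<in> ?P")
        case True
        have e: "inv u \<otimes> v = s" using s u by (simp add: m_assoc[symmetric])
        have "u <# H i = ?P" using base.lcoset_eq[OF K x] True by simp
        then have "s \<in> H i" using base.mem_lcoset[OF K u, of v] True e by simp
        then have "d u v \<le> r" using s(3) r(2) metric_norm[OF u v] e True by simp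
        then show ?thesis using fam.proj_id[OF P] True by (simp add: R_def)
      next
        case False
        then have "d (?\<pi> u) (?\<pi> v) \<le> R0" by (intro R0[OF P u v] fam.meets_once_edge[OF u v b])
        then show ?thesis using r(1) by (simp add: R_def)
      qed
      from a(1) have "d (?\<pi> u) (?\<pi> v) \<le> R"
      proof (cases rule: cone_letter_cases)
        case (Gen s)
        then show ?thesis using a(2) base.X_carrier
          by (intro base[of s] base_edge(2)[OF u]) (auto simp: T_def)
      next
        case (Per j s)
        then have "s \<in> carrier G" using subgroup.mem_carrier[OF base.peripheral_subgroup] by blast
        moreover have "s \<in> T" if "u \<in> ?P" "s \<in> H i"
        proof -
          have "j \<noteq> i" using a(3) that Per by blast
          then show ?thesis using that Per iI by (auto simp: T_def)
        qed
        ultimately show ?thesis using a(2) Per by (intro base[of s] base_edge(2)[OF u]) auto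
      next
        case (Cone s)
        let ?B = "u <# \<Gamma>"
        note B = \<Gamma>_coset[OF u]
        have vB: "v \<in> ?B" using base.lcoset_mult[OF \<Gamma>_subgroup u Cone(2)] a(2) Cone(1) by simp
        have "d (?\<pi> u) (?\<pi> v) \<le> R1"
        proof (rule R1[OF P u v])
          fix p q assume pq: "p \<in> base.interval u v \<inter> ?P" "q \<in> base.interval u v \<inter> ?P"
          then have "\<exists>b\<in>?B. d p b \<le> \<sigma>" "\<exists>b\<in>?B. d q b \<le> \<sigma>" using \<Gamma>_coset_quasiconvex[OF B vB] by blast+
          then show "d p q \<le> k" using k B(1) i x pq by blast
        qed
        then show ?thesis using r(1) by (simp add: R_def)
      qed
      then show ?thesis using v by simp
    qed
    have "y \<in> carrier G \<and> d (?\<pi> x) (?\<pi> y) \<le> real n * R"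
      by (rule metric_along_relpow[OF xy x fam.proj_V[OF P] step])
    then have "d (?\<pi> x) (?\<pi> y) \<le> real n * R" ..
    also have "\<dots> \<le> real N * R" using n r(1) by (intro mult_right_mono) (auto simp: R_def)
    finally show ?thesis using fam.proj_id[OF P] base.lcoset_self[OF K x] y by simp
  qed
  moreover have "real N * R \<ge> 0" using r(1) by (simp add: R_def)
  ultimately show ?thesis by blast
qed

lemma cone_fine: "cone.fine_wrt d"
  unfolding cone.fine_wrt_def
proof
  fix N
  obtain r1 where r1: "\<forall>x\<in>carrier G. \<forall>y \<in> x <# \<Gamma>. \<forall>n\<le>N. (x, y) \<in> cone.off None (x <# \<Gamma>) ^^ n \<longrightarrow> d x y \<le> r1"
    using cone_fine_\<Gamma>[of N] ..
  obtain r2 where r2: "\<forall>i\<in>I - J. \<forall>x\<in>carrier G. \<forall>y \<in> x <# H i. \<forall>n\<le>N.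
     (x, y) \<in> cone.off (Some i) (x <# H i) ^^ n \<longrightarrow> d x y \<le> r2" using cone_fine_peripheral[of N] by blast
  have "d x y \<le> max r1 r2"
    if i: "i \<in> I'" and xy: "x \<in> carrier G" "y \<in> x <# H' i" "n \<le> N" "(x, y) \<in> cone.off i (x <# H' i) ^^ n" for i x y n
  proof (cases i)
    case None
    have "d x y \<le> r1" using r1 xy unfolding None option.case by blast
    then show ?thesis by simp
  next
    case (Some j)
    then have "j \<in> I - J" using i by auto
    then have "d x y \<le> r2" using r2 xy unfolding Some option.case by blast
    then show ?thesis by simp
  qed
  then show "\<exists>r. \<forall>i\<in>I'. \<forall>x\<in>carrier G. \<forall>y \<in> x <# H' i. \<forall>n\<le>N.
     (x, y) \<in> cone.off i (x <# H' i) ^^ n \<longrightarrow> d x y \<le> r" by blast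
qed

lemma cone_hyperbolic: "hyperbolic_graph cone.\<C>"
proof -
  obtain h where "coned_space (carrier G) base.gdist cone.gdist \<delta> h" by (rule cone_coned_space)
  then interpret M: coned_space "carrier G" base.gdist cone.gdist \<delta> h .
  from M.coned_slim obtain R where R: "\<forall>f g k m n q.
     M.quasi_seq 1 0 f m \<longrightarrow> M.quasi_seq 1 0 g n \<longrightarrow> M.quasi_seq 1 0 k q \<longrightarrow>
     f m = g 0 \<longrightarrow> g n = k 0 \<longrightarrow> k q = f 0 \<longrightarrow>
     (\<forall>i\<le>m. (\<exists>j\<le>n. cone.gdist (f i) (g j) \<le> R) \<or> (\<exists>j\<le>q. cone.gdist (f i) (k j) \<le> R))" ..
  note R = R[rule_format]
  have quasi: "M.quasi_seq 1 0 (cone.vert x p) (length p)" if "geodesic cone.\<C> x p y" for x p y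
    using cone.geodesic_seqD[OF cone.geodesic_walk_seq(1)[OF that]] by (simp add: M.quasi_seq_def)
  have "\<exists>w \<in> set (pre_digraph.awalk_verts cone.\<C> y q) \<union> set (pre_digraph.awalk_verts cone.\<C> z r).
      real (cone.gdist v w) \<le> real R"
    if g: "geodesic cone.\<C> x p y" "geodesic cone.\<C> y q z" "geodesic cone.\<C> z r x"
      and v: "v \<in> set (pre_digraph.awalk_verts cone.\<C> x p)" for x y z p q r v
  proof -
    obtain i where i: "i \<le> length p" "v = cone.vert x p i" using v by (auto simp: cone.walk_verts)
    note w = cone.geodesic_walk_seq(2)[OF g(1)] cone.geodesic_walk_seq(2)[OF g(2)] cone.geodesic_walk_seq(2)[OF g(3)]
    have "(\<exists>j\<le>length q. cone.gdist v (cone.vert y q j) \<le> R) \<or> (\<exists>j\<le>length r. cone.gdist v (cone.vert z r j) \<le> R)"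
      unfolding i(2) using w i(1)
      by (intro R[OF quasi[OF g(1)] quasi[OF g(2)] quasi[OF g(3)]]) (simp_all add: cone.vert_0 cone.vert_length)
    then show ?thesis by (auto simp: cone.walk_verts)
  qed
  then show ?thesis unfolding hyperbolic_graph_def by (intro exI[of _ "real R"]) auto
qed

lemma cone_BCP: "BCP G I' H' X"
proof -
  obtain h where "coned_space (carrier G) base.gdist cone.gdist \<delta> h" by (rule cone_coned_space)
  then interpret M: coned_space "carrier G" base.gdist cone.gdist \<delta> h .
  interpret S: stable_relative_graph G I' H' X base.gdist \<delta> h d
    by unfold_locales (use proper_metric cone_fine in auto)
  show ?thesis by (rule S.BCP)
qed

lemma cone_hyperbolic_relative: "hyperbolic_relative_to G I' H'"
  using cone.generating cone_hyperbolic cone_BCP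
  unfolding hyperbolic_relative_to_def hyperbolic_relative_wrt_def by blast

end

theorem theorem3p10:
  fixes G :: "('a, 'b) monoid_scheme"
    and I J :: "'i set"
    and H :: "'i \<Rightarrow> 'a set"
    and \<Gamma> :: "'a set"
  assumes "group G"
    and "countable (carrier G)"
    and "finite I"
    and "\<And>i. i \<in> I \<Longrightarrow> subgroup (H i) G"
    and "hyperbolic_relative_to G I H"
    and "J \<subseteq> I"
    and "subgroup \<Gamma> G"
    and C0: "\<And>i. i \<in> J \<Longrightarrow> H i \<subseteq> \<Gamma>"
    and C1: "relatively_quasiconvex G I H \<Gamma>"
    and C2: "weakly_malnormal G \<Gamma>"
    and C3: "\<And>g i. g \<in> carrier G \<Longrightarrow> i \<in> I - J \<Longrightarrow> finite (conjugate_set G g \<Gamma> \<inter> H i)"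
  shows "hyperbolic_relative_to G (insert None (Some ` (I - J))) (case_option \<Gamma> H)"
proof -
  interpret group G by fact
  obtain X d' s where X: "hyperbolic_relative_wrt G I H X" and d': "proper_left_inv_metric G d'"
    and qc: "\<And>u v p x. u \<in> \<Gamma> \<Longrightarrow> v \<in> \<Gamma> \<Longrightarrow> geodesic (rel_cayley_graph G I H X) u p v \<Longrightarrow>
      x \<in> set (pre_digraph.awalk_verts (rel_cayley_graph G I H X) u p) \<Longrightarrow> \<exists>w\<in>\<Gamma>. d' x w < s"
    using C1 unfolding relatively_quasiconvex_def Let_def by blast
  interpret base: relative_graph G I H X
    using assms(1,4) X
    by (intro relative_graph.intro relative_graph_axioms.intro) (auto simp: hyperbolic_relative_wrt_def)
  obtain d where d: "proper_left_inv_metric G d" "base.fine_wrt d"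
    using base.BCP_imp_fine X by (auto simp: hyperbolic_relative_wrt_def)
  obtain \<delta> where \<delta>: "slim_space (carrier G) base.gdist \<delta>"
    using base.slim_space_if_hyperbolic X by (auto simp: hyperbolic_relative_wrt_def)
  interpret m: metric_group G d by unfold_locales (rule d(1))
  interpret m': metric_group G d' by unfold_locales (rule d')
  \<comment> \<open>Quasiconvexity is given for the metric \<open>d'\<close>; the balls of \<open>d'\<close> are finite, hence bounded for \<open>d\<close>.\<close>
  obtain \<sigma> where \<sigma>: "\<forall>g\<in>{g \<in> carrier G. d' \<one>\<^bsub>G\<^esub> g \<le> s}. d \<one>\<^bsub>G\<^esub> g \<le> \<sigma>"
    using m.finite_bounded[OF m'.finite_ball] by blast
  have qc': "\<exists>w\<in>\<Gamma>. d x w \<le> \<sigma>" if u: "u \<in> \<Gamma>" "v \<in> \<Gamma>" and x: "x \<in> base.interval u v" for u v x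
  proof -
    have V: "u \<in> carrier G" "v \<in> carrier G" "x \<in> carrier G"
      using u subgroup.mem_carrier[OF assms(7)] base.interval_V[OF x] by blast+
    obtain p where "geodesic base.\<C> u p v" "x \<in> set (pre_digraph.awalk_verts base.\<C> u p)"
      by (rule base.geodesic_through[OF V(1,2) x])
    then obtain w where w: "w \<in> \<Gamma>" "d' x w < s" using qc u by blast
    have wc: "w \<in> carrier G" using subgroup.mem_carrier[OF assms(7) w(1)] .
    have "d x w \<le> \<sigma>"
      using \<sigma> w(2) V wc m.metric_norm[OF V(3) wc] m'.metric_norm[OF V(3) wc] by simp
    then show ?thesis using w(1) by blast
  qed
  interpret \<delta>: slim_space "carrier G" base.gdist \<delta> by (rule \<delta>)
  interpret cone_setup G I J H \<Gamma> X d \<delta> \<sigma>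
    by (intro cone_setup.intro cone_setup_axioms.intro m.metric_group_axioms base.relative_graph_axioms)
      (use assms d \<delta> qc' in blast)+
  show ?thesis by (rule cone_hyperbolic_relative)
qed

end
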